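(* Let $A$ be a commutative associative unital $\mathbb{C}$-algebra with a fixed $\mathbb{C}$-basis $\mathbf{B}$, let $\mathfrak{g}=\mathfrak{sl}(2,1)$, and let $m\in\mathbb{Z}_{\ge 0}$. Let $\widetilde{W}_A(m\omega_1)$ be the $\mathfrak{g}\otimes A$-module with generator $\widetilde{w}_{m\omega_1}$ and let $\widetilde{S}^m(V\otimes A)$ be the $\mathbf{U}(\mathfrak{g}\otimes A)$-module of supersymmetrized tensors, both as defined in the context, and put $v:=(v_1\otimes 1)^{\otimes m}\in\widetilde{S}^m(V\otimes A)$. Then the assignment $\widetilde{w}_{m\omega_1}\mapsto v$ extends to an isomorphism $\Phi:\widetilde{W}_A(m\omega_1)\to\widetilde{S}^m(V\otimes A)$ of $\mathbf{U}(\mathfrak{g}\otimes A)$-modules. Moreover, the set $$\left\{p(\varphi_1,\varphi_2,\xi)\,\widetilde{w}_{m\omega_1}\ \big|\ \varphi_1,\varphi_2\in\mathcal{F}(\mathbf{B}),\ \xi\in\mathbf{B}^n,\ |\varphi_1|+|\varphi_2|+n=m\right\}$$ (where $n$ ranges over $\mathbb{Z}_{\ge0}$) is a $\mathbb{C}$-basis of $\widetilde{W}_A(m\omega_1)$.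
   Context: **Lie superalgebra.** $\mathfrak{g}=\mathfrak{sl}(2,1)$ is the Lie superalgebra of complex $3\times 3$ matrices $[a_{i,j}]$ with $a_{3,3}=a_{1,1}+a_{2,2}$; the even part is spanned by the entries in the diagonal blocks (sizes $2$ and $1$), the odd part by the entries in the off-diagonal blocks, with the supercommutator bracket. With $e_{i,j}$ the matrix units, put $h_1=e_{1,1}-e_{2,2}$, $h_2=e_{2,2}+e_{3,3}$, $x_1=e_{1,2}$, $x_{-1}=e_{2,1}$ (even), $x_2=e_{2,3}$, $x_{-2}=e_{3,2}$, $x_3=e_{1,3}$, $x_{-3}=e_{3,1}$ (odd). Put $\mathfrak{h}=\mathrm{span}\{h_1,h_2\}$, $\mathfrak{n}^{\pm}=\mathrm{span}\{x_{\pm1},x_{\pm2},x_{\pm3}\}$. Define $\omega_k\in\mathfrak{h}^*$ by $\omega_k(h_i)=\delta_{k,i}$, $i,k\in\{1,2\}$. **Map superalgebra.** $\mathfrak{g}\otimes A$ has even/odd parts $\mathfrak{g}_0\otimes A$, $\mathfrak{g}_1\otimes A$ and bracket $[z\otimes a,z'\otimes b]=[z,z']\otimes ab$. $\mathfrak{g}$ is embedded as $\mathfrak{g}\otimes 1$. $\mathbf{U}(\mathfrak{g}\otimes A)$ is its universal enveloping algebra. **The module $\widetilde{W}_A(m\omega_1)$.** It is the $\mathfrak{g}\otimes A$-module generated by a vector $\widetilde{w}_{m\omega_1}$ with defining relations $(\mathfrak{n}^+\otimes A)\widetilde{w}_{m\omega_1}=0$; $h\,\widetilde{w}_{m\omega_1}=(m\omega_1)(h)\,\widetilde{w}_{m\omega_1}$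 for all $h\in\mathfrak{h}$; $(x_{-1})^{m+1}\widetilde{w}_{m\omega_1}=0$; and $(x_{-2}\otimes a)\widetilde{w}_{m\omega_1}=0$ for all $a\in A$. (It is the quotient of the global Weyl module of highest weight $\lambda=m\omega_1$ by the relations that products of $\lambda(h_2)+1=1$ elements of $x_{-2}\otimes A$ kill the generator.) **Multisets.** For a set $S$, $\mathcal{F}(S)$ is the set of finitely supported functions $\chi:S\to\mathbb{Z}_{\ge0}$, with pointwise addition and pointwise partial order; $|\chi|=\sum_{s}\chi(s)$; $\chi_s$ is the characteristic function of $\{s\}$. $\mathcal{F}:=\mathcal{F}(A)$, $\mathcal{F}(\mathbf B)$ is viewed inside $\mathcal F$ (extension by zero), and $\mathcal{F}(\chi):=\{\psi\in\mathcal{F}:\psi\le\chi\}$ for $\chi\in\mathcal F$. For $\psi\in\mathcal{F}$: $\pi(\psi)=\prod_{a\in A}a^{\psi(a)}$ (so $\pi(0)=1$), $\mathcal{M}(\psi)=|\psi|!/\prod_{a}\psi(a)!$. $A^n$ is the set of functions $\{1,\dots,n\}\to A$, $A^0=\{\varnothing\}$; $\mathbf{B}^n\subset A^n$ is the set of those functions with values in $\mathbf{B}$. **Elements $p$.** For $\xi\in A^n$, $X_{-3}(\xi):=(x_{-3}\otimes\xi(1))\cdots(x_{-3}\otimes\xi(n))$, $X_{-3}(\varnothing)=1$. Define $p_1:\mathcal{F}^2\to\mathbf{U}(\mathfrak{g}\otimes A)$ recursively by $p_1(0,0)=1$; $$p_1(0,\chi)=-\frac1{|\chi|}\sum_{\psi\in\mathcal{F}(\chi)\setminus\{0\}}\mathcal{M}(\psi)(h_1\otimes\pi(\psi))\,p_1(0,\chi-\psi)\quad(\chi\ne0);$$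 $$p_1(\varphi,\chi)=-\frac1{|\varphi|}\sum_{d\in\mathrm{supp}\,\varphi}\ \sum_{\psi\in\mathcal{F}(\chi)}\mathcal{M}(\psi)(x_{-1}\otimes d\,\pi(\psi))\,p_1(\varphi-\chi_d,\chi-\psi)\quad(\varphi\neq0).$$ Set $p(\varphi_1,\varphi_2,\xi):=p_1(\varphi_2,\varphi_1)X_{-3}(\xi)$. **The module $\widetilde{S}^m(V\otimes A)$.** $V\cong\mathbb{C}^3$ is the natural $\mathfrak{g}$-module with standard basis $v_1$, $v_2=x_{-1}v_1$, $v_3=x_{-3}v_1$; $v_1,v_2$ are even and $v_3$ is odd. $V\otimes A$ is a $\mathfrak{g}\otimes A$-module via $(z\otimes a)(w\otimes b)=zw\otimes ab$, with parity from $V$. $T^m(V\otimes A)$ is the $m$-fold tensor power over $\mathbb{C}$, a $\mathbf{U}(\mathfrak{g}\otimes A)$-module via the usual super coproduct: homogeneous $z\in\mathfrak{g}\otimes A$ acts by $z\cdot(w_1\otimes\cdots\otimes w_m)=\sum_{j=1}^m(-1)^{\bar z(\bar w_1+\cdots+\bar w_{j-1})}w_1\otimes\cdots\otimes zw_j\otimes\cdots\otimes w_m$ for homogeneous $w_i$ (bars denote parities). $S_m$ acts on $T^m(V\otimes A)$ by $\sigma^{-1}(w_1\otimes\cdots\otimes w_m)=\gamma(w,\sigma)\,w_{\sigma(1)}\otimes\cdots\otimes w_{\sigma(m)}$ for homogeneous $w_i$, where $\gamma(w,\sigma)=\prod_{j<k,\ \sigma(j)>\sigma(k)}(-1)^{\bar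 w_{\sigma(j)}\bar w_{\sigma(k)}}$. $\widetilde{S}^m(V\otimes A)$ is the $\mathbb{C}$-span of all $\sum_{\sigma\in S_m}\sigma^{-1}(w_1\otimes\cdots\otimes w_m)$, $w_i\in V\otimes A$; it is a $\mathbf{U}(\mathfrak{g}\otimes A)$-submodule of $T^m(V\otimes A)$.
   Formalization: In the basis claim ξ ranges not over all words in B (for m≥2, A≠0 that set contains 0 and pairs x, −x, as the x₋₃⊗b anticommute and square to 0) but over any choice of exactly one repetition-free ordering of each finite subset of B. *)

theory Defs
  imports "HOL-Analysis.Analysis" "HOL-Library.Poly_Mapping" "HOL-Library.Multiset"
    "HOL-Library.Set_Algebras"
begin

section \<open>Complex vector spaces and algebras\<close>

class complex_vector = ab_group_add +
  fixes scaleC :: "complex \<Rightarrow> 'a \<Rightarrow> 'a"  (infixr \<open>*\<^sub>C\<close> 75)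
  assumes scaleC_add_right: "c *\<^sub>C (x + y) = c *\<^sub>C x + c *\<^sub>C y"
    and scaleC_add_left: "(c + d) *\<^sub>C x = c *\<^sub>C x + d *\<^sub>C x"
    and scaleC_scaleC: "c *\<^sub>C d *\<^sub>C x = (c * d) *\<^sub>C x"
    and scaleC_one: "1 *\<^sub>C x = x"

global_interpretation cvec: vector_space "scaleC :: complex \<Rightarrow> 'a \<Rightarrow> 'a::complex_vector"
  by unfold_locales (rule scaleC_add_right scaleC_add_left scaleC_scaleC scaleC_one)+

lemmas [simp] = cvec.scale_zero_left cvec.scale_zero_right cvec.scale_minus_left
  cvec.scale_minus_right scaleC_one

abbreviation clinear :: "('a::complex_vector \<Rightarrow> 'b::complex_vector) \<Rightarrow> bool" where
  "clinear \<equiv> Vector_Spaces.linear scaleC scaleC"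

lemma clinearI:
  fixes f :: "'a::complex_vector \<Rightarrow> 'b::complex_vector"
  assumes "\<And>x y. f (x + y) = f x + f y" "\<And>c x. f (c *\<^sub>C x) = c *\<^sub>C f x"
  shows "clinear f"
  using assms by unfold_locales auto

lemma clinear_add: "clinear f \<Longrightarrow> f (x + y) = f x + f y"
  and clinear_scale: "clinear f \<Longrightarrow> f (c *\<^sub>C x) = c *\<^sub>C f x"
  and clinear_0: "clinear f \<Longrightarrow> f 0 = 0"
  and clinear_diff: "clinear f \<Longrightarrow> f (x - y) = f x - f y"
  and clinear_sum: "clinear f \<Longrightarrow> f (sum g S) = (\<Sum>a\<in>S. f (g a))"
  by (simp_all add: linear_iff_module_hom module_hom.add module_hom.scale module_hom.zero
      module_hom.diff module_hom.sum)

text \<open>The unit is not required to differ from zero, so that the zero algebra is included.\<close>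

class complex_algebra = complex_vector + ring + monoid_mult +
  assumes scaleC_mult_left: "(c *\<^sub>C x) * y = c *\<^sub>C (x * y)"
    and scaleC_mult_right: "x * (c *\<^sub>C y) = c *\<^sub>C (x * y)"

class complex_comm_algebra = complex_algebra + comm_ring + comm_monoid_mult

instantiation complex :: complex_comm_algebra
begin
definition scaleC_complex :: "complex \<Rightarrow> complex \<Rightarrow> complex" where "scaleC_complex = (*)"
instance by standard (simp_all add: scaleC_complex_def algebra_simps)
end

instantiation vec :: (complex_vector, finite) complex_vector
begin
definition scaleC_vec :: "complex \<Rightarrow> ('a, 'b) vec \<Rightarrow> ('a, 'b) vec" where
  "c *\<^sub>C x = (\<chi> i. c *\<^sub>C x $ i)"
instance
  by standard (simp_all add: scaleC_vec_def vec_eq_iff scaleC_add_right scaleC_add_left scaleC_scaleC)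
end

instantiation poly_mapping :: (type, complex_vector) complex_vector
begin
lift_definition scaleC_poly_mapping :: "complex \<Rightarrow> ('a \<Rightarrow>\<^sub>0 'b) \<Rightarrow> ('a \<Rightarrow>\<^sub>0 'b)"
  is "\<lambda>c f x. c *\<^sub>C f x"
  by (erule finite_subset[rotated]) auto
instance
  by standard (transfer; simp add: fun_eq_iff scaleC_add_right scaleC_add_left scaleC_scaleC)+
end

section \<open>Free vector spaces, and quotients of them\<close>

text \<open>The free complex vector space on \<^typ>\<open>'x\<close> is \<^typ>\<open>'x \<Rightarrow>\<^sub>0 complex\<close>.\<close>

abbreviation delta :: "'x \<Rightarrow> 'x \<Rightarrow>\<^sub>0 complex" where
  "delta x \<equiv> Poly_Mapping.single x 1"

definition lin_ext :: "('x \<Rightarrow> 'm::complex_vector) \<Rightarrow> ('x \<Rightarrow>\<^sub>0 complex) \<Rightarrow> 'm" where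
  "lin_ext f p = (\<Sum>x\<in>Poly_Mapping.keys p. Poly_Mapping.lookup p x *\<^sub>C f x)"

lemma lookup_scaleC: "Poly_Mapping.lookup (c *\<^sub>C p) x = c *\<^sub>C Poly_Mapping.lookup p x"
  by (simp add: scaleC_poly_mapping.rep_eq)

lemma lin_ext_superset:
  assumes "finite S" "Poly_Mapping.keys p \<subseteq> S"
  shows "lin_ext f p = (\<Sum>x\<in>S. Poly_Mapping.lookup p x *\<^sub>C f x)"
  unfolding lin_ext_def using assms by (intro sum.mono_neutral_left) (auto simp: in_keys_iff)

lemma lin_ext_linear: "clinear (lin_ext f)"
proof (rule clinearI)
  fix p q :: "'a \<Rightarrow>\<^sub>0 complex" and c
  let ?S = "Poly_Mapping.keys p \<union> Poly_Mapping.keys q"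
  have "Poly_Mapping.keys (p + q) \<subseteq> ?S" by (rule Poly_Mapping.keys_add)
  then show "lin_ext f (p + q) = lin_ext f p + lin_ext f q"
    by (simp add: lin_ext_superset[of ?S] lookup_add scaleC_add_left sum.distrib)
  have "Poly_Mapping.keys (c *\<^sub>C p) \<subseteq> Poly_Mapping.keys p"
    by (auto simp: in_keys_iff lookup_scaleC)
  then show "lin_ext f (c *\<^sub>C p) = c *\<^sub>C lin_ext f p"
    by (simp add: lin_ext_superset[of "Poly_Mapping.keys p"] lookup_scaleC cvec.scale_sum_right
        scaleC_scaleC scaleC_complex_def)
qed

lemma lin_ext_single [simp]: "lin_ext f (Poly_Mapping.single x c) = c *\<^sub>C f x"
  by (cases "c = 0") (simp_all add: lin_ext_def)

lemma lin_ext_fun_add: "lin_ext (\<lambda>x. f x + g x) p = lin_ext f p + lin_ext g p"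
  by (simp add: lin_ext_def scaleC_add_right sum.distrib)

lemma lin_ext_fun_scale: "lin_ext (\<lambda>x. c *\<^sub>C f x) p = c *\<^sub>C lin_ext f p"
  by (simp add: lin_ext_def cvec.scale_sum_right scaleC_scaleC mult.commute)

lemma lin_ext_comp: "clinear g \<Longrightarrow> lin_ext (\<lambda>x. g (f x)) p = g (lin_ext f p)"
  by (simp add: lin_ext_def clinear_sum clinear_scale)

lemma lin_ext_id: "lin_ext (\<lambda>x. Poly_Mapping.single x 1) p = p"
  by (rule poly_mapping_eqI)
    (simp add: lin_ext_def lookup_sum lookup_scaleC lookup_single scaleC_complex_def when_def
      in_keys_iff sum.delta if_distrib[of "(*) _"] cong: if_cong)

lemma free_induct [case_names scale add]:
  assumes scale: "\<And>c x. P (c *\<^sub>C delta x)" and add: "\<And>p q. P p \<Longrightarrow> P q \<Longrightarrow> P (p + q)"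
  shows "P p"
proof -
  have "P (\<Sum>x\<in>S. Poly_Mapping.lookup p x *\<^sub>C delta x)" if "finite S" for S
    using that
  proof induction
    case empty
    show ?case using scale[of 0] by simp
  next
    case (insert x S)
    then show ?case by (simp add: add scale)
  qed
  from this[of "Poly_Mapping.keys p"] show ?thesis
    using lin_ext_id[of p] by (simp add: lin_ext_def)
qed

lemma clinear_vanish_on_span:
  assumes "clinear f" "\<And>r. r \<in> R \<Longrightarrow> f r = 0" "x \<in> cvec.span R"
  shows "f x = 0"
  using assms(3) by (induction rule: cvec.span_induct_alt)
    (simp_all add: assms clinear_0 clinear_add clinear_scale)

lemma equivp_mod_subspace: "cvec.subspace N \<Longrightarrow> equivp (\<lambda>x y. x - y \<in> N)"
proof (rule equivpI)
  assume N: "cvec.subspace N"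
  show "reflp (\<lambda>x y. x - y \<in> N)" using cvec.subspace_0[OF N] by (simp add: reflp_def)
  show "symp (\<lambda>x y. x - y \<in> N)"
    using cvec.subspace_neg[OF N] by (fastforce simp: symp_def)
  show "transp (\<lambda>x y. x - y \<in> N)"
    using cvec.subspace_add[OF N] by (fastforce simp: transp_def)
qed

section \<open>Tensor products over the complex numbers\<close>

inductive_set tensor_relations :: "(('v::complex_vector \<times> 'w::complex_vector) \<Rightarrow>\<^sub>0 complex) set" where
  "delta (v + v', w) - (delta (v, w) + delta (v', w)) \<in> tensor_relations"
| "delta (v, w + w') - (delta (v, w) + delta (v, w')) \<in> tensor_relations"
| "delta (c *\<^sub>C v, w) - c *\<^sub>C delta (v, w) \<in> tensor_relations"
| "delta (v, c *\<^sub>C w) - c *\<^sub>C delta (v, w) \<in> tensor_relations"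

quotient_type (overloaded) ('v, 'w) tensor =
  "('v::complex_vector \<times> 'w::complex_vector) \<Rightarrow>\<^sub>0 complex" /
  "\<lambda>p q. p - q \<in> cvec.span tensor_relations"
  by (rule equivp_mod_subspace) (rule cvec.subspace_span)

instantiation tensor :: (complex_vector, complex_vector) complex_vector
begin
lift_definition zero_tensor :: "('a, 'b) tensor" is 0 .
lift_definition plus_tensor :: "('a, 'b) tensor \<Rightarrow> ('a, 'b) tensor \<Rightarrow> ('a, 'b) tensor" is "(+)"
  using cvec.span_add by (fastforce simp: algebra_simps)
lift_definition minus_tensor :: "('a, 'b) tensor \<Rightarrow> ('a, 'b) tensor \<Rightarrow> ('a, 'b) tensor" is "(-)"
  using cvec.span_diff by (fastforce simp: algebra_simps)
lift_definition uminus_tensor :: "('a, 'b) tensor \<Rightarrow> ('a, 'b) tensor" is uminus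
  using cvec.span_neg by fastforce
lift_definition scaleC_tensor :: "complex \<Rightarrow> ('a, 'b) tensor \<Rightarrow> ('a, 'b) tensor" is scaleC
  using cvec.span_scale by (fastforce simp: cvec.scale_right_diff_distrib[symmetric])
instance
  by standard (transfer; simp add: cvec.span_zero algebra_simps scaleC_add_right scaleC_add_left scaleC_scaleC)+
end

lift_definition pure_tensor :: "'v::complex_vector \<Rightarrow> 'w::complex_vector \<Rightarrow> ('v, 'w) tensor"
  (infixr \<open>\<otimes>\<close> 76) is "\<lambda>v w. Poly_Mapping.single (v, w) 1" .

lemma pure_tensor_add_left: "(v + v') \<otimes> w = v \<otimes> w + v' \<otimes> w"
  by transfer (rule cvec.span_base, rule tensor_relations.intros)
lemma pure_tensor_add_right: "v \<otimes> (w + w') = v \<otimes> w + v \<otimes> w'"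
  by transfer (rule cvec.span_base, rule tensor_relations.intros)
lemma pure_tensor_scale_left: "(c *\<^sub>C v) \<otimes> w = c *\<^sub>C v \<otimes> w"
  by transfer (rule cvec.span_base, rule tensor_relations.intros)
lemma pure_tensor_scale_right: "v \<otimes> (c *\<^sub>C w) = c *\<^sub>C v \<otimes> w"
  by transfer (rule cvec.span_base, rule tensor_relations.intros)

definition cbilinear :: "('v::complex_vector \<Rightarrow> 'w::complex_vector \<Rightarrow> 'x::complex_vector) \<Rightarrow> bool" where
  "cbilinear f \<longleftrightarrow> (\<forall>w. clinear (\<lambda>v. f v w)) \<and> (\<forall>v. clinear (f v))"

text \<open>The linear map induced by a bilinear map \<open>f\<close>; for bilinear \<open>f\<close> the value does not depend on
  the chosen representative (lemma \<open>tensor_lift\<close>).\<close>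

definition tensor_lift ::
  "('v::complex_vector \<Rightarrow> 'w::complex_vector \<Rightarrow> 'x::complex_vector) \<Rightarrow> ('v, 'w) tensor \<Rightarrow> 'x" where
  "tensor_lift f t = lin_ext (\<lambda>(v, w). f v w) (rep_tensor t)"

lemma tensor_lift_abs:
  assumes "cbilinear f"
  shows "tensor_lift f (abs_tensor p) = lin_ext (\<lambda>(v, w). f v w) p"
proof -
  let ?F = "lin_ext (\<lambda>(v, w). f v w)"
  have b: "clinear (\<lambda>v. f v w)" "clinear (f v)" for v w
    using assms by (auto simp: cbilinear_def)
  note [simp] = clinear_diff[OF lin_ext_linear] clinear_add[OF lin_ext_linear] clinear_scale[OF lin_ext_linear]
    clinear_add[OF b(1)] clinear_add[OF b(2)] clinear_scale[OF b(1)] clinear_scale[OF b(2)]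
  have "rep_tensor (abs_tensor p) - p \<in> cvec.span tensor_relations"
    by (rule Quotient3_rep_abs[OF Quotient3_tensor]) (simp add: cvec.span_zero)
  then have "?F (rep_tensor (abs_tensor p) - p) = 0"
    by (rule clinear_vanish_on_span[OF lin_ext_linear, rotated]) (erule tensor_relations.cases; simp)
  then show ?thesis by (simp add: tensor_lift_def)
qed

lemma tensor_lift [simp]: "cbilinear f \<Longrightarrow> tensor_lift f (v \<otimes> w) = f v w"
  by (simp add: pure_tensor_def tensor_lift_abs)

lemma tensor_lift_linear: "cbilinear f \<Longrightarrow> clinear (tensor_lift f)"
proof (rule clinearI)
  fix s t :: "('a, 'b) tensor" and c
  assume f: "cbilinear f"
  show "tensor_lift f (s + t) = tensor_lift f s + tensor_lift f t"
    by (induct s, induct t)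
      (simp add: plus_tensor.abs_eq f tensor_lift_abs clinear_add[OF lin_ext_linear])
  show "tensor_lift f (c *\<^sub>C t) = c *\<^sub>C tensor_lift f t"
    by (induct t)
      (simp add: scaleC_tensor.abs_eq f tensor_lift_abs clinear_scale[OF lin_ext_linear])
qed

lemma tensor_lift_fun_add: "tensor_lift (\<lambda>v w. f v w + g v w) t = tensor_lift f t + tensor_lift g t"
  using lin_ext_fun_add[of "\<lambda>(v, w). f v w" "\<lambda>(v, w). g v w"]
  by (simp add: tensor_lift_def case_prod_unfold)

lemma tensor_lift_fun_scale: "tensor_lift (\<lambda>v w. c *\<^sub>C f v w) t = c *\<^sub>C tensor_lift f t"
  using lin_ext_fun_scale[of c "\<lambda>(v, w). f v w"]
  by (simp add: tensor_lift_def case_prod_unfold)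

lemma tensor_induct [case_names pure add]:
  fixes t :: "('v::complex_vector, 'w::complex_vector) tensor"
  assumes pure: "\<And>v w. P (v \<otimes> w)" and add: "\<And>s t. P s \<Longrightarrow> P t \<Longrightarrow> P (s + t)"
  shows "P t"
proof (induct t)
  case (1 p)
  have *: "abs_tensor (c *\<^sub>C delta x) = (c *\<^sub>C fst x) \<otimes> snd x" for c and x :: "'v \<times> 'w"
    by (simp only: pure_tensor_scale_left) (simp add: pure_tensor_def scaleC_tensor.abs_eq)
  show ?case
    by (induction p rule: free_induct) (simp_all add: * pure add flip: plus_tensor.abs_eq)
qed

section \<open>Superspaces and Lie superalgebras\<close>

text \<open>Parities are Booleans, with \<^const>\<open>True\<close> for odd. A grading is given by its two projections.\<close>

class superspace = complex_vector +
  fixes component :: "bool \<Rightarrow> 'a \<Rightarrow> 'a"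
  assumes component_add: "component p (x + y) = component p x + component p y"
    and component_scaleC: "component p (c *\<^sub>C x) = c *\<^sub>C component p x"
    and component_component: "component p (component q x) = (if p = q then component p x else 0)"
    and component_sum: "component False x + component True x = x"
begin

definition homogeneous :: "bool \<Rightarrow> 'a \<Rightarrow> bool" where
  "homogeneous p x \<longleftrightarrow> component p x = x"

end

lemma component_linear: "clinear (component p)"
  by (rule clinearI) (simp_all add: component_add component_scaleC)

lemma component_0 [simp]: "component p 0 = (0 :: 'a::superspace)"
  by (rule clinear_0[OF component_linear])

lemma homogeneous_component [simp]: "homogeneous p (component p (x :: 'a::superspace))"
  by (simp add: homogeneous_def component_component)

lemma component_homogeneous:
  "homogeneous p x \<Longrightarrow> component q x = (if p = q then x else (0 :: 'a::superspace))"
  using component_component[of q p x] by (auto simp: homogeneous_def)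

definition koszul :: "bool \<Rightarrow> bool \<Rightarrow> complex" where
  "koszul p q = (if p \<and> q then -1 else 1)"

class lie_superalgebra = superspace +
  fixes bracket :: "'a \<Rightarrow> 'a \<Rightarrow> 'a"
  assumes bracket_add_left: "bracket (x + y) z = bracket x z + bracket y z"
    and bracket_add_right: "bracket x (y + z) = bracket x y + bracket x z"
    and bracket_scaleC_left: "bracket (c *\<^sub>C x) y = c *\<^sub>C bracket x y"
    and bracket_scaleC_right: "bracket x (c *\<^sub>C y) = c *\<^sub>C bracket x y"
    and bracket_graded:
      "homogeneous p x \<Longrightarrow> homogeneous q y \<Longrightarrow> homogeneous (p \<noteq> q) (bracket x y)"
    and bracket_skew:
      "homogeneous p x \<Longrightarrow> homogeneous q y \<Longrightarrow> bracket x y = - (koszul p q *\<^sub>C bracket y x)"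
    and super_jacobi:
      "homogeneous p x \<Longrightarrow> homogeneous q y \<Longrightarrow>
        bracket x (bracket y z) = bracket (bracket x y) z + koszul p q *\<^sub>C bracket y (bracket x z)"

section \<open>The Lie superalgebra sl(2,1) and its natural module\<close>

typedef sl21 = "{M :: complex^3^3. M $ 3 $ 3 = M $ 1 $ 1 + M $ 2 $ 2}"
  by (rule exI[of _ 0]) simp

setup_lifting type_definition_sl21

definition block :: "bool \<Rightarrow> complex^3^3 \<Rightarrow> complex^3^3" where
  "block p M = (\<chi> i j. if ((i = 3) \<noteq> (j = 3)) = p then M $ i $ j else 0)"

definition supercommutator :: "complex^3^3 \<Rightarrow> complex^3^3 \<Rightarrow> complex^3^3" where
  "supercommutator M N =
     (\<Sum>p\<in>UNIV. \<Sum>q\<in>UNIV. block p M ** block q N - koszul p q *\<^sub>C (block q N ** block p M))"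

lemma scaleC_vec_nth [simp]: "(c *\<^sub>C x) $ i = c *\<^sub>C x $ i"
  by (simp add: scaleC_vec_def)

lemma scaleC_complex_eq [simp]: "c *\<^sub>C d = c * (d :: complex)"
  by (simp add: scaleC_complex_def)

lemma block_nth: "block p M $ i $ j = (if ((i = 3) \<noteq> (j = 3)) = p then M $ i $ j else 0)"
  by (simp add: block_def)

lemmas matrix3_simps = vec_eq_iff forall_3 sum_3 matrix_matrix_mult_def supercommutator_def
  UNIV_bool block_nth koszul_def

instantiation sl21 :: superspace
begin
lift_definition zero_sl21 :: sl21 is 0 by simp
lift_definition plus_sl21 :: "sl21 \<Rightarrow> sl21 \<Rightarrow> sl21" is "(+)" by (simp add: algebra_simps)
lift_definition minus_sl21 :: "sl21 \<Rightarrow> sl21 \<Rightarrow> sl21" is "(-)" by (simp add: algebra_simps)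
lift_definition uminus_sl21 :: "sl21 \<Rightarrow> sl21" is uminus by (simp add: algebra_simps)
lift_definition scaleC_sl21 :: "complex \<Rightarrow> sl21 \<Rightarrow> sl21" is scaleC by (simp add: algebra_simps)
lift_definition component_sl21 :: "bool \<Rightarrow> sl21 \<Rightarrow> sl21" is block by (simp add: block_nth)
instance
  by standard (transfer; simp add: scaleC_add_right scaleC_add_left scaleC_scaleC vec_eq_iff block_nth)+
end

lemma block_block: "block p (block q M) = (if p = q then block p M else 0)"
  by (simp add: vec_eq_iff block_nth)

lemma block_fixed: "block p M = M \<Longrightarrow> block q M = (if q = p then M else 0)"
  using block_block[of q p M] by auto

lemma block_mult:
  assumes "block p M = M" "block q N = N"
  shows "block (p \<noteq> q) (M ** N) = M ** N"
proof -
  have M: "M $ i $ j = 0" if "((i = 3) \<noteq> (j = 3)) \<noteq> p" for i j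
    using arg_cong[OF assms(1), of "\<lambda>X. X $ i $ j"] that by (simp add: block_nth)
  have N: "N $ i $ j = 0" if "((i = 3) \<noteq> (j = 3)) \<noteq> q" for i j
    using arg_cong[OF assms(2), of "\<lambda>X. X $ i $ j"] that by (simp add: block_nth)
  have "(M ** N) $ i $ j = 0" if "((i = 3) \<noteq> (j = 3)) \<noteq> (p \<noteq> q)" for i j
  proof -
    have "M $ i $ k * N $ k $ j = 0" for k
      using M[of i k] N[of k j] that by (cases "((i = 3) \<noteq> (k = 3)) = p") auto
    then show ?thesis by (simp only: matrix_matrix_mult_def vec_lambda_beta sum.neutral_const)
  qed
  then show ?thesis by (simp add: vec_eq_iff block_nth)
qed

lemma matrix3_bilinear:
  fixes M N :: "complex^3^3"
  shows "(c *\<^sub>C M) ** N = c *\<^sub>C (M ** N)" "M ** (c *\<^sub>C N) = c *\<^sub>C (M ** N)"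
    "(M + M') ** N = M ** N + M' ** N" "M ** (N + N') = M ** N + M ** N'"
    "(M - M') ** N = M ** N - M' ** N" "M ** (N - N') = M ** N - M ** N'"
  by (simp_all add: vec_eq_iff matrix_matrix_mult_def sum_distrib_left algebra_simps
      sum.distrib sum_subtractf)

lemma block_linear: "clinear (block p)"
  by (rule clinearI) (simp_all add: vec_eq_iff block_nth)

lemma supercommutator_homogeneous:
  assumes "block p M = M" "block q N = N"
  shows "supercommutator M N = M ** N - koszul p q *\<^sub>C (N ** M)"
  by (simp add: supercommutator_def UNIV_bool block_fixed[OF assms(1)] block_fixed[OF assms(2)])

lemma block_supercommutator:
  assumes "block p M = M" "block q N = N"
  shows "block (p \<noteq> q) (supercommutator M N) = supercommutator M N"
  using block_mult[OF assms] block_mult[OF assms(2,1)]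
  by (simp add: supercommutator_homogeneous[OF assms] clinear_diff[OF block_linear]
      clinear_scale[OF block_linear] eq_commute[of q p])

lemma supercommutator_add_right:
  "supercommutator M (N + N') = supercommutator M N + supercommutator M N'"
  by (simp add: supercommutator_def UNIV_bool clinear_add[OF block_linear] algebra_simps
      matrix3_bilinear scaleC_add_right)

lemma supercommutator_jacobi:
  assumes p: "block p X = X" and q: "block q Y = Y"
  shows "supercommutator X (supercommutator Y Z) =
    supercommutator (supercommutator X Y) Z + koszul p q *\<^sub>C supercommutator Y (supercommutator X Z)"
proof -
  have *: "supercommutator X (supercommutator Y Z) =
    supercommutator (supercommutator X Y) Z + koszul p q *\<^sub>C supercommutator Y (supercommutator X Z)"
    if r: "block r Z = Z" for r Z
  proof -
    note h = supercommutator_homogeneous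
    note inner = h[OF p q] h[OF p r] h[OF q r]
    note outer = h[OF p block_supercommutator[OF q r], unfolded inner]
      h[OF q block_supercommutator[OF p r], unfolded inner]
      h[OF block_supercommutator[OF p q] r, unfolded inner]
    show ?thesis unfolding inner outer
      by (cases p; cases q; cases r) (simp_all add: koszul_def matrix3_bilinear matrix_mul_assoc)
  qed
  have Z: "Z = block False Z + block True Z" by (simp add: vec_eq_iff block_nth)
  have "supercommutator X (supercommutator Y (A + B)) =
      supercommutator (supercommutator X Y) (A + B) + koszul p q *\<^sub>C supercommutator Y (supercommutator X (A + B))"
    if "block False A = A" "block True B = B" for A B
    by (simp only: supercommutator_add_right *[OF that(1)] *[OF that(2)] scaleC_add_right ac_simps)
  from this[of "block False Z" "block True Z"] show ?thesis
    by (simp add: block_block flip: Z)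
qed

instantiation sl21 :: lie_superalgebra
begin
lift_definition bracket_sl21 :: "sl21 \<Rightarrow> sl21 \<Rightarrow> sl21" is supercommutator
  by (simp add: matrix3_simps algebra_simps)
instance
proof
  fix p q and x y z :: sl21
  assume h: "homogeneous p x" "homogeneous q y"
  show "homogeneous (p \<noteq> q) (bracket x y)"
    using h unfolding homogeneous_def by transfer (rule block_supercommutator)
  show "bracket x y = - (koszul p q *\<^sub>C bracket y x)"
    using h unfolding homogeneous_def
    by transfer (auto simp: supercommutator_homogeneous koszul_def)
  show "bracket x (bracket y z) = bracket (bracket x y) z + koszul p q *\<^sub>C bracket y (bracket x z)"
    using h unfolding homogeneous_def by transfer (rule supercommutator_jacobi)
qed (transfer; simp add: matrix3_simps algebra_simps)+
end

section \<open>Map superalgebras\<close>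

lemma cbilinearI:
  assumes "\<And>v v' w. f (v + v') w = f v w + f v' w" "\<And>v w w'. f v (w + w') = f v w + f v w'"
    "\<And>c v w. f (c *\<^sub>C v) w = c *\<^sub>C f v w" "\<And>c v w. f v (c *\<^sub>C w) = c *\<^sub>C f v w"
  shows "cbilinear f"
  unfolding cbilinear_def using assms by (auto intro!: clinearI)

lemma pure_tensor_bilinear: "cbilinear (\<otimes>)"
  by (rule cbilinearI) (simp_all add: pure_tensor_add_left pure_tensor_add_right
      pure_tensor_scale_left pure_tensor_scale_right)

lemmas pure_tensor_simps = pure_tensor_add_left pure_tensor_add_right
  pure_tensor_scale_left pure_tensor_scale_right

lemma pure_tensor_zero [simp]: "0 \<otimes> w = 0" "v \<otimes> 0 = 0"
  using pure_tensor_scale_left[of 0 0 w] pure_tensor_scale_right[of v 0 0] by simp_all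

lemma pure_tensor_minus: "(- v) \<otimes> w = - (v \<otimes> w)"
  using pure_tensor_scale_left[of "-1" v w] by simp

text \<open>The parity on a tensor product whose second factor is purely even.\<close>

instantiation tensor :: (superspace, complex_vector) superspace
begin

definition component_tensor :: "bool \<Rightarrow> ('a, 'b) tensor \<Rightarrow> ('a, 'b) tensor" where
  "component p = tensor_lift (\<lambda>v w. component p v \<otimes> w)"

lemma component_tensor_bilinear: "cbilinear (\<lambda>(v::'a::superspace) (w::'b::complex_vector). component p v \<otimes> w)"
  by (rule cbilinearI) (simp_all add: pure_tensor_simps component_add component_scaleC)

lemma component_pure_tensor [simp]:
  "component p (v \<otimes> w) = component p v \<otimes> (w :: 'b::complex_vector)" for v :: "'a::superspace"
  by (simp add: component_tensor_def component_tensor_bilinear)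

instance
proof
  fix p q c and s t :: "('a, 'b) tensor"
  note lin = tensor_lift_linear[OF component_tensor_bilinear]
  show add_comp: "component p (s + t) = component p s + component p t" for p and s t :: "('a, 'b) tensor"
    unfolding component_tensor_def by (rule clinear_add[OF lin])
  show "component p (c *\<^sub>C t) = c *\<^sub>C component p t"
    unfolding component_tensor_def by (rule clinear_scale[OF lin])
  show "component p (component q t) = (if p = q then component p t else 0)"
    by (induction t rule: tensor_induct) (simp_all add: add_comp component_component)
  show "component False t + component True t = t"
  proof (induction t rule: tensor_induct)
    case (pure v w)
    then show ?case by (simp add: component_sum flip: pure_tensor_add_left)
  next
    case (add s t)
    have "component False (s + t) + component True (s + t) =
        (component False s + component True s) + (component False t + component True t)"
      by (simp only: add_comp ac_simps)
    then show ?case by (simp only: add)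
  qed
qed

end

text \<open>The double bilinear extension of \<open>(z \<otimes> a, w \<otimes> b) \<mapsto> f z w \<otimes> ab\<close>.\<close>

definition tensor_lift2 ::
  "('u::complex_vector \<Rightarrow> 'v::complex_vector \<Rightarrow> 'w::complex_vector) \<Rightarrow>
    ('u, 'a::complex_algebra) tensor \<Rightarrow> ('v, 'a) tensor \<Rightarrow> ('w, 'a) tensor" where
  "tensor_lift2 f s t = tensor_lift (\<lambda>z a. tensor_lift (\<lambda>w b. f z w \<otimes> (a * b)) t) s"

context
  fixes f :: "'u::complex_vector \<Rightarrow> 'v::complex_vector \<Rightarrow> 'w::complex_vector"
  assumes f: "cbilinear f"
begin

lemma cbilinearD:
  "f (z + z') w = f z w + f z' w" "f z (w + w') = f z w + f z w'"
  "f (c *\<^sub>C z) w = c *\<^sub>C f z w" "f z (c *\<^sub>C w) = c *\<^sub>C f z w"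
  using f by (auto simp: cbilinear_def clinear_add clinear_scale
      clinear_add[of "\<lambda>v. f v w"] clinear_scale[of "\<lambda>v. f v w"])

lemma tensor_lift2_inner: "cbilinear (\<lambda>w (b::'a::complex_algebra). f z w \<otimes> (a * b))"
  by (rule cbilinearI) (simp_all add: cbilinearD pure_tensor_simps distrib_left scaleC_mult_right)

lemma tensor_lift2_outer:
  "cbilinear (\<lambda>z (a::'a::complex_algebra). tensor_lift (\<lambda>w b. f z w \<otimes> (a * b)) t)"
  by (rule cbilinearI)
    (simp_all add: cbilinearD pure_tensor_simps distrib_right scaleC_mult_left
      tensor_lift_fun_add tensor_lift_fun_scale)

lemma tensor_lift2_pure: "tensor_lift2 f (z \<otimes> a) (w \<otimes> b) = f z w \<otimes> (a * (b::'a::complex_algebra))"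
  unfolding tensor_lift2_def by (subst tensor_lift[OF tensor_lift2_outer]) (rule tensor_lift[OF tensor_lift2_inner])

lemma tensor_lift2_bilinear:
  "cbilinear (tensor_lift2 f :: ('u, 'a::complex_algebra) tensor \<Rightarrow> ('v, 'a) tensor \<Rightarrow> ('w, 'a) tensor)"
proof -
  note out = tensor_lift_linear[OF tensor_lift2_outer]
  note inn = tensor_lift_linear[OF tensor_lift2_inner]
  show ?thesis
    by (rule cbilinearI)
      (simp_all add: tensor_lift2_def clinear_add[OF out] clinear_scale[OF out]
        clinear_add[OF inn] clinear_scale[OF inn] tensor_lift_fun_add tensor_lift_fun_scale)
qed

end

lemma bracket_bilinear: "cbilinear (bracket :: 'g::lie_superalgebra \<Rightarrow> _)"
  by (rule cbilinearI)
    (simp_all add: bracket_add_left bracket_add_right bracket_scaleC_left bracket_scaleC_right)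

instantiation tensor :: (lie_superalgebra, complex_comm_algebra) lie_superalgebra
begin

definition bracket_tensor :: "('a, 'b) tensor \<Rightarrow> ('a, 'b) tensor \<Rightarrow> ('a, 'b) tensor" where
  "bracket = tensor_lift2 bracket"

lemma bracket_pure_tensor [simp]: "bracket (z \<otimes> a) (w \<otimes> b) = bracket z w \<otimes> (a * b)"
  for z w :: "'a::lie_superalgebra" and a b :: "'b::complex_comm_algebra"
  by (simp add: bracket_tensor_def tensor_lift2_pure bracket_bilinear)

instance
proof
  fix p q c and x y z :: "('a, 'b) tensor"
  have bil: "bracket (x + y) z = bracket x z + bracket y z"
    "bracket x (y + z) = bracket x y + bracket x z"
    "bracket (c *\<^sub>C x) y = c *\<^sub>C bracket x y" "bracket x (c *\<^sub>C y) = c *\<^sub>C bracket x y"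
    for c and x y z :: "('a, 'b) tensor"
    unfolding bracket_tensor_def
    by (simp_all only: cbilinearD[OF tensor_lift2_bilinear[OF bracket_bilinear]])
  show "bracket (x + y) z = bracket x z + bracket y z"
    "bracket x (y + z) = bracket x y + bracket x z"
    "bracket (c *\<^sub>C x) y = c *\<^sub>C bracket x y" "bracket x (c *\<^sub>C y) = c *\<^sub>C bracket x y"
    by (simp_all only: bil)
  note lin = bil component_add scaleC_add_right
  assume "homogeneous p x" "homogeneous q y"
  then have xy: "component p x = x" "component q y = y" by (simp_all add: homogeneous_def)
  have "component (p \<noteq> q) (bracket (component p x) (component q y)) = bracket (component p x) (component q y)"
  proof (induction x rule: tensor_induct)
    case (pure u a)
    show ?case
    proof (induction y rule: tensor_induct)
      case (pure v b)
      have "component (p \<noteq> q) (bracket (component p u) (component q v)) = bracket (component p u) (component q v)"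
        using bracket_graded[of p "component p u" q "component q v"] by (simp add: homogeneous_def component_component)
      then show ?case by simp
    qed (simp add: lin)
  qed (simp add: lin)
  then show "homogeneous (p \<noteq> q) (bracket x y)" by (simp add: homogeneous_def xy)
  have "bracket (component p x) (component q y) = - (koszul p q *\<^sub>C bracket (component q y) (component p x))"
  proof (induction x rule: tensor_induct)
    case (pure u a)
    show ?case
    proof (induction y rule: tensor_induct)
      case (pure v b)
      have "bracket (component p u) (component q v) = (- koszul p q) *\<^sub>C bracket (component q v) (component p u)"
        using bracket_skew[of p "component p u" q "component q v"] by simp
      then show ?case by (simp add: pure_tensor_scale_left pure_tensor_minus mult.commute[of a b])
    qed (simp add: lin)
  qed (simp add: lin)
  then show "bracket x y = - (koszul p q *\<^sub>C bracket y x)" by (simp add: xy)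
  have "bracket (component p x) (bracket (component q y) z) =
    bracket (bracket (component p x) (component q y)) z +
    koszul p q *\<^sub>C bracket (component q y) (bracket (component p x) z)"
  proof (induction x rule: tensor_induct)
    case (pure u a)
    show ?case
    proof (induction y rule: tensor_induct)
      case (pure v b)
      show ?case
      proof (induction z rule: tensor_induct)
        case (pure w c)
        show ?case
          using super_jacobi[of p "component p u" q "component q v" w]
          by (simp add: pure_tensor_simps mult.assoc mult.left_commute[of b a])
      qed (simp add: lin)
    qed (simp add: lin)
  qed (simp add: lin)
  then show "bracket x (bracket y z) = bracket (bracket x y) z + koszul p q *\<^sub>C bracket y (bracket x z)"
    by (simp add: xy)
qed

end

text \<open>A copy of the column vectors, so that it can carry the grading in which \<open>v\<^sub>3\<close> is odd.\<close>

typedef natural_module = "UNIV :: (complex^3) set" morphisms coords Vec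
  by simp

setup_lifting type_definition_natural_module

instantiation natural_module :: superspace
begin
lift_definition zero_natural_module :: natural_module is 0 .
lift_definition plus_natural_module :: "natural_module \<Rightarrow> natural_module \<Rightarrow> natural_module" is "(+)" .
lift_definition minus_natural_module :: "natural_module \<Rightarrow> natural_module \<Rightarrow> natural_module" is "(-)" .
lift_definition uminus_natural_module :: "natural_module \<Rightarrow> natural_module" is uminus .
lift_definition scaleC_natural_module :: "complex \<Rightarrow> natural_module \<Rightarrow> natural_module" is scaleC .
lift_definition component_natural_module :: "bool \<Rightarrow> natural_module \<Rightarrow> natural_module"
  is "\<lambda>p v. \<chi> i. if (i = 3) = p then v $ i else 0" .
instance
  by standard (transfer; simp add: scaleC_add_right scaleC_add_left scaleC_scaleC vec_eq_iff)+
end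

lift_definition natural_act :: "sl21 \<Rightarrow> natural_module \<Rightarrow> natural_module" is "(*v)" .

lemma natural_act_bilinear: "cbilinear natural_act"
  by (rule cbilinearI; transfer)
    (simp_all add: vec_eq_iff forall_3 matrix_vector_mult_def sum_3 algebra_simps)

section \<open>Free, tensor and enveloping algebras\<close>

text \<open>Words form a monoid under concatenation, so \<^typ>\<open>'x list \<Rightarrow>\<^sub>0 complex\<close> with the
  multiplication of \<^theory>\<open>HOL-Library.Poly_Mapping\<close> is the free associative algebra on \<^typ>\<open>'x\<close>.\<close>

instantiation list :: (type) monoid_add
begin
definition zero_list :: "'a list" where "zero_list = []"
definition plus_list :: "'a list \<Rightarrow> 'a list \<Rightarrow> 'a list" where "plus_list = (@)"
instance by standard (simp_all add: zero_list_def plus_list_def)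
end

lemma delta_mult: "delta xs * delta ys = delta (xs @ ys)"
  by (simp add: mult_single plus_list_def)

lemma one_free: "1 = delta []"
  using single_one[where 'a = "'x list" and 'b = complex] by (simp add: zero_list_def)

lemma free_scaleC_mult:
  fixes p q :: "'x list \<Rightarrow>\<^sub>0 complex"
  shows "(c *\<^sub>C p) * q = c *\<^sub>C (p * q)" "p * (c *\<^sub>C q) = c *\<^sub>C (p * q)"
proof -
  have s: "c *\<^sub>C Poly_Mapping.single x d = Poly_Mapping.single x (c * d)" for c d and x :: "'x list"
    by (rule poly_mapping_eqI) (simp add: lookup_scaleC lookup_single when_def)
  have 1: "(c *\<^sub>C delta xs) * q = c *\<^sub>C (delta xs * q)" for xs c
  proof (induction q rule: free_induct)
    case (scale d ys)
    show ?case by (simp add: s mult_single)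
  qed (simp add: distrib_left scaleC_add_right)
  have 2: "p * (c *\<^sub>C delta ys) = c *\<^sub>C (p * delta ys)" for ys c
  proof (induction p rule: free_induct)
    case (scale d xs)
    show ?case by (simp add: s mult_single mult.commute)
  qed (simp add: distrib_right scaleC_add_right)
  show "(c *\<^sub>C p) * q = c *\<^sub>C (p * q)"
    by (induction p rule: free_induct) (simp_all add: scaleC_scaleC 1 distrib_right scaleC_add_right)
  show "p * (c *\<^sub>C q) = c *\<^sub>C (p * q)"
    by (induction q rule: free_induct) (simp_all add: scaleC_scaleC 2 distrib_left scaleC_add_right)
qed

definition ideal_span :: "'r::{complex_vector, times} set \<Rightarrow> 'r set" where
  "ideal_span R = cvec.span {a * r * b |a r b. r \<in> R}"

lemma ideal_span_mult:
  fixes a b x :: "'r::{complex_vector, ring, monoid_mult}"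
  assumes scale: "\<And>c (x::'r) y. (c *\<^sub>C x) * y = c *\<^sub>C (x * y)" "\<And>c (x::'r) y. x * (c *\<^sub>C y) = c *\<^sub>C (x * y)"
    and x: "x \<in> ideal_span R"
  shows "a * x * b \<in> ideal_span R"
  using x unfolding ideal_span_def
proof (induction rule: cvec.span_induct_alt)
  case base
  show ?case by (simp add: cvec.span_zero)
next
  case (step c y z)
  then obtain a' r b' where y: "y = a' * r * b'" "r \<in> R" by blast
  have "a * y * b = (a * a') * r * (b' * b)" by (simp add: y mult.assoc)
  with y(2) have "a * y * b \<in> cvec.span {a * r * b |a r b. r \<in> R}"
    by (intro cvec.span_base) blast
  then show ?case using step
    by (simp add: distrib_left distrib_right scale cvec.span_add cvec.span_scale)
qed

lemma ideal_span_base: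
  fixes r :: "'r::{complex_vector, ring, monoid_mult}"
  shows "r \<in> R \<Longrightarrow> r \<in> ideal_span R"
  unfolding ideal_span_def by (rule cvec.span_base) (metis (mono_tags, lifting) mem_Collect_eq mult_1_left mult_1_right)

lemma subspace_ideal_span: "cvec.subspace (ideal_span R)"
  unfolding ideal_span_def by (rule cvec.subspace_span)

lemma ideal_span_cong_mult:
  fixes x y :: "'r::{complex_vector, ring, monoid_mult}"
  assumes scale: "\<And>c (x::'r) y. (c *\<^sub>C x) * y = c *\<^sub>C (x * y)" "\<And>c (x::'r) y. x * (c *\<^sub>C y) = c *\<^sub>C (x * y)"
    and "x - x' \<in> ideal_span R" "y - y' \<in> ideal_span R"
  shows "x * y - x' * y' \<in> ideal_span R"
proof -
  have "x * y - x' * y' = 1 * (x - x') * y + x' * (y - y') * 1" by (simp add: algebra_simps)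
  then show ?thesis
    using ideal_span_mult[OF scale assms(3), of 1 y] ideal_span_mult[OF scale assms(4), of x' 1]
      cvec.subspace_add[OF subspace_ideal_span] by metis
qed

inductive_set tensor_algebra_relations :: "('v::complex_vector list \<Rightarrow>\<^sub>0 complex) set" where
  "delta [v + w] - (delta [v] + delta [w]) \<in> tensor_algebra_relations"
| "delta [c *\<^sub>C v] - c *\<^sub>C delta [v] \<in> tensor_algebra_relations"

quotient_type (overloaded) 'v tensor_algebra =
  "'v::complex_vector list \<Rightarrow>\<^sub>0 complex" / "\<lambda>p q. p - q \<in> ideal_span tensor_algebra_relations"
  by (rule equivp_mod_subspace) (rule subspace_ideal_span)

lemma diff_lift:
  assumes "cvec.subspace N"
  shows "x - x' \<in> N \<Longrightarrow> y - y' \<in> N \<Longrightarrow> (x + y) - (x' + y') \<in> N"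
    "x - x' \<in> N \<Longrightarrow> y - y' \<in> N \<Longrightarrow> (x - y) - (x' - y') \<in> N"
    "x - x' \<in> N \<Longrightarrow> - x - - x' \<in> N" "x - x' \<in> N \<Longrightarrow> c *\<^sub>C x - c *\<^sub>C x' \<in> N"
  using cvec.subspace_add[OF assms, of "x - x'" "y - y'"]
    cvec.subspace_diff[OF assms, of "x - x'" "y - y'"] cvec.subspace_neg[OF assms, of "x - x'"]
    cvec.subspace_scale[OF assms, of "x - x'" c]
  by (simp_all add: algebra_simps cvec.scale_right_diff_distrib)

instantiation tensor_algebra :: (complex_vector) complex_algebra
begin
lift_definition zero_tensor_algebra :: "'a tensor_algebra" is 0 .
lift_definition one_tensor_algebra :: "'a tensor_algebra" is 1 .
lift_definition plus_tensor_algebra :: "'a tensor_algebra \<Rightarrow> 'a tensor_algebra \<Rightarrow> 'a tensor_algebra"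
  is "(+)" by (rule diff_lift[OF subspace_ideal_span])
lift_definition minus_tensor_algebra :: "'a tensor_algebra \<Rightarrow> 'a tensor_algebra \<Rightarrow> 'a tensor_algebra"
  is "(-)" by (rule diff_lift[OF subspace_ideal_span])
lift_definition uminus_tensor_algebra :: "'a tensor_algebra \<Rightarrow> 'a tensor_algebra"
  is uminus by (rule diff_lift[OF subspace_ideal_span])
lift_definition scaleC_tensor_algebra :: "complex \<Rightarrow> 'a tensor_algebra \<Rightarrow> 'a tensor_algebra"
  is scaleC by (rule diff_lift[OF subspace_ideal_span])
lift_definition times_tensor_algebra :: "'a tensor_algebra \<Rightarrow> 'a tensor_algebra \<Rightarrow> 'a tensor_algebra"
  is "(*)" by (rule ideal_span_cong_mult[OF free_scaleC_mult])
instance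
  by standard
    (transfer; simp add: cvec.subspace_0[OF subspace_ideal_span] algebra_simps scaleC_add_right
      scaleC_add_left scaleC_scaleC free_scaleC_mult)+
end

lift_definition tensor_incl :: "'v::complex_vector \<Rightarrow> 'v tensor_algebra" is "\<lambda>v. delta [v]" .

definition tensor_word :: "'v::complex_vector list \<Rightarrow> 'v tensor_algebra" where
  "tensor_word ws = prod_list (map tensor_incl ws)"

definition tensor_power :: "nat \<Rightarrow> 'v::complex_vector tensor_algebra set" where
  "tensor_power m = cvec.span {tensor_word ws |ws. length ws = m}"

lemma tensor_word_abs: "tensor_word ws = abs_tensor_algebra (delta ws)"
proof (induction ws)
  case Nil
  then show ?case by (simp add: tensor_word_def one_tensor_algebra_def one_free)
next
  case (Cons w ws)
  then show ?case
    by (simp add: tensor_word_def tensor_incl_def times_tensor_algebra.abs_eq delta_mult)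
qed

lemma tensor_incl_linear: "clinear tensor_incl"
proof (rule clinearI)
  show "tensor_incl (v + w) = tensor_incl v + tensor_incl w" for v w :: 'a
    by transfer (rule ideal_span_base, rule tensor_algebra_relations.intros)
  show "tensor_incl (c *\<^sub>C v) = c *\<^sub>C tensor_incl v" for c and v :: 'a
    by transfer (rule ideal_span_base, rule tensor_algebra_relations.intros)
qed

definition multilinear :: "('v::complex_vector list \<Rightarrow> 'x::complex_vector) \<Rightarrow> bool" where
  "multilinear f \<longleftrightarrow> (\<forall>ws. \<forall>i < length ws. clinear (\<lambda>v. f (ws[i := v])))"

text \<open>The linear map on the tensor algebra given by a multilinear map on words.\<close>

definition multilinear_lift ::
  "('v::complex_vector list \<Rightarrow> 'x::complex_vector) \<Rightarrow> 'v tensor_algebra \<Rightarrow> 'x" where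
  "multilinear_lift f t = lin_ext f (rep_tensor_algebra t)"

lemma multilinear_middle:
  "multilinear f \<Longrightarrow> clinear (\<lambda>v. f (xs @ v # ys))"
  unfolding multilinear_def by (elim allE[of _ "xs @ undefined # ys"] allE[of _ "length xs"]) simp

lemma multilinear_lift_abs:
  assumes "multilinear f"
  shows "multilinear_lift f (abs_tensor_algebra p) = lin_ext f p"
proof -
  have "rep_tensor_algebra (abs_tensor_algebra p) - p \<in> ideal_span tensor_algebra_relations"
    by (rule Quotient3_rep_abs[OF Quotient3_tensor_algebra])
      (simp add: cvec.subspace_0[OF subspace_ideal_span])
  then have "lin_ext f (rep_tensor_algebra (abs_tensor_algebra p) - p) = 0"
    unfolding ideal_span_def
  proof (rule clinear_vanish_on_span[OF lin_ext_linear, rotated])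
    fix x assume "x \<in> {a * r * b |a r b. r \<in> (tensor_algebra_relations :: ('a list \<Rightarrow>\<^sub>0 complex) set)}"
    then obtain a r b where x: "x = a * r * b" and r: "r \<in> tensor_algebra_relations" by blast
    note mid = multilinear_middle[OF assms]
    have 1: "lin_ext f (delta xs * r * delta ys) = 0" for xs ys
      using r
      by cases (simp_all add: left_diff_distrib right_diff_distrib distrib_left distrib_right
          free_scaleC_mult delta_mult clinear_add[OF lin_ext_linear]
          clinear_diff[OF lin_ext_linear] clinear_scale[OF lin_ext_linear] clinear_add[OF mid]
          clinear_scale[OF mid])
    have 2: "lin_ext f (delta xs * r * b) = 0" for xs
      by (induction b rule: free_induct) (simp_all add: free_scaleC_mult distrib_left 1
          clinear_add[OF lin_ext_linear] clinear_scale[OF lin_ext_linear])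
    show "lin_ext f x = 0" unfolding x
      by (induction a rule: free_induct) (simp_all add: free_scaleC_mult distrib_right 2
          clinear_add[OF lin_ext_linear] clinear_scale[OF lin_ext_linear])
  qed
  then show ?thesis by (simp add: multilinear_lift_def clinear_diff[OF lin_ext_linear])
qed

lemma multilinear_lift_word [simp]: "multilinear f \<Longrightarrow> multilinear_lift f (tensor_word ws) = f ws"
  by (simp add: tensor_word_abs multilinear_lift_abs)

lemma multilinear_lift_linear: "multilinear f \<Longrightarrow> clinear (multilinear_lift f)"
proof (rule clinearI)
  fix s t :: "'a tensor_algebra" and c
  assume f: "multilinear f"
  show "multilinear_lift f (s + t) = multilinear_lift f s + multilinear_lift f t"
    by (induct s, induct t)
      (simp add: plus_tensor_algebra.abs_eq f multilinear_lift_abs clinear_add[OF lin_ext_linear])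
  show "multilinear_lift f (c *\<^sub>C t) = c *\<^sub>C multilinear_lift f t"
    by (induct t)
      (simp add: scaleC_tensor_algebra.abs_eq f multilinear_lift_abs clinear_scale[OF lin_ext_linear])
qed

lemma tensor_algebra_induct [case_names scale add]:
  assumes scale: "\<And>c ws. P (c *\<^sub>C tensor_word ws)" and add: "\<And>s t. P s \<Longrightarrow> P t \<Longrightarrow> P (s + t)"
  shows "P t"
proof (induct t)
  case (1 p)
  show ?case
    by (induction p rule: free_induct)
      (use assms in \<open>simp_all add: tensor_word_abs flip: plus_tensor_algebra.abs_eq scaleC_tensor_algebra.abs_eq\<close>)
qed

text \<open>The enveloping algebra: relations \<open>x y - (-1)\<^bsup>|x||y|\<^esup> y x = [x, y]\<close> for homogeneous \<open>x, y\<close>.\<close>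

inductive_set uea_relations :: "'g::lie_superalgebra tensor_algebra set" where
  "homogeneous p x \<Longrightarrow> homogeneous q y \<Longrightarrow>
    tensor_incl x * tensor_incl y - koszul p q *\<^sub>C (tensor_incl y * tensor_incl x)
      - tensor_incl (bracket x y) \<in> uea_relations"

quotient_type (overloaded) 'g uea =
  "'g::lie_superalgebra tensor_algebra" / "\<lambda>s t. s - t \<in> ideal_span uea_relations"
  by (rule equivp_mod_subspace) (rule subspace_ideal_span)

instantiation uea :: (lie_superalgebra) complex_algebra
begin
lift_definition zero_uea :: "'a uea" is 0 .
lift_definition one_uea :: "'a uea" is 1 .
lift_definition plus_uea :: "'a uea \<Rightarrow> 'a uea \<Rightarrow> 'a uea"
  is "(+)" by (rule diff_lift[OF subspace_ideal_span])
lift_definition minus_uea :: "'a uea \<Rightarrow> 'a uea \<Rightarrow> 'a uea"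
  is "(-)" by (rule diff_lift[OF subspace_ideal_span])
lift_definition uminus_uea :: "'a uea \<Rightarrow> 'a uea"
  is uminus by (rule diff_lift[OF subspace_ideal_span])
lift_definition scaleC_uea :: "complex \<Rightarrow> 'a uea \<Rightarrow> 'a uea"
  is scaleC by (rule diff_lift[OF subspace_ideal_span])
lift_definition times_uea :: "'a uea \<Rightarrow> 'a uea \<Rightarrow> 'a uea"
  is "(*)" by (rule ideal_span_cong_mult[OF scaleC_mult_left scaleC_mult_right])
instance
  by standard
    (transfer; simp add: cvec.subspace_0[OF subspace_ideal_span] algebra_simps scaleC_add_right
      scaleC_add_left scaleC_scaleC scaleC_mult_left scaleC_mult_right)+
end

lift_definition uea_incl :: "'g::lie_superalgebra \<Rightarrow> 'g uea" is tensor_incl .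

lemma uea_incl_linear: "clinear uea_incl"
  by (rule clinearI; transfer)
    (simp_all add: clinear_add[OF tensor_incl_linear] clinear_scale[OF tensor_incl_linear]
      cvec.subspace_0[OF subspace_ideal_span])

lemma uea_incl_bracket:
  assumes "homogeneous p x" "homogeneous q y"
  shows "uea_incl x * uea_incl y = koszul p q *\<^sub>C (uea_incl y * uea_incl x) + uea_incl (bracket x y)"
  using assms
  by transfer (drule (1) uea_relations.intros, drule ideal_span_base, simp add: algebra_simps)

section \<open>Representations\<close>

definition representation :: "('g::lie_superalgebra \<Rightarrow> 'm::complex_vector \<Rightarrow> 'm) \<Rightarrow> bool" where
  "representation \<rho> \<longleftrightarrow> cbilinear \<rho> \<and>
    (\<forall>p q x y v. homogeneous p x \<longrightarrow> homogeneous q y \<longrightarrow>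
      \<rho> (bracket x y) v = \<rho> x (\<rho> y v) - koszul p q *\<^sub>C \<rho> y (\<rho> x v))"

text \<open>The action of the enveloping algebra extending a representation \<open>\<rho>\<close>: the class of
  \<open>x\<^sub>1 \<cdots> x\<^sub>n\<close> acts as \<open>\<rho> x\<^sub>1 \<circ> \<cdots> \<circ> \<rho> x\<^sub>n\<close>. It is independent of the representative and
  multiplicative whenever \<open>\<rho>\<close> is a representation (lemma \<open>uea_act\<close>).\<close>

definition uea_act :: "('g::lie_superalgebra \<Rightarrow> 'm::complex_vector \<Rightarrow> 'm) \<Rightarrow> 'g uea \<Rightarrow> 'm \<Rightarrow> 'm" where
  "uea_act \<rho> u v = multilinear_lift (\<lambda>xs. foldr \<rho> xs v) (rep_uea u)"

lemma foldr_linear: "cbilinear \<rho> \<Longrightarrow> clinear (foldr \<rho> xs)"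
  by (induction xs) (simp_all add: clinearI cbilinear_def clinear_add clinear_scale)

lemma foldr_multilinear:
  fixes \<rho> :: "'g::complex_vector \<Rightarrow> 'm::complex_vector \<Rightarrow> 'm"
  assumes "cbilinear \<rho>"
  shows "multilinear (\<lambda>xs. foldr \<rho> xs v)"
  unfolding multilinear_def
proof (intro allI impI clinearI)
  fix ws :: "'g list" and i and x y :: 'g and c
  assume i: "i < length ws"
  note l = foldr_linear[OF assms]
  show "foldr \<rho> (ws[i := x + y]) v = foldr \<rho> (ws[i := x]) v + foldr \<rho> (ws[i := y]) v"
    using i by (simp add: upd_conv_take_nth_drop cbilinearD[OF assms] clinear_add[OF l])
  show "foldr \<rho> (ws[i := c *\<^sub>C x]) v = c *\<^sub>C foldr \<rho> (ws[i := x]) v"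
    using i by (simp add: upd_conv_take_nth_drop cbilinearD[OF assms] clinear_scale[OF l])
qed

lemma tensor_word_append: "tensor_word (xs @ ys) = tensor_word xs * tensor_word ys"
  by (simp add: tensor_word_def)

context
  fixes \<rho> :: "'g::lie_superalgebra \<Rightarrow> 'm::complex_vector \<Rightarrow> 'm"
  assumes \<rho>: "representation \<rho>"
begin

definition tact :: "'g tensor_algebra \<Rightarrow> 'm \<Rightarrow> 'm" where
  "tact t v = multilinear_lift (\<lambda>xs. foldr \<rho> xs v) t"

lemma \<rho>_bilinear: "cbilinear \<rho>"
  using \<rho> by (simp add: representation_def)

lemma tact_word: "tact (tensor_word xs) v = foldr \<rho> xs v"
  by (simp add: tact_def foldr_multilinear \<rho>_bilinear)

lemma tact_linear: "clinear (\<lambda>t. tact t v)"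
  unfolding tact_def by (rule multilinear_lift_linear) (rule foldr_multilinear[OF \<rho>_bilinear])

lemma tact_linear_right: "clinear (tact t)"
proof (rule clinearI)
  show "tact t (v + w) = tact t v + tact t w" for v w
    by (induction t rule: tensor_algebra_induct)
      (simp_all add: clinear_add[OF tact_linear] clinear_scale[OF tact_linear] tact_word
        clinear_add[OF foldr_linear[OF \<rho>_bilinear]] scaleC_add_right)
  show "tact t (c *\<^sub>C v) = c *\<^sub>C tact t v" for c v
    by (induction t rule: tensor_algebra_induct)
      (simp_all add: clinear_add[OF tact_linear] clinear_scale[OF tact_linear] tact_word
        clinear_scale[OF foldr_linear[OF \<rho>_bilinear]] scaleC_add_right scaleC_scaleC mult.commute)
qed

lemma tact_mult: "tact (s * t) v = tact s (tact t v)"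
proof (induction s rule: tensor_algebra_induct)
  case (scale c xs)
  have "tact (tensor_word xs * t) v = foldr \<rho> xs (tact t v)"
    by (induction t rule: tensor_algebra_induct)
      (simp_all add: scaleC_mult_right distrib_left clinear_add[OF tact_linear]
        clinear_scale[OF tact_linear] clinear_add[OF foldr_linear[OF \<rho>_bilinear]]
        clinear_scale[OF foldr_linear[OF \<rho>_bilinear]] tact_word flip: tensor_word_append)
  then show ?case by (simp add: scaleC_mult_left clinear_scale[OF tact_linear] tact_word)
qed (simp add: distrib_right clinear_add[OF tact_linear])

lemma tact_incl: "tact (tensor_incl x) v = \<rho> x v"
  using tact_word[of "[x]"] by (simp add: tensor_word_def)

lemma tact_ideal:
  assumes "t \<in> ideal_span uea_relations"
  shows "tact t v = 0"
proof -
  have "tact r v = 0" if "r \<in> uea_relations" for r v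
    using that \<rho>
    by cases (simp add: clinear_diff[OF tact_linear] clinear_scale[OF tact_linear] tact_mult
        tact_incl representation_def)
  then have "tact r v = 0" if "r \<in> {a * r * b |a r b. r \<in> uea_relations}" for r
    using that by (auto simp: tact_mult clinear_0[OF tact_linear_right])
  then show ?thesis
    using clinear_vanish_on_span[OF tact_linear _ assms[unfolded ideal_span_def]] by blast
qed

lemma uea_act_abs: "uea_act \<rho> (abs_uea t) v = tact t v"
proof -
  have "rep_uea (abs_uea t) - t \<in> ideal_span uea_relations"
    by (rule Quotient3_rep_abs[OF Quotient3_uea]) (simp add: cvec.subspace_0[OF subspace_ideal_span])
  from tact_ideal[OF this, of v] have "tact (rep_uea (abs_uea t)) v = tact t v"
    by (simp add: clinear_diff[OF tact_linear])
  then show ?thesis by (simp add: uea_act_def tact_def)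
qed

lemma uea_act:
  "uea_act \<rho> (uea_incl x) v = \<rho> x v" "uea_act \<rho> 1 v = v"
  "uea_act \<rho> (u * u') v = uea_act \<rho> u (uea_act \<rho> u' v)"
  "uea_act \<rho> (u + u') v = uea_act \<rho> u v + uea_act \<rho> u' v"
  "uea_act \<rho> (c *\<^sub>C u) v = c *\<^sub>C uea_act \<rho> u v"
  "clinear (uea_act \<rho> u)"
proof -
  show "uea_act \<rho> (uea_incl x) v = \<rho> x v"
    by (simp add: uea_incl_def uea_act_abs tact_incl)
  show "uea_act \<rho> 1 v = v"
    using tact_word[of "[]" v] by (simp add: one_uea_def uea_act_abs tensor_word_def)
  show "uea_act \<rho> (u * u') v = uea_act \<rho> u (uea_act \<rho> u' v)"
    by (induct u, induct u') (simp add: times_uea.abs_eq uea_act_abs tact_mult)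
  show "uea_act \<rho> (u + u') v = uea_act \<rho> u v + uea_act \<rho> u' v"
    by (induct u, induct u') (simp add: plus_uea.abs_eq uea_act_abs clinear_add[OF tact_linear])
  show "uea_act \<rho> (c *\<^sub>C u) v = c *\<^sub>C uea_act \<rho> u v"
    by (induct u) (simp add: scaleC_uea.abs_eq uea_act_abs clinear_scale[OF tact_linear])
  show "clinear (uea_act \<rho> u)"
  proof (induct u)
    case (1 t)
    have "uea_act \<rho> (abs_uea t) = tact t" by (rule ext) (rule uea_act_abs)
    then show ?case by (simp add: tact_linear_right)
  qed
qed

end

section \<open>Tensor powers as supermodules\<close>

text \<open>For homogeneous \<open>w\<close>, \<open>parity_twist p w = (-1)\<^bsup>p|w|\<^esup> w\<close>.\<close>

definition parity_twist :: "bool \<Rightarrow> 'w::superspace \<Rightarrow> 'w" where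
  "parity_twist p w = (\<Sum>q\<in>UNIV. koszul p q *\<^sub>C component q w)"

definition coproduct_term ::
  "('g::superspace \<Rightarrow> 'w::superspace \<Rightarrow> 'w) \<Rightarrow> bool \<Rightarrow> 'g \<Rightarrow> 'w list \<Rightarrow> nat \<Rightarrow> 'w tensor_algebra" where
  "coproduct_term \<rho> p z ws j =
     tensor_word (map (parity_twist p) (take j ws) @ \<rho> z (ws ! j) # drop (Suc j) ws)"

definition coproduct_act ::
  "('g::superspace \<Rightarrow> 'w::superspace \<Rightarrow> 'w) \<Rightarrow> 'g \<Rightarrow> 'w tensor_algebra \<Rightarrow> 'w tensor_algebra" where
  "coproduct_act \<rho> z =
     multilinear_lift (\<lambda>ws. \<Sum>p\<in>UNIV. \<Sum>j<length ws. coproduct_term \<rho> p (component p z) ws j)"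

lemma parity_twist_linear: "clinear (parity_twist p)"
  by (rule clinearI) (simp_all add: parity_twist_def UNIV_bool component_add component_scaleC
      scaleC_add_right scaleC_scaleC mult.commute)

lemma parity_twist_homogeneous: "homogeneous q w \<Longrightarrow> parity_twist p w = koszul p q *\<^sub>C w"
  by (cases q) (simp_all add: parity_twist_def UNIV_bool component_homogeneous)

lemma clinear_sum_fun: "(\<And>i. i \<in> S \<Longrightarrow> clinear (f i)) \<Longrightarrow> clinear (\<lambda>x. \<Sum>i\<in>S. f i x)"
  by (rule clinearI) (simp_all add: clinear_add clinear_scale sum.distrib cvec.scale_sum_right)

lemma clinear_compose: "clinear f \<Longrightarrow> clinear g \<Longrightarrow> clinear (\<lambda>x. f (g x))"
  by (rule clinearI) (simp_all add: clinear_add clinear_scale)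

lemma clinear_scaled: "clinear f \<Longrightarrow> clinear (\<lambda>x. c *\<^sub>C f x)"
  by (rule clinearI) (simp_all add: clinear_add clinear_scale scaleC_add_right scaleC_scaleC mult.commute)

lemma tensor_word_multilinear: "multilinear tensor_word"
  unfolding multilinear_def
  by (auto intro!: clinearI simp: upd_conv_take_nth_drop tensor_word_def distrib_left distrib_right
      clinear_add[OF tensor_incl_linear] clinear_scale[OF tensor_incl_linear] scaleC_mult_left scaleC_mult_right)

lemma multilinear_update: "multilinear f \<Longrightarrow> i < length ws \<Longrightarrow> clinear (\<lambda>v. f (ws[i := v]))"
  by (simp add: multilinear_def)

lemma coproduct_multilinear:
  assumes "cbilinear \<rho>"
  shows "multilinear (\<lambda>ws. \<Sum>p\<in>UNIV. \<Sum>j<length ws. coproduct_term \<rho> p (component p z) ws j)"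
  unfolding multilinear_def length_list_update
proof (intro allI impI clinear_sum_fun)
  fix ws :: "'b list" and i p j
  assume i: "i < length ws" and "j \<in> {..<length ws}"
  then have j: "j < length ws" by simp
  let ?w = "map (parity_twist p) (take j ws) @ \<rho> (component p z) (ws ! j) # drop (Suc j) ws"
  have lin: "clinear (\<rho> (component p z))" using assms by (simp add: cbilinear_def)
  have len: "length ?w = length ws" using j by simp
  note up = multilinear_update[OF tensor_word_multilinear, of i ?w, unfolded len, OF i]
  consider "i < j" | "i = j" | "j < i" by linarith
  then show "clinear (\<lambda>v. coproduct_term \<rho> p (component p z) (ws[i := v]) j)"
  proof cases
    case 1
    then have "map (parity_twist p) (take j (ws[i := v])) @ \<rho> (component p z) (ws[i := v] ! j) # drop (Suc j) (ws[i := v])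
        = ?w[i := parity_twist p v]" for v
      using j by (simp add: list_update_append take_update_swap map_update)
    then show ?thesis
      unfolding coproduct_term_def using clinear_compose[OF up parity_twist_linear] by simp
  next
    case 2
    then have "map (parity_twist p) (take j (ws[i := v])) @ \<rho> (component p z) (ws[i := v] ! j) # drop (Suc j) (ws[i := v])
        = ?w[i := \<rho> (component p z) v]" for v
      using j by (simp add: list_update_append)
    then show ?thesis
      unfolding coproduct_term_def using clinear_compose[OF up lin] by simp
  next
    case 3
    then obtain k where k: "i = Suc (j + k)" using less_iff_Suc_add by auto
    have "map (parity_twist p) (take j (ws[i := v])) @ \<rho> (component p z) (ws[i := v] ! j) # drop (Suc j) (ws[i := v])
        = ?w[i := v]" for v
      using j 3 by (simp add: list_update_append drop_update_swap k)
    then show ?thesis unfolding coproduct_term_def using up by simp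
  qed
qed

text \<open>On homogeneous words this is the usual formula with Koszul signs.\<close>

lemma coproduct_act_homogeneous:
  assumes "cbilinear \<rho>" "homogeneous p z" "length qs = length ws"
    "\<And>i. i < length ws \<Longrightarrow> homogeneous (qs ! i) (ws ! i)"
  shows "coproduct_act \<rho> z (tensor_word ws) =
    (\<Sum>j<length ws. (\<Prod>i<j. koszul p (qs ! i)) *\<^sub>C tensor_word (ws[j := \<rho> z (ws ! j)]))"
proof -
  have tw: "tensor_word (map (parity_twist p) (take j ws)) = (\<Prod>i<j. koszul p (qs ! i)) *\<^sub>C tensor_word (take j ws)"
    if "j \<le> length ws" for j
    using that
  proof (induction j)
    case (Suc j)
    then show ?case
      by (simp add: take_Suc_conv_app_nth tensor_word_append parity_twist_homogeneous[OF assms(4)])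
        (simp add: tensor_word_def clinear_scale[OF tensor_incl_linear] scaleC_mult_left scaleC_mult_right
          scaleC_scaleC mult.commute)
  qed simp
  have "(\<Sum>q\<in>UNIV. \<Sum>j<length ws. coproduct_term \<rho> q (component q z) ws j) =
      (\<Sum>j<length ws. coproduct_term \<rho> p z ws j)"
  proof -
    have 0: "coproduct_term \<rho> q 0 ws j = 0" for q j
      using clinear_0[of "\<lambda>z. \<rho> z (ws ! j)"] assms(1)
      by (simp add: coproduct_term_def tensor_word_def cbilinear_def clinear_0[OF tensor_incl_linear])
    show ?thesis by (cases p) (simp_all add: UNIV_bool component_homogeneous[OF assms(2)] 0)
  qed
  also have "\<dots> = (\<Sum>j<length ws. (\<Prod>i<j. koszul p (qs ! i)) *\<^sub>C tensor_word (ws[j := \<rho> z (ws ! j)]))"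
    by (rule sum.cong)
      (simp_all add: coproduct_term_def tensor_word_append[of "map _ _"] tw upd_conv_take_nth_drop
        tensor_word_append scaleC_mult_left)
  finally show ?thesis by (simp add: coproduct_act_def coproduct_multilinear[OF assms(1)])
qed

text \<open>\<open>permute_act m \<sigma>\<close> is the operator \<open>\<sigma>\<^sup>-\<^sup>1\<close> on the \<open>m\<close>-th tensor power; on non-homogeneous words it is
  defined by multilinearity, summing over the parities \<open>es\<close> of the factors. Positions are
  counted from \<open>0\<close>.\<close>

definition koszul_sign :: "bool list \<Rightarrow> (nat \<Rightarrow> nat) \<Rightarrow> complex" where
  "koszul_sign es \<sigma> =
     (\<Prod>(j, k) \<in> {(j, k). j < k \<and> k < length es \<and> \<sigma> j > \<sigma> k}. koszul (es ! \<sigma> j) (es ! \<sigma> k))"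

definition permute_act :: "nat \<Rightarrow> (nat \<Rightarrow> nat) \<Rightarrow> 'w::superspace tensor_algebra \<Rightarrow> 'w tensor_algebra" where
  "permute_act m \<sigma> = multilinear_lift (\<lambda>ws. if length ws = m
     then \<Sum>es | length es = m.
       koszul_sign es \<sigma> *\<^sub>C tensor_word (map (\<lambda>j. component (es ! \<sigma> j) (ws ! \<sigma> j)) [0..<m])
     else 0)"

lemma permute_multilinear:
  assumes "\<sigma> permutes {..<m}"
  shows "multilinear (\<lambda>ws :: 'w::superspace list. if length ws = m
     then \<Sum>es | length es = m.
       koszul_sign es \<sigma> *\<^sub>C tensor_word (map (\<lambda>j. component (es ! \<sigma> j) (ws ! \<sigma> j)) [0..<m])
     else 0)"
  unfolding multilinear_def length_list_update
proof (intro allI impI)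
  fix ws :: "'w list" and i
  assume i: "i < length ws"
  show "clinear (\<lambda>v. if length ws = m then \<Sum>es | length es = m.
       koszul_sign es \<sigma> *\<^sub>C tensor_word (map (\<lambda>j. component (es ! \<sigma> j) (ws[i := v] ! \<sigma> j)) [0..<m]) else 0)"
  proof (cases "length ws = m")
    case False
    then show ?thesis by (simp add: clinearI)
  next
    case True
    obtain k where k: "k < m" "\<sigma> k = i"
      using assms i True by (metis lessThan_iff permutes_def permutes_in_image)
    have eq: "map (\<lambda>j. component (es ! \<sigma> j) (ws[i := v] ! \<sigma> j)) [0..<m] =
      (map (\<lambda>j. component (es ! \<sigma> j) (ws ! \<sigma> j)) [0..<m])[k := component (es ! i) v]" for es v
    proof (rule nth_equalityI)
      fix j assume "j < length (map (\<lambda>j. component (es ! \<sigma> j) (ws[i := v] ! \<sigma> j)) [0..<m])"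
      then have j: "j < m" by simp
      have "\<sigma> j = i \<longleftrightarrow> j = k" using k(2) permutes_inj[OF assms] by (metis injD)
      then show "map (\<lambda>j. component (es ! \<sigma> j) (ws[i := v] ! \<sigma> j)) [0..<m] ! j =
        (map (\<lambda>j. component (es ! \<sigma> j) (ws ! \<sigma> j)) [0..<m])[k := component (es ! i) v] ! j"
        using j i k by (auto simp: nth_list_update)
    qed simp
    have "clinear (\<lambda>v. tensor_word (map (\<lambda>j. component (es ! \<sigma> j) (ws[i := v] ! \<sigma> j)) [0..<m]))" for es
      unfolding eq
      by (rule clinear_compose[OF multilinear_update[OF tensor_word_multilinear] component_linear])
        (simp add: k)
    then show ?thesis using True
      by (simp add: clinear_sum_fun clinear_scaled)
  qed
qed

lemma permute_act_homogeneous: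
  fixes ws :: "'w::superspace list"
  assumes \<sigma>: "\<sigma> permutes {..<m}" and len: "length ws = m" "length qs = m"
    and hom: "\<And>i. i < m \<Longrightarrow> homogeneous (qs ! i) (ws ! i)"
  shows "permute_act m \<sigma> (tensor_word ws) = koszul_sign qs \<sigma> *\<^sub>C tensor_word (map (\<lambda>j. ws ! \<sigma> j) [0..<m])"
proof -
  let ?t = "\<lambda>es. koszul_sign es \<sigma> *\<^sub>C tensor_word (map (\<lambda>j. component (es ! \<sigma> j) (ws ! \<sigma> j)) [0..<m])"
  have lt: "\<sigma> j < m" if "j < m" for j using that permutes_in_image[OF \<sigma>, of j] by simp
  have "?t es = 0" if es: "length es = m" "es \<noteq> qs" for es
  proof -
    obtain i where i: "i < m" "es ! i \<noteq> qs ! i" using nth_equalityI[of es qs] es len by auto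
    obtain k where k: "k < m" "\<sigma> k = i"
      using \<sigma> i by (metis lessThan_iff permutes_def permutes_in_image)
    have "component (es ! i) (ws ! i) = 0" using component_homogeneous[OF hom[OF i(1)]] i(2) by auto
    then have "tensor_incl 0 \<in> set (map tensor_incl (map (\<lambda>j. component (es ! \<sigma> j) (ws ! \<sigma> j)) [0..<m]))"
      using k by force
    then have "0 \<in> set (map tensor_incl (map (\<lambda>j. component (es ! \<sigma> j) (ws ! \<sigma> j)) [0..<m]))"
      by (simp add: clinear_0[OF tensor_incl_linear])
    then have "tensor_word (map (\<lambda>j. component (es ! \<sigma> j) (ws ! \<sigma> j)) [0..<m]) = 0"
      unfolding tensor_word_def
    proof -
      have "0 \<in> set xs \<Longrightarrow> prod_list xs = 0" for xs :: "'w tensor_algebra list"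
        by (induction xs) auto
      then show "0 \<in> set (map tensor_incl (map (\<lambda>j. component (es ! \<sigma> j) (ws ! \<sigma> j)) [0..<m])) \<Longrightarrow>
        prod_list (map tensor_incl (map (\<lambda>j. component (es ! \<sigma> j) (ws ! \<sigma> j)) [0..<m])) = 0" .
    qed
    then show ?thesis by simp
  qed
  then have "(\<Sum>es | length es = m. ?t es) = (\<Sum>es\<in>{qs}. ?t es)"
    using len finite_lists_length_eq[of "UNIV :: bool set" m]
    by (intro sum.mono_neutral_right) auto
  moreover have "map (\<lambda>j. component (qs ! \<sigma> j) (ws ! \<sigma> j)) [0..<m] = map (\<lambda>j. ws ! \<sigma> j) [0..<m]"
    using hom lt by (simp add: homogeneous_def)
  ultimately show ?thesis by (simp add: permute_act_def permute_multilinear[OF \<sigma>] len)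
qed

text \<open>The complex span of the \<open>\<Sum>\<sigma>. \<sigma>\<^sup>-\<^sup>1 (w\<^sub>1 \<otimes> \<cdots> \<otimes> w\<^sub>m)\<close>.\<close>

definition symmetrized_power :: "nat \<Rightarrow> 'w::superspace tensor_algebra set" where
  "symmetrized_power m =
     cvec.span {\<Sum>\<sigma> | \<sigma> permutes {..<m}. permute_act m \<sigma> (tensor_word ws) |ws. length ws = m}"

lemma coproduct_act_Cons:
  assumes "cbilinear \<rho>"
  shows "coproduct_act \<rho> z (tensor_incl w * t) = tensor_incl (\<rho> z w) * t +
    (\<Sum>p\<in>UNIV. tensor_incl (parity_twist p w) * coproduct_act \<rho> (component p z) t)"
proof (induction t rule: tensor_algebra_induct)
  note lin = multilinear_lift_linear[OF coproduct_multilinear[OF assms], folded coproduct_act_def]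
  note word = multilinear_lift_word[OF coproduct_multilinear[OF assms], folded coproduct_act_def]
  have 0: "coproduct_term \<rho> q 0 ws j = 0" for q ws j
    using clinear_0[of "\<lambda>z. \<rho> z (ws ! j)"] assms(1)
    by (simp add: coproduct_term_def tensor_word_def cbilinear_def clinear_0[OF tensor_incl_linear])
  {
    case (scale c ws)
    have "tensor_incl w * tensor_word ws = tensor_word (w # ws)"
      by (simp add: tensor_word_def)
    moreover have "coproduct_act \<rho> z (tensor_word (w # ws)) = tensor_incl (\<rho> z w) * tensor_word ws +
      (\<Sum>p\<in>UNIV. tensor_incl (parity_twist p w) * coproduct_act \<rho> (component p z) (tensor_word ws))"
    proof -
      have sums: "(\<Sum>j<length ws. coproduct_term \<rho> p (component p z) ws j) =
          coproduct_act \<rho> (component p z) (tensor_word ws)" for p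
        by (cases p) (simp_all add: word UNIV_bool component_component 0)
      have "coproduct_act \<rho> z (tensor_word (w # ws)) =
        (\<Sum>p\<in>UNIV. coproduct_term \<rho> p (component p z) (w # ws) 0 +
          (\<Sum>j<length ws. coproduct_term \<rho> p (component p z) (w # ws) (Suc j)))"
        by (simp add: word sum.lessThan_Suc_shift del: sum.lessThan_Suc)
      also have "\<dots> = (\<Sum>p\<in>UNIV. tensor_incl (\<rho> (component p z) w) * tensor_word ws) +
        (\<Sum>p\<in>UNIV. tensor_incl (parity_twist p w) * (\<Sum>j<length ws. coproduct_term \<rho> p (component p z) ws j))"
        by (simp add: sum.distrib coproduct_term_def tensor_word_def sum_distrib_left mult.assoc)
      also have "(\<Sum>p\<in>UNIV. tensor_incl (\<rho> (component p z) w) * tensor_word ws) = tensor_incl (\<rho> z w) * tensor_word ws"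
      proof -
        have "\<rho> z w = \<rho> (component False z) w + \<rho> (component True z) w"
          using cbilinearD(1)[OF assms] component_sum by metis
        then show ?thesis by (simp add: UNIV_bool clinear_add[OF tensor_incl_linear] distrib_right)
      qed
      finally show ?thesis by (simp only: sums)
    qed
    ultimately show ?case
      by (simp add: scaleC_mult_right clinear_scale[OF lin] scaleC_add_right cvec.scale_sum_right)
  next
    case (add s t)
    then show ?case
      by (simp add: distrib_left clinear_add[OF lin] sum.distrib)
  }
qed

text \<open>The super coproduct makes the tensor algebra of a supermodule into a module.\<close>

lemma coproduct_act_representation:
  fixes \<rho> :: "'g::lie_superalgebra \<Rightarrow> 'w::superspace \<Rightarrow> 'w"
  assumes \<rho>: "representation \<rho>"
    and par: "\<And>p q z w. homogeneous p z \<Longrightarrow> homogeneous q w \<Longrightarrow> homogeneous (p \<noteq> q) (\<rho> z w)"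
  shows "representation (coproduct_act \<rho>)"
proof -
  have bil: "cbilinear \<rho>" using \<rho> by (simp add: representation_def)
  note lin = multilinear_lift_linear[OF coproduct_multilinear[OF bil], folded coproduct_act_def]
  note word = multilinear_lift_word[OF coproduct_multilinear[OF bil], folded coproduct_act_def]
  note b = cbilinearD[OF bil]
  note i = clinear_add[OF tensor_incl_linear] clinear_scale[OF tensor_incl_linear]
    clinear_diff[OF tensor_incl_linear]
  have one: "coproduct_act \<rho> z 1 = 0" for z
    using word[of z "[]"] by (simp add: tensor_word_def)
  have act_Cons: "coproduct_act \<rho> z (tensor_incl w * t) =
      tensor_incl (\<rho> z w) * t + tensor_incl (parity_twist p w) * coproduct_act \<rho> z t"
    if "homogeneous p z" for z p w t
  proof -
    have "coproduct_act \<rho> 0 t = 0" for t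
    proof (induction t rule: tensor_algebra_induct)
      case (scale c ws)
      have "\<rho> 0 w = 0" for w using b(3)[of 0 0 w] by simp
      then show ?case
        by (simp add: clinear_scale[OF lin] word coproduct_term_def tensor_word_append)
          (simp add: tensor_word_def clinear_0[OF tensor_incl_linear])
    qed (simp add: clinear_add[OF lin])
    then show ?thesis
      by (cases p) (simp_all add: coproduct_act_Cons[OF bil] UNIV_bool component_homogeneous[OF that])
  qed
  have twist_act: "parity_twist p (\<rho> y w) = koszul p q *\<^sub>C \<rho> y (parity_twist p w)"
    if y: "homogeneous q y" for p q y w
  proof -
    have "parity_twist p (\<rho> y v) = koszul p q *\<^sub>C \<rho> y (parity_twist p v)" if "homogeneous r v" for r v
      using parity_twist_homogeneous[OF par[OF y that], of p] parity_twist_homogeneous[OF that, of p]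
      using b(4)[of y "-1" v]
      by (cases p; cases q; cases r) (simp_all add: b koszul_def scaleC_scaleC)
    from this[of False "component False w"] this[of True "component True w"]
    have "parity_twist p (\<rho> y (component False w + component True w)) =
      koszul p q *\<^sub>C \<rho> y (parity_twist p (component False w + component True w))"
      by (simp only: b clinear_add[OF parity_twist_linear] scaleC_add_right homogeneous_component)
    then show ?thesis by (simp only: component_sum)
  qed
  have lie: "coproduct_act \<rho> (bracket x y) (tensor_word ws) =
      coproduct_act \<rho> x (coproduct_act \<rho> y (tensor_word ws)) -
      koszul p q *\<^sub>C coproduct_act \<rho> y (coproduct_act \<rho> x (tensor_word ws))"
    if x: "homogeneous p x" and y: "homogeneous q y" for p q x y ws
  proof (induction ws)
    case Nil
    show ?case by (simp add: tensor_word_def one clinear_0[OF lin])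
  next
    case (Cons w ws)
    let ?D = "coproduct_act \<rho>" let ?t = "tensor_word ws"
    have ww: "tensor_word (w # ws) = tensor_incl w * ?t" by (simp add: tensor_word_def)
    have rb: "\<rho> (bracket x y) w = \<rho> x (\<rho> y w) - koszul p q *\<^sub>C \<rho> y (\<rho> x w)"
      using \<rho> x y by (simp add: representation_def)
    have tt: "parity_twist p (parity_twist q w) = parity_twist (p \<noteq> q) w"
      "parity_twist q (parity_twist p w) = parity_twist (p \<noteq> q) w"
      by (cases p; cases q; simp add: parity_twist_def UNIV_bool koszul_def component_add component_component
          component_scaleC component_sum clinear_diff[OF component_linear])+
    have kk: "koszul p q * koszul q p = 1" "koszul q p = koszul p q" by (auto simp: koszul_def)
    have "?D x (?D y (tensor_incl w * ?t)) =
        tensor_incl (\<rho> x (\<rho> y w)) * ?t + koszul p q *\<^sub>C (tensor_incl (\<rho> y (parity_twist p w)) * ?D x ?t) +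
        (tensor_incl (\<rho> x (parity_twist q w)) * ?D y ?t + tensor_incl (parity_twist (p \<noteq> q) w) * ?D x (?D y ?t))"
      by (simp add: act_Cons[OF x] act_Cons[OF y] clinear_add[OF lin] twist_act[OF y] i scaleC_mult_left tt)
    moreover have "?D y (?D x (tensor_incl w * ?t)) =
        tensor_incl (\<rho> y (\<rho> x w)) * ?t + koszul p q *\<^sub>C (tensor_incl (\<rho> x (parity_twist q w)) * ?D y ?t) +
        (tensor_incl (\<rho> y (parity_twist p w)) * ?D x ?t + tensor_incl (parity_twist (p \<noteq> q) w) * ?D y (?D x ?t))"
      by (simp add: act_Cons[OF x] act_Cons[OF y] clinear_add[OF lin] twist_act[OF x] i scaleC_mult_left tt kk)
    moreover have "?D (bracket x y) (tensor_incl w * ?t) =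
        tensor_incl (\<rho> x (\<rho> y w)) * ?t - koszul p q *\<^sub>C (tensor_incl (\<rho> y (\<rho> x w)) * ?t) +
        tensor_incl (parity_twist (p \<noteq> q) w) * (?D x (?D y ?t) - koszul p q *\<^sub>C ?D y (?D x ?t))"
      by (simp add: act_Cons[OF bracket_graded[OF x y]] rb i scaleC_mult_left left_diff_distrib Cons.IH)
    ultimately show ?case
      unfolding ww
      by (simp only: scaleC_add_right scaleC_scaleC kk(1)[unfolded kk(2)] scaleC_one scaleC_mult_right
          right_diff_distrib) (simp add: algebra_simps)
  qed
  show ?thesis
    unfolding representation_def
  proof (intro conjI allI impI)
    show "cbilinear (coproduct_act \<rho>)"
    proof (rule cbilinearI)
      have z: "clinear (\<lambda>z. coproduct_term \<rho> p (component p z) ws j)" for p ws j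
        unfolding coproduct_term_def tensor_word_append
        by (rule clinearI) (simp_all add: tensor_word_def b component_add component_scaleC i
            distrib_left distrib_right scaleC_mult_left scaleC_mult_right)
      have l: "clinear (\<lambda>z. \<Sum>p\<in>UNIV. \<Sum>j<length ws. coproduct_term \<rho> p (component p z) ws j)" for ws
        by (intro clinear_sum_fun z)
      show "coproduct_act \<rho> (x + y) t = coproduct_act \<rho> x t + coproduct_act \<rho> y t" for x y t
        by (induction t rule: tensor_algebra_induct)
          (simp_all only: clinear_scale[OF lin] clinear_add[OF lin] word clinear_add[OF l]
            scaleC_add_right add_ac)
      show "coproduct_act \<rho> (c *\<^sub>C x) t = c *\<^sub>C coproduct_act \<rho> x t" for c x t
        by (induction t rule: tensor_algebra_induct)
          (simp_all add: clinear_scale[OF lin] clinear_add[OF lin] word clinear_scale[OF l]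
            scaleC_add_right scaleC_scaleC mult.commute)
    qed (simp_all add: clinear_add[OF lin] clinear_scale[OF lin])
    fix p q and x y :: 'g and t
    assume h: "homogeneous p (x::'g)" "homogeneous q (y::'g)"
    show "coproduct_act \<rho> (bracket x y) t = coproduct_act \<rho> x (coproduct_act \<rho> y t) -
        koszul p q *\<^sub>C coproduct_act \<rho> y (coproduct_act \<rho> x t)"
    proof (induction t rule: tensor_algebra_induct)
      case (scale c ws)
      show ?case
        by (simp add: clinear_scale[OF lin] lie[OF h] cvec.scale_right_diff_distrib scaleC_scaleC mult.commute)
    next
      case (add s t)
      then show ?case by (simp add: clinear_add[OF lin] scaleC_add_right)
    qed
  qed
qed

section \<open>The module of supersymmetrized tensors\<close>

definition map_natural_act ::
  "(sl21, 'a::complex_comm_algebra) tensor \<Rightarrow> (natural_module, 'a) tensor \<Rightarrow> (natural_module, 'a) tensor"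
  where "map_natural_act = tensor_lift2 natural_act"

lemma map_natural_act_pure: "map_natural_act (z \<otimes> a) (w \<otimes> b) = natural_act z w \<otimes> (a * b)"
  by (simp add: map_natural_act_def tensor_lift2_pure natural_act_bilinear)

lemma natural_act_graded:
  "homogeneous p z \<Longrightarrow> homogeneous q w \<Longrightarrow> homogeneous (p \<noteq> q) (natural_act z w)"
  unfolding homogeneous_def
proof (transfer, goal_cases)
  case (1 p M q v)
  have M: "M $ i $ j = 0" if "((i = 3) \<noteq> (j = 3)) \<noteq> p" for i j
    using arg_cong[OF 1(2), of "\<lambda>X. X $ i $ j"] that by (simp add: block_nth)
  have v: "v $ j = 0" if "(j = 3) \<noteq> q" for j
    using arg_cong[OF 1(3), of "\<lambda>X. X $ j"] that by simp
  have "(M *v v) $ i = 0" if "(i = 3) \<noteq> (p \<noteq> q)" for i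
  proof -
    have "M $ i $ k * v $ k = 0" for k
      using M[of i k] v[of k] that by (cases "((i = 3) \<noteq> (k = 3)) = p") auto
    then show ?thesis by (simp only: matrix_vector_mult_def vec_lambda_beta sum.neutral_const)
  qed
  then show ?case by (simp add: vec_eq_iff)
qed

lemma natural_act_bracket:
  assumes "homogeneous p x" "homogeneous q y"
  shows "natural_act (bracket x y) v = natural_act x (natural_act y v) - koszul p q *\<^sub>C natural_act y (natural_act x v)"
  using assms unfolding homogeneous_def
proof (transfer, goal_cases)
  case (1 p M q N v)
  have "(c *\<^sub>C A) *v v = c *\<^sub>C (A *v v)" for c and A :: "complex^3^3"
    by (simp add: vec_eq_iff matrix_vector_mult_def sum_distrib_left mult.assoc)
  then show ?case
    using 1 by (simp add: supercommutator_homogeneous matrix_vector_mult_diff_rdistrib matrix_vector_mul_assoc)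
qed

lemma map_natural_act_bilinear: "cbilinear map_natural_act"
  unfolding map_natural_act_def by (rule tensor_lift2_bilinear[OF natural_act_bilinear])

lemma map_natural_act_graded:
  assumes "homogeneous p z" "homogeneous q w"
  shows "homogeneous (p \<noteq> q) (map_natural_act z w)"
proof -
  note lin = cbilinearD[OF map_natural_act_bilinear] component_add
  have "component (p \<noteq> q) (map_natural_act (component p z) (component q w)) =
      map_natural_act (component p z) (component q w)"
  proof (induction z rule: tensor_induct)
    case (pure z a)
    show ?case
    proof (induction w rule: tensor_induct)
      case (pure w b)
      have "component (p \<noteq> q) (natural_act (component p z) (component q w)) = natural_act (component p z) (component q w)"
        using natural_act_graded[of p "component p z" q "component q w"]
        by (simp add: homogeneous_def component_component)
      then show ?case by (simp add: map_natural_act_pure)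
    qed (simp add: lin)
  qed (simp add: lin)
  then show ?thesis using assms by (simp add: homogeneous_def)
qed

lemma map_natural_act_representation: "representation map_natural_act"
  unfolding representation_def
proof (intro conjI allI impI map_natural_act_bilinear)
  fix p q and x y :: "(sl21, 'a::complex_comm_algebra) tensor" and v
  assume xy: "homogeneous p x" "homogeneous q y"
  note lin = cbilinearD[OF map_natural_act_bilinear] component_add bracket_add_left
    bracket_add_right scaleC_add_right
  have "map_natural_act (bracket (component p x) (component q y)) v =
      map_natural_act (component p x) (map_natural_act (component q y) v) -
      koszul p q *\<^sub>C map_natural_act (component q y) (map_natural_act (component p x) v)"
  proof (induction x rule: tensor_induct)
    case (pure x a)
    show ?case
    proof (induction y rule: tensor_induct)
      case (pure y b)
      show ?case
      proof (induction v rule: tensor_induct)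
        case (pure v c)
        have m: "(u - u') \<otimes> d = u \<otimes> d - u' \<otimes> d" for u u' :: natural_module and d :: 'a
          using pure_tensor_add_left[of "u - u'" u' d] by simp
        show ?case
          using natural_act_bracket[of p "component p x" q "component q y" v]
          by (simp add: map_natural_act_pure m pure_tensor_scale_left mult.assoc mult.left_commute[of b a])
      qed (simp add: lin)
    qed (simp add: lin)
  qed (simp add: lin)
  then show "map_natural_act (bracket x y) v =
      map_natural_act x (map_natural_act y v) - koszul p q *\<^sub>C map_natural_act y (map_natural_act x v)"
    using xy by (simp add: homogeneous_def)
qed

section \<open>The standard basis of sl(2,1)\<close>

definition matrix_unit :: "3 \<Rightarrow> 3 \<Rightarrow> complex^3^3" where
  "matrix_unit i j = (\<chi> k l. if k = i \<and> l = j then 1 else 0)"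

text \<open>\<open>sl_y1, sl_y2, sl_y3\<close> stand for \<open>x\<^bsub>-1\<^esub>, x\<^bsub>-2\<^esub>, x\<^bsub>-3\<^esub>\<close>.\<close>

lift_definition sl_h1 :: sl21 is "matrix_unit 1 1 - matrix_unit 2 2" by (simp add: matrix_unit_def)
lift_definition sl_h2 :: sl21 is "matrix_unit 2 2 + matrix_unit 3 3" by (simp add: matrix_unit_def)
lift_definition sl_x1 :: sl21 is "matrix_unit 1 2" by (simp add: matrix_unit_def)
lift_definition sl_x2 :: sl21 is "matrix_unit 2 3" by (simp add: matrix_unit_def)
lift_definition sl_x3 :: sl21 is "matrix_unit 1 3" by (simp add: matrix_unit_def)
lift_definition sl_y1 :: sl21 is "matrix_unit 2 1" by (simp add: matrix_unit_def)
lift_definition sl_y2 :: sl21 is "matrix_unit 3 2" by (simp add: matrix_unit_def)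
lift_definition sl_y3 :: sl21 is "matrix_unit 3 1" by (simp add: matrix_unit_def)

definition cartan :: "sl21 set" where "cartan = cvec.span {sl_h1, sl_h2}"
definition n_plus :: "sl21 set" where "n_plus = cvec.span {sl_x1, sl_x2, sl_x3}"

text \<open>The functional dual to \<^const>\<open>sl_h1\<close>; only its values on \<^const>\<open>cartan\<close> are used.\<close>

lift_definition omega1 :: "sl21 \<Rightarrow> complex" is "\<lambda>M. M $ 1 $ 1" .

lemma omega1: "clinear omega1" "omega1 sl_h1 = 1" "omega1 sl_h2 = 0"
  by (rule clinearI; transfer; simp) (transfer; simp add: matrix_unit_def)+

definition v1 :: natural_module where "v1 = Vec (axis 1 1)"

section \<open>The module with one generator and defining relations\<close>

text \<open>\<open>weyl_relations m\<close> consists of the \<open>r\<close> for which \<open>r w = 0\<close> is one of the defining relations. The module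
  is the quotient of the enveloping algebra by the left ideal they generate, and its generator \<open>w\<close> is
  the coset of \<open>1\<close>.\<close>

inductive_set weyl_relations :: "nat \<Rightarrow> (sl21, 'a::complex_comm_algebra) tensor uea set" for m where
  "x \<in> n_plus \<Longrightarrow> uea_incl (x \<otimes> a) \<in> weyl_relations m"
| "h \<in> cartan \<Longrightarrow> uea_incl (h \<otimes> 1) - (of_nat m * omega1 h) *\<^sub>C 1 \<in> weyl_relations m"
| "uea_incl (sl_y1 \<otimes> 1) ^ (m + 1) \<in> weyl_relations m"
| "uea_incl (sl_y2 \<otimes> a) \<in> weyl_relations m"

definition left_ideal_span :: "'r::{complex_vector, times} set \<Rightarrow> 'r set" where
  "left_ideal_span R = cvec.span {u * r |u r. r \<in> R}"

definition weyl_ideal :: "nat \<Rightarrow> (sl21, 'a::complex_comm_algebra) tensor uea set" where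
  "weyl_ideal m = left_ideal_span (weyl_relations m)"

text \<open>The quotient of a space by a subspace \<open>J\<close>, as the set of cosets; sums of cosets are sums of
  sets as in \<^theory>\<open>HOL-Library.Set_Algebras\<close>.\<close>

definition coset_space :: "'u::complex_vector set \<Rightarrow> 'u set set" where
  "coset_space J = range (\<lambda>u. u +o J)"

definition coset_lincomb :: "'u::complex_vector set \<Rightarrow> ('i \<Rightarrow>\<^sub>0 complex) \<Rightarrow> ('i \<Rightarrow> 'u set) \<Rightarrow> 'u set" where
  "coset_lincomb J c e = J + (\<Sum>i\<in>Poly_Mapping.keys c. scaleC (Poly_Mapping.lookup c i) ` e i)"

text \<open>A family is a basis if every element has a unique expansion as a finite linear combination; in
  particular the family is injective.\<close>

definition coset_basis :: "'u::complex_vector set \<Rightarrow> 'i set \<Rightarrow> ('i \<Rightarrow> 'u set) \<Rightarrow> bool" where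
  "coset_basis J I e \<longleftrightarrow> e ` I \<subseteq> coset_space J \<and>
     (\<forall>X\<in>coset_space J. \<exists>!c. Poly_Mapping.keys c \<subseteq> I \<and> coset_lincomb J c e = X)"

definition weyl_module :: "nat \<Rightarrow> (sl21, 'a::complex_comm_algebra) tensor uea set set" where
  "weyl_module m = coset_space (weyl_ideal m)"

definition weyl_act ::
  "nat \<Rightarrow> (sl21, 'a::complex_comm_algebra) tensor uea \<Rightarrow> (sl21, 'a) tensor uea set \<Rightarrow> (sl21, 'a) tensor uea set"
  where "weyl_act m u X = (u *o X) + weyl_ideal m"

definition weyl_gen :: "nat \<Rightarrow> (sl21, 'a::complex_comm_algebra) tensor uea set" where
  "weyl_gen m = 1 +o weyl_ideal m"

lemma coset_add:
  assumes "cvec.subspace J"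
  shows "(x +o J) + (y +o J) = (x + y) +o J"
proof -
  have "J + J = J"
    using cvec.subspace_add[OF assms] cvec.subspace_0[OF assms]
    by (auto simp: set_plus_def) (metis add_0)
  then show ?thesis by (simp add: set_plus_rearrange)
qed

lemma coset_lincomb:
  assumes J: "cvec.subspace J"
  shows "coset_lincomb J c (\<lambda>i. x i +o J) = (\<Sum>i\<in>Poly_Mapping.keys c. Poly_Mapping.lookup c i *\<^sub>C x i) +o J"
proof -
  have sc: "scaleC d ` (y +o J) = d *\<^sub>C y +o J" if "d \<noteq> 0" for d y
  proof -
    have "scaleC d ` J = J"
    proof
      show "J \<subseteq> scaleC d ` J"
      proof
        fix z assume "z \<in> J"
        then have "inverse d *\<^sub>C z \<in> J" by (rule cvec.subspace_scale[OF J])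
        moreover have "z = d *\<^sub>C inverse d *\<^sub>C z" using that by (simp add: scaleC_scaleC)
        ultimately show "z \<in> scaleC d ` J" by blast
      qed
    qed (use cvec.subspace_scale[OF J] in auto)
    moreover have "scaleC d ` (y +o J) = d *\<^sub>C y +o scaleC d ` J"
      by (force simp: elt_set_plus_def scaleC_add_right image_iff)
    ultimately show ?thesis by simp
  qed
  have "J + (\<Sum>i\<in>S. scaleC (Poly_Mapping.lookup c i) ` (x i +o J)) = (\<Sum>i\<in>S. Poly_Mapping.lookup c i *\<^sub>C x i) +o J"
    if "finite S" "S \<subseteq> Poly_Mapping.keys c" for S
    using that
  proof (induction S)
    case empty
    then show ?case by simp
  next
    case (insert i S)
    let ?y = "\<lambda>i. Poly_Mapping.lookup c i *\<^sub>C x i" and ?Y = "\<lambda>i. scaleC (Poly_Mapping.lookup c i) ` (x i +o J)"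
    have "J + (\<Sum>i\<in>insert i S. ?Y i) = ?Y i + (J + (\<Sum>i\<in>S. ?Y i))"
      using insert.hyps by (simp add: add.left_commute[of J])
    also have "J + (\<Sum>i\<in>S. ?Y i) = (\<Sum>i\<in>S. ?y i) +o J"
      using insert.IH insert.prems by simp
    also have "?Y i = ?y i +o J"
      using insert.prems by (intro sc) (simp add: in_keys_iff)
    also have "(?y i +o J) + ((\<Sum>i\<in>S. ?y i) +o J) = (\<Sum>i\<in>insert i S. ?y i) +o J"
      using insert.hyps by (simp add: coset_add[OF J])
    finally show ?case .
  qed
  then show ?thesis by (simp add: coset_lincomb_def)
qed

lemma subspace_weyl_ideal: "cvec.subspace (weyl_ideal m)"
  unfolding weyl_ideal_def left_ideal_span_def by (rule cvec.subspace_span)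

lemma weyl_ideal_mult:
  assumes "x \<in> weyl_ideal m"
  shows "u * x \<in> weyl_ideal m"
  using assms unfolding weyl_ideal_def left_ideal_span_def
proof (induction rule: cvec.span_induct_alt)
  case base
  show ?case by (simp add: cvec.span_zero)
next
  case (step c y z)
  then obtain u' r where y: "y = u' * r" "r \<in> weyl_relations m" by blast
  have "u * y \<in> {u * r |u r. r \<in> weyl_relations m}"
    using y by (auto simp flip: mult.assoc)
  then show ?case using step
    by (simp add: distrib_left scaleC_mult_right cvec.span_add cvec.span_scale cvec.span_base)
qed

lemma weyl_act_coset: "weyl_act m u (x +o weyl_ideal m) = (u * x) +o weyl_ideal m"
proof (rule set_eqI)
  fix z
  have "z \<in> (u * x) +o weyl_ideal m" if z: "z \<in> weyl_act m u (x +o weyl_ideal m)"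
  proof -
    obtain j k where "z = u * (x + j) + k" and jk: "j \<in> weyl_ideal m" "k \<in> weyl_ideal m"
      using z by (auto simp: weyl_act_def elt_set_plus_def elt_set_times_def set_plus_def)
    then have "z = u * x + (u * j + k)" by (simp add: distrib_left add.assoc)
    moreover have "u * j + k \<in> weyl_ideal m"
      by (rule cvec.subspace_add[OF subspace_weyl_ideal weyl_ideal_mult[OF jk(1)] jk(2)])
    ultimately show ?thesis by (auto simp: elt_set_plus_def)
  qed
  moreover have "z \<in> weyl_act m u (x +o weyl_ideal m)" if z: "z \<in> (u * x) +o weyl_ideal m"
  proof -
    have "x \<in> x +o weyl_ideal m"
      using cvec.subspace_0[OF subspace_weyl_ideal, of m] by (force simp: elt_set_plus_def)
    then show ?thesis
      using z unfolding weyl_act_def elt_set_plus_def elt_set_times_def set_plus_def by blast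
  qed
  ultimately show "z \<in> weyl_act m u (x +o weyl_ideal m) \<longleftrightarrow> z \<in> (u * x) +o weyl_ideal m" by blast
qed

section \<open>The elements p\<close>

text \<open>Finitely supported functions with values in the natural numbers are multisets.\<close>

definition multinomial :: "'a multiset \<Rightarrow> complex" where
  "multinomial \<psi> = fact (size \<psi>) / (\<Prod>a\<in>set_mset \<psi>. fact (count \<psi> a))"

function p1 :: "'a multiset \<Rightarrow> 'a multiset \<Rightarrow> (sl21, 'a::complex_comm_algebra) tensor uea" where
  "p1 \<phi> \<theta> =
    (if \<phi> \<noteq> {#} then
       (- 1 / of_nat (size \<phi>)) *\<^sub>C (\<Sum>d\<in>set_mset \<phi>. \<Sum>\<psi>\<in>{\<psi>. \<psi> \<subseteq># \<theta>}.
          multinomial \<psi> *\<^sub>C (uea_incl (sl_y1 \<otimes> (d * prod_mset \<psi>)) * p1 (\<phi> - {#d#}) (\<theta> - \<psi>)))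
     else if \<theta> \<noteq> {#} then
       (- 1 / of_nat (size \<theta>)) *\<^sub>C (\<Sum>\<psi>\<in>{\<psi>. \<psi> \<subseteq># \<theta>} - {{#}}.
          multinomial \<psi> *\<^sub>C (uea_incl (sl_h1 \<otimes> prod_mset \<psi>) * p1 {#} (\<theta> - \<psi>)))
     else 1)"
  by pat_completeness auto
termination
proof (relation "Wellfounded.measure (\<lambda>(\<phi>, \<theta>). size \<phi> + size \<theta>)", goal_cases)
  case (2 \<phi> \<theta> d \<psi>)
  then have "size (\<phi> - {#d#}) < size \<phi>" by (simp add: size_Diff1_less)
  moreover have "size (\<theta> - \<psi>) \<le> size \<theta>" by (simp add: size_mset_mono)
  ultimately show ?case by simp
next
  case (3 \<phi> \<theta> \<psi>)
  then show ?case by (auto simp: size_Diff_submset nonempty_has_size dest: size_mset_mono)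
qed simp

declare p1.simps [simp del]

definition X_minus3 :: "'a list \<Rightarrow> (sl21, 'a::complex_comm_algebra) tensor uea" where
  "X_minus3 \<xi> = prod_list (map (\<lambda>a. uea_incl (sl_y3 \<otimes> a)) \<xi>)"

definition p_elem :: "'a multiset \<Rightarrow> 'a multiset \<Rightarrow> 'a list \<Rightarrow> (sl21, 'a::complex_comm_algebra) tensor uea" where
  "p_elem \<phi>\<^sub>1 \<phi>\<^sub>2 \<xi> = p1 \<phi>\<^sub>2 \<phi>\<^sub>1 * X_minus3 \<xi>"

lemma finite_submultisets: "finite {\<psi>. \<psi> \<subseteq># \<theta>}"
proof (rule finite_subset)
  show "{\<psi>. \<psi> \<subseteq># \<theta>} \<subseteq> mset ` {xs. set xs \<subseteq> set_mset \<theta> \<and> length xs \<le> size \<theta>}"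
  proof
    fix \<psi> assume "\<psi> \<in> {\<psi>. \<psi> \<subseteq># \<theta>}"
    moreover obtain xs where "mset xs = \<psi>" using ex_mset by blast
    ultimately show "\<psi> \<in> mset ` {xs. set xs \<subseteq> set_mset \<theta> \<and> length xs \<le> size \<theta>}"
      using set_mset_mono[of \<psi> \<theta>] size_mset_mono[of \<psi> \<theta>] by (auto intro!: image_eqI[of _ _ xs])
  qed
  show "finite (mset ` {xs. set xs \<subseteq> set_mset \<theta> \<and> length xs \<le> size \<theta>})"
    by (intro finite_imageI finite_lists_length_le) simp
qed

lemma sl_y3_anticommute:
  "uea_incl (sl_y3 \<otimes> a) * uea_incl (sl_y3 \<otimes> b) = - (uea_incl (sl_y3 \<otimes> b) * uea_incl (sl_y3 \<otimes> a))"
proof -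
  have odd: "component True sl_y3 = sl_y3"
    by transfer (simp add: vec_eq_iff forall_3 block_nth matrix_unit_def)
  have "bracket sl_y3 sl_y3 = 0"
    by transfer (simp add: matrix3_simps matrix_unit_def)
  then show ?thesis
    using uea_incl_bracket[of True "sl_y3 \<otimes> a" True "sl_y3 \<otimes> b"]
    by (simp add: homogeneous_def odd koszul_def clinear_0[OF uea_incl_linear])
qed

text \<open>Since the \<open>x\<^bsub>-3\<^esub> \<otimes> a\<close> anticommute, \<open>X\<^bsub>-3\<^esub>(\<xi>)\<close> depends up to sign only on the multiset of values
  of \<open>\<xi>\<close>, and it vanishes when a value is repeated.\<close>

lemma X_minus3_swap: "X_minus3 (xs @ a # b # ys) = - X_minus3 (xs @ b # a # ys)"
proof -
  have "X_minus3 (xs @ a # b # ys) = X_minus3 xs * (uea_incl (sl_y3 \<otimes> a) * uea_incl (sl_y3 \<otimes> b)) * X_minus3 ys" for a b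
    by (simp add: X_minus3_def mult.assoc)
  then show ?thesis by (simp add: sl_y3_anticommute[of a b])
qed

lemma X_minus3_not_distinct:
  assumes "\<not> distinct \<xi>"
  shows "X_minus3 \<xi> = 0"
proof -
  have "X_minus3 (xs @ a # ys @ a # zs) = 0" for xs and a :: 'a and ys zs
  proof (induction ys arbitrary: xs)
    case Nil
    let ?X = "X_minus3 (xs @ a # a # zs)"
    have "?X + ?X = 0" using X_minus3_swap[of xs a a zs] by (simp only: eq_neg_iff_add_eq_0)
    then have "2 *\<^sub>C ?X = 0" using scaleC_add_left[of 1 1 ?X] by simp
    then show ?case by simp
  next
    case (Cons b ys)
    show ?case using X_minus3_swap[of xs a b "ys @ a # zs"] Cons[of "xs @ [b]"] by simp
  qed
  then show ?thesis using not_distinct_decomp[OF assms] by force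
qed

text \<open>So the words \<open>\<xi>\<close> in \<open>B\<close> contribute linearly independent elements only if repeated values are
  excluded and a single ordering of each finite subset of \<open>B\<close> is used. Such a choice of orderings
  is, for instance, the set of strictly increasing words for a linear order on \<open>B\<close>.\<close>

definition orderings_of_subsets :: "'a set \<Rightarrow> 'a list set \<Rightarrow> bool" where
  "orderings_of_subsets B \<Xi> \<longleftrightarrow> (\<forall>\<xi>\<in>\<Xi>. distinct \<xi>) \<and> bij_betw set \<Xi> {F. finite F \<and> F \<subseteq> B}"

lemma orderings_of_subsets_exist: "\<exists>\<Xi>. orderings_of_subsets B \<Xi>"
proof -
  obtain w :: "'a set \<Rightarrow> 'a list" where w: "\<And>F. finite F \<Longrightarrow> set (w F) = F \<and> distinct (w F)"
    using finite_distinct_list by metis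
  then have "bij_betw set (w ` {F. finite F \<and> F \<subseteq> B}) {F. finite F \<and> F \<subseteq> B}"
    unfolding bij_betw_def inj_on_def by (auto simp: image_image)
  then have "orderings_of_subsets B (w ` {F. finite F \<and> F \<subseteq> B})"
    using w by (auto simp: orderings_of_subsets_def)
  then show ?thesis ..
qed

end

theory Submission
  imports Defs
begin

text \<open>Let \<open>e = v\<^sub>1 \<otimes> 1\<close>, and let \<open>\<zeta> : V \<otimes> A \<rightarrow> \<gg> \<otimes> A\<close> be the even linear map with \<open>\<zeta> x e = x\<close> given by
  \<open>v\<^sub>1, v\<^sub>2, v\<^sub>3 \<mapsto> h\<^sub>1, x\<^bsub>-1\<^esub>, x\<^bsub>-3\<^esub>\<close>. In every module with a vector \<open>w\<close> that satisfies the defining relations,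
  the recursion \<open>P 1 = w\<close>, \<open>P (x \<otimes> t) = \<zeta> x (P t) - P (\<zeta> x t)\<close> defines a linear map \<open>P\<close> on the tensor algebra
  of \<open>V \<otimes> A\<close>. It is supersymmetric and satisfies \<open>z (P t) = P (z t) + P (z e \<otimes> t)\<close>. The relation
  \<open>x\<^bsub>-1\<^esub>\<^sup>m\<^sup>+\<^sup>1 w = 0\<close> makes \<open>P\<close> vanish on words of length \<open>m + 1\<close>, so that \<open>P\<close> is equivariant on words of
  length \<open>m\<close>, and the weight of \<open>w\<close> gives \<open>P (e\<^sup>m) = m! w\<close>. Applied to the Weyl module this is an inverse,
  up to the factor \<open>m!\<close>, of the map \<open>u w \<mapsto> u e\<^sup>m\<close>; applied to the tensor power, \<open>P\<close> is the symmetrizer.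
  Finally \<open>p(\<phi>\<^sub>1, \<phi>\<^sub>2, \<xi>) w\<close> is a nonzero multiple of the value of \<open>P\<close> on the word with letters
  \<open>v\<^sub>1 \<otimes> \<phi>\<^sub>1, v\<^sub>2 \<otimes> \<phi>\<^sub>2, v\<^sub>3 \<otimes> \<xi>\<close>, and the symmetrizations of these words form a basis.\<close>

section \<open>Tensor words\<close>

text \<open>The difficulty is injectivity: the relations must be shown to collapse the Weyl module
  to the size of the tensor space. Hence the map \<open>P\<close> in the opposite direction, built
  from the relations alone. Its recursion is forced: on \<open>e \<otimes> ... \<otimes> e\<close>,
  the element \<open>\<zeta> x\<close> replaces one more factor \<open>e\<close> by
  \<open>x\<close>, and its action on the factors already replaced has to be subtracted. For this to
  make sense at an abstract \<open>w\<close>, everything that kills \<open>e\<close> must kill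
  \<open>w\<close>. In sl(2,1) with coefficients in \<open>A\<close>, the elements killing
  \<open>e\<close> are spanned by the multiples of \<open>x_1, x_2, x_3, x_{-2}, h_2\<close>; the
  relation on \<open>x_{-2} \<otimes> a\<close> covers one of these and, through
  \<open>[x_2 \<otimes> a, x_{-2} \<otimes> 1] = h_2 \<otimes> a\<close>, also the last. Statements
  about all words of length \<open>N\<close> are reduced to the power of a single even letter, by
  supersymmetry and conversion of letters: \<open>v_2 \<otimes> 1\<close> with
  \<open>N = m + 1\<close> truncates \<open>P\<close>, and \<open>v_1 \<otimes> 1\<close> with
  \<open>N = m\<close> identifies \<open>P\<close> with the symmetrizer. The factor m! arises as m
  (m - 1) ... 1, because \<open>P (e \<otimes> t) = (m - n) P t\<close> for \<open>t\<close> of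
  length \<open>n\<close>.\<close>

lemma tensor_word_Nil [simp]: "tensor_word [] = 1"
  and tensor_word_Cons: "tensor_word (x # xs) = tensor_incl x * tensor_word xs"
  by (simp_all add: tensor_word_def)

lemma tensor_word_single: "tensor_word [x] = tensor_incl x"
  by (simp add: tensor_word_def)

lemma tensor_word_in_power [intro]: "length ws = n \<Longrightarrow> tensor_word ws \<in> tensor_power n"
  unfolding tensor_power_def by (rule cvec.span_base) blast

lemma subspace_tensor_power: "cvec.subspace (tensor_power n)"
  unfolding tensor_power_def by (rule cvec.subspace_span)

lemma clinear_eq_on_power:
  assumes "clinear f" "clinear g"
    and "\<And>ws. length ws = n \<Longrightarrow> f (tensor_word ws) = g (tensor_word ws)"
    and "t \<in> tensor_power n"
  shows "f t = g t"
  using assms(4) unfolding tensor_power_def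
  by (induction rule: cvec.span_induct_alt)
    (auto simp: assms(3) clinear_0[OF assms(1)] clinear_0[OF assms(2)] clinear_add[OF assms(1)]
      clinear_add[OF assms(2)] clinear_scale[OF assms(1)] clinear_scale[OF assms(2)])

lemma tensor_eqI:
  assumes "clinear f" "clinear g" "\<And>ws. f (tensor_word ws) = g (tensor_word ws)"
  shows "f t = g t"
  by (induction t rule: tensor_algebra_induct)
    (simp_all add: assms(3) clinear_add[OF assms(1)] clinear_add[OF assms(2)]
      clinear_scale[OF assms(1)] clinear_scale[OF assms(2)])

lemma clinear_zero: "clinear (\<lambda>_. 0)"
  by (rule clinearI) simp_all

lemma clinear_plus: "clinear f \<Longrightarrow> clinear g \<Longrightarrow> clinear (\<lambda>x. f x + g x)"
  by (rule clinearI) (simp_all add: clinear_add clinear_scale scaleC_add_right)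

lemma clinear_minus: "clinear f \<Longrightarrow> clinear g \<Longrightarrow> clinear (\<lambda>x. f x - g x)"
  by (rule clinearI) (simp_all add: clinear_add clinear_scale cvec.scale_right_diff_distrib)

lemma clinear_ident: "clinear (\<lambda>x. x)"
  by (rule clinearI) simp_all

lemma clinear_times_left: "clinear (\<lambda>x::'a::complex_algebra. x * y)"
  by (rule clinearI) (simp_all add: distrib_right scaleC_mult_left)

lemma clinear_times_right: "clinear (\<lambda>x::'a::complex_algebra. y * x)"
  by (rule clinearI) (simp_all add: distrib_left scaleC_mult_right)

lemma cbilinear_left: "cbilinear f \<Longrightarrow> clinear (\<lambda>v. f v w)"
  and cbilinear_right: "cbilinear f \<Longrightarrow> clinear (f v)"
  by (simp_all add: cbilinear_def)

lemma homogeneous_eqI: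
  fixes f g :: "'v::superspace \<Rightarrow> 'x::complex_vector"
  assumes "clinear f" "clinear g" "\<And>p x. homogeneous p x \<Longrightarrow> f x = g x"
  shows "f x = g x"
proof -
  have "f (component False x + component True x) = g (component False x + component True x)"
    by (simp add: clinear_add[OF assms(1)] clinear_add[OF assms(2)] assms(3)[OF homogeneous_component])
  then show ?thesis by (simp only: component_sum)
qed

text \<open>Letters are made homogeneous one at a time from the left: the induction keeps a prefix
  \<open>us\<close> of homogeneous letters before an arbitrary rest, and linearity in the next
  letter allows it to be split into its two components.\<close>

lemma clinear_eq_on_homogeneous_words:
  fixes f g :: "'v::superspace tensor_algebra \<Rightarrow> 'x::complex_vector"
  assumes f: "clinear f" and g: "clinear g"
    and eq: "\<And>ws ps. length ws = n \<Longrightarrow> list_all2 homogeneous ps ws \<Longrightarrow> f (tensor_word ws) = g (tensor_word ws)"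
    and "t \<in> tensor_power n"
  shows "f t = g t"
  using f g _ assms(4)
proof (rule clinear_eq_on_power)
  fix ws :: "'v list" assume "length ws = n"
  have "length us + length ws = n \<Longrightarrow> list_all2 homogeneous ps us \<Longrightarrow>
      f (tensor_word us * tensor_word ws) = g (tensor_word us * tensor_word ws)" for us ps ws
  proof (induction ws arbitrary: us ps)
    case Nil
    then show ?case using eq[of us ps] by simp
  next
    case (Cons x ws)
    show ?case
      unfolding tensor_word_Cons
    proof (rule homogeneous_eqI[where x = x])
      have lin: "clinear (\<lambda>x. tensor_word us * (tensor_incl x * tensor_word ws))"
        by (rule clinear_compose[OF clinear_times_right],
            rule clinear_compose[OF clinear_times_left tensor_incl_linear])
      show "clinear (\<lambda>x. f (tensor_word us * (tensor_incl x * tensor_word ws)))"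
        "clinear (\<lambda>x. g (tensor_word us * (tensor_incl x * tensor_word ws)))"
        by (rule clinear_compose[OF f lin] clinear_compose[OF g lin])+
      show "f (tensor_word us * (tensor_incl x * tensor_word ws)) = g (tensor_word us * (tensor_incl x * tensor_word ws))"
        if "homogeneous p x" for p x
        using Cons.IH[of "us @ [x]" "ps @ [p]"] Cons.prems that
        by (simp add: tensor_word_append tensor_word_single mult.assoc list_all2_appendI)
    qed
  qed
  from this[of "[]" ws "[]"] show "f (tensor_word ws) = g (tensor_word ws)" using \<open>length ws = n\<close> by simp
qed

lemma tensor_power_times:
  assumes "s \<in> tensor_power a" "t \<in> tensor_power b"
  shows "s * t \<in> tensor_power (a + b)"
proof -
  have 1: "tensor_word xs * t \<in> tensor_power (a + b)" if "length xs = a" for xs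
    using assms(2) unfolding tensor_power_def[of b]
  proof (induction rule: cvec.span_induct_alt)
    case (step c y z)
    then show ?case using that subspace_tensor_power[of "a + b"]
      by (auto simp: distrib_left scaleC_mult_right
          intro!: cvec.subspace_add cvec.subspace_scale tensor_word_in_power
          simp flip: tensor_word_append)
  qed (simp add: cvec.subspace_0[OF subspace_tensor_power])
  show ?thesis
    using assms(1) unfolding tensor_power_def[of a]
  proof (induction rule: cvec.span_induct_alt)
    case (step c y z)
    then show ?case using 1 subspace_tensor_power[of "a + b"]
      by (auto simp: distrib_right scaleC_mult_left intro!: cvec.subspace_add cvec.subspace_scale)
  qed (simp add: cvec.subspace_0[OF subspace_tensor_power])
qed

lemma tensor_incl_power: "tensor_incl x ^ n = tensor_word (replicate n x)"
  by (induction n) (simp_all add: tensor_word_Cons)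

section \<open>Derivations of the tensor algebra\<close>

lemma parity_twist_idem [simp]: "parity_twist p (parity_twist p x) = x"
  by (cases p; simp add: parity_twist_def UNIV_bool koszul_def component_add component_component
      component_scaleC component_sum clinear_diff[OF component_linear])

lemma parity_twist_even: "homogeneous False x \<Longrightarrow> parity_twist p x = x"
  by (simp add: parity_twist_homogeneous koszul_def)

text \<open>The abstract counterpart of \<open>V \<otimes> A\<close> over the map superalgebra;
  \<open>D\<close> is the induced action on the whole tensor algebra by superderivations.\<close>

locale supermodule =
  fixes \<delta> :: "'g::lie_superalgebra \<Rightarrow> 'v::superspace \<Rightarrow> 'v"
  assumes rep: "representation \<delta>"
    and graded: "homogeneous p z \<Longrightarrow> homogeneous q x \<Longrightarrow> homogeneous (p \<noteq> q) (\<delta> z x)"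
begin

abbreviation (input) "D \<equiv> coproduct_act \<delta>"

lemma bilinear: "cbilinear \<delta>"
  using rep by (simp add: representation_def)

lemma D_representation: "representation D"
  by (rule coproduct_act_representation[OF rep graded])

lemma D_bilinear: "cbilinear D"
  using D_representation by (simp add: representation_def)

lemmas D_linear = cbilinear_right[OF D_bilinear]
lemmas D_simps = cbilinearD[OF D_bilinear]

lemma D_zero [simp]: "D 0 t = 0" "D z 0 = 0"
  using D_simps(3)[of 0 0 t] D_simps(4)[of z 0 0] by simp_all

lemma D_diff: "D (y - z) t = D y t - D z t" "D z (s - t) = D z s - D z t"
  by (rule clinear_diff[OF cbilinear_left[OF D_bilinear]] clinear_diff[OF D_linear])+

lemma D_one [simp]: "D z 1 = 0"
  using multilinear_lift_word[OF coproduct_multilinear[OF bilinear], folded coproduct_act_def, of z "[]"]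
  by simp

lemma D_Cons:
  assumes "homogeneous p z"
  shows "D z (tensor_incl x * t) = tensor_incl (\<delta> z x) * t + tensor_incl (parity_twist p x) * D z t"
  by (cases p) (simp_all add: coproduct_act_Cons[OF bilinear] UNIV_bool component_homogeneous[OF assms])

lemma D_Cons_even:
  assumes "homogeneous False x"
  shows "D z (tensor_incl x * t) = tensor_incl (\<delta> z x) * t + tensor_incl x * D z t"
  by (simp add: coproduct_act_Cons[OF bilinear] parity_twist_even[OF assms] UNIV_bool component_sum
      flip: distrib_left D_simps(1))

lemma D_word_mult:
  assumes "homogeneous p z"
  shows "D z (tensor_word xs * t) = D z (tensor_word xs) * t + tensor_word (map (parity_twist p) xs) * D z t"
  by (induction xs) (simp_all add: tensor_word_Cons D_Cons[OF assms] mult.assoc algebra_simps)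

lemma D_tensor_word: "D z (tensor_word xs) \<in> tensor_power (length xs)"
proof (induction xs arbitrary: z)
  case Nil
  show ?case by (simp add: cvec.subspace_0[OF subspace_tensor_power])
next
  case (Cons x xs)
  have 1: "tensor_incl y * t \<in> tensor_power (length (x # xs))" if "t \<in> tensor_power (length xs)" for y t
    using tensor_power_times[OF tensor_word_in_power[of "[y]" 1] that]
    by (simp add: tensor_word_single)
  show ?case
    unfolding tensor_word_Cons coproduct_act_Cons[OF bilinear]
    by (intro cvec.subspace_add[OF subspace_tensor_power] cvec.subspace_sum[OF subspace_tensor_power] 1 Cons.IH)
      (simp add: tensor_word_in_power)
qed

lemma D_tensor_power: "t \<in> tensor_power n \<Longrightarrow> D z t \<in> tensor_power n"
  unfolding tensor_power_def[of n]
proof (induction rule: cvec.span_induct_alt)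
  case (step c y t)
  then show ?case using D_tensor_word[of z]
    by (auto simp: D_simps tensor_power_def intro!: cvec.span_add cvec.span_scale)
qed (simp add: cvec.span_zero)

lemma D_power_even:
  assumes "homogeneous False x"
  shows "D z (tensor_incl x ^ n) = (\<Sum>i<n. tensor_incl x ^ i * tensor_incl (\<delta> z x) * tensor_incl x ^ (n - Suc i))"
proof (induction n)
  case (Suc n)
  show ?case
    by (simp add: D_Cons_even[OF assms] Suc sum.lessThan_Suc_shift sum_distrib_left mult.assoc
        del: sum.lessThan_Suc)
qed simp

end

section \<open>Supersymmetric functionals on words\<close>

text \<open>Expresses that \<open>Q\<close> factors through the supersymmetric algebra. Adjacent
  exchanges are enough, since they generate all permutations.\<close>

definition supersymmetric :: "('v::superspace tensor_algebra \<Rightarrow> 'x::complex_vector) \<Rightarrow> bool" where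
  "supersymmetric Q \<longleftrightarrow> clinear Q \<and>
    (\<forall>us p q x y t. homogeneous p x \<longrightarrow> homogeneous q y \<longrightarrow>
      Q (tensor_word us * (tensor_incl x * (tensor_incl y * t))) =
      koszul p q *\<^sub>C Q (tensor_word us * (tensor_incl y * (tensor_incl x * t))))"

lemma supersymmetric_linear: "supersymmetric Q \<Longrightarrow> clinear Q"
  unfolding supersymmetric_def by blast

lemma supersymmetric_swap:
  "supersymmetric Q \<Longrightarrow> homogeneous p x \<Longrightarrow> homogeneous q y \<Longrightarrow>
    Q (tensor_word us * (tensor_incl x * (tensor_incl y * t))) =
      koszul p q *\<^sub>C Q (tensor_word us * (tensor_incl y * (tensor_incl x * t)))"
  unfolding supersymmetric_def by blast

lemma tensor_incl_minus: "tensor_incl (- x) = - tensor_incl x"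
  using clinear_scale[OF tensor_incl_linear, of "-1" x] by simp

lemma tensor_incl_zero [simp]: "tensor_incl 0 = 0"
  by (rule clinear_0[OF tensor_incl_linear])

lemma koszul_even [simp]: "koszul False q = 1" "koszul p False = 1"
  by (simp_all add: koszul_def)

lemma supersymmetric_even_power:
  assumes Q: "supersymmetric Q" and e: "homogeneous False e" and x: "homogeneous p x"
  shows "Q (tensor_word us * (tensor_incl e ^ i * (tensor_incl x * t))) =
    Q (tensor_word us * (tensor_incl x * (tensor_incl e ^ i * t)))"
proof (induction i arbitrary: us)
  case (Suc i)
  show ?case
    using Suc[of "us @ [e]"] supersymmetric_swap[OF Q e x, of us]
    by (simp add: tensor_word_append tensor_word_single mult.assoc)
qed simp

context supermodule
begin

text \<open>Starting from \<open>e\<^sup>N\<close>, the elements \<open>z\<close> convert the factors \<open>e\<close> into arbitrary letters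
  one at a time.\<close>

lemma supersymmetric_vanish:
  assumes Q: "supersymmetric Q" and e: "homogeneous False e" and zero: "Q (tensor_incl e ^ N) = 0"
    and step: "\<And>p x. homogeneous p x \<Longrightarrow> \<exists>z. homogeneous p z \<and> \<delta> z e = x \<and>
      (\<forall>t\<in>tensor_power N. Q t = 0 \<longrightarrow> Q (D z t) = 0)"
    and "t \<in> tensor_power N"
  shows "Q t = 0"
proof -
  note lin = supersymmetric_linear[OF Q]
  have "n \<le> N \<Longrightarrow> s \<in> tensor_power n \<Longrightarrow> Q (s * tensor_incl e ^ (N - n)) = 0" for n s
  proof (induction n arbitrary: s)
    case 0
    show ?case
    proof (rule clinear_eq_on_power[OF _ clinear_zero _ 0(2)])
      show "clinear (\<lambda>s. Q (s * tensor_incl e ^ (N - 0)))"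
        by (rule clinear_compose[OF lin clinear_times_left])
    qed (simp add: zero)
  next
    case (Suc n)
    define j where "j = N - n"
    have j: "j = Suc (N - Suc n)" using Suc.prems by (simp add: j_def)
    have hom: "Q (tensor_word us * (tensor_incl x * tensor_incl e ^ (N - Suc n))) = 0"
      if us: "length us = n" and x: "homogeneous p x" for us p x
    proof -
      obtain z where z: "homogeneous p z" "\<delta> z e = x"
        and Qz: "\<And>t. t \<in> tensor_power N \<Longrightarrow> Q t = 0 \<Longrightarrow> Q (D z t) = 0"
        using step[OF x] by blast
      \<comment> \<open>\<open>D z\<close> twists the prefix that it passes. Twisting is an
        involution, so starting from the twisted prefix leaves \<open>us\<close> itself in front of
        \<open>D z (tensor_incl e ^ j)\<close>.\<close>
      let ?us = "map (parity_twist p) us"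
      have "tensor_word ?us * tensor_incl e ^ j \<in> tensor_power (n + j)"
        unfolding tensor_incl_power by (rule tensor_power_times) (auto simp: us)
      then have "Q (D z (tensor_word ?us * tensor_incl e ^ j)) = 0"
        using Suc.IH[OF _ tensor_word_in_power[of ?us n]] Suc.prems us by (intro Qz) (auto simp: j_def)
      moreover have "Q (D z (tensor_word ?us) * tensor_incl e ^ j) = 0"
        unfolding j_def using Suc.prems us D_tensor_word[of z ?us] by (intro Suc.IH) auto
      ultimately have "Q (tensor_word us * D z (tensor_incl e ^ j)) = 0"
        by (simp add: D_word_mult[OF z(1)] clinear_add[OF lin] o_def)
      moreover have "Q (tensor_word us * (tensor_incl e ^ i * tensor_incl x * tensor_incl e ^ (j - Suc i)))
          = Q (tensor_word us * (tensor_incl x * tensor_incl e ^ (N - Suc n)))" if "i < j" for i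
      proof -
        have "i + (j - Suc i) = N - Suc n" using that j by simp
        then show ?thesis
          using supersymmetric_even_power[OF Q e x, of us i "tensor_incl e ^ (j - Suc i)"]
          by (simp add: mult.assoc flip: power_add)
      qed
      \<comment> \<open>All \<open>j\<close> Leibniz terms agree, because \<open>x\<close> moves
        past the even letter \<open>e\<close> without a sign; as \<open>j > 0\<close>, the factor
        \<open>j\<close> can then be divided out.\<close>
      ultimately have "(\<Sum>i<j. Q (tensor_word us * (tensor_incl x * tensor_incl e ^ (N - Suc n)))) = 0"
        by (simp add: D_power_even[OF e] z(2) sum_distrib_left clinear_sum[OF lin])
      then have "of_nat j *\<^sub>C Q (tensor_word us * (tensor_incl x * tensor_incl e ^ (N - Suc n))) = 0"
        by (simp add: cvec.sum_constant_scale)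
      then show ?thesis using j by (simp del: of_nat_Suc)
    qed
    show ?case
    proof (rule clinear_eq_on_power[OF _ clinear_zero _ Suc.prems(2)])
      show "clinear (\<lambda>s. Q (s * tensor_incl e ^ (N - Suc n)))"
        by (rule clinear_compose[OF lin clinear_times_left])
      fix ws :: "'v list" assume "length ws = Suc n"
      then obtain us x where ws: "ws = us @ [x]" "length us = n"
        by (metis length_Suc_conv_rev)
      have "Q (tensor_word us * (tensor_incl x * tensor_incl e ^ (N - Suc n))) = 0"
      proof (rule homogeneous_eqI[where x = x])
        show "clinear (\<lambda>x. Q (tensor_word us * (tensor_incl x * tensor_incl e ^ (N - Suc n))))"
          by (rule clinear_compose[OF lin], rule clinear_compose[OF clinear_times_right],
              rule clinear_compose[OF clinear_times_left tensor_incl_linear])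
      qed (use hom ws(2) in \<open>simp_all add: clinear_zero\<close>)
      then show "Q (tensor_word ws * tensor_incl e ^ (N - Suc n)) = 0"
        by (simp add: ws tensor_word_append tensor_word_single mult.assoc)
    qed
  qed
  from this[of N t] show ?thesis using assms(5) by simp
qed

end

section \<open>The polarization map\<close>

text \<open>In the motivating case \<open>w = e \<otimes> \<dots> \<otimes> e\<close>, the polarization of \<open>x\<^sub>1 \<otimes> \<dots> \<otimes> x\<^sub>k\<close> is the sum over all
  ways of replacing \<open>k\<close> distinct factors of \<open>w\<close> by \<open>x\<^sub>1, \<dots>, x\<^sub>k\<close> (with Koszul signs). Its recursive
  description uses only the module structure, hence makes sense in any cyclic module
  whose generator satisfies the annihilation condition \<open>vacuum\<close>.\<close>

locale polarization = supermodule \<delta>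
  for \<delta> :: "'g::lie_superalgebra \<Rightarrow> 'v::superspace \<Rightarrow> 'v" +
  fixes \<zeta> :: "'v \<Rightarrow> 'g" and e :: 'v and \<rho> :: "'g \<Rightarrow> 'm::complex_vector \<Rightarrow> 'm" and w :: 'm
  assumes zeta_linear: "clinear \<zeta>"
    and zeta_graded: "homogeneous p x \<Longrightarrow> homogeneous p (\<zeta> x)"
    and e_even: "homogeneous False e"
    and zeta_e [simp]: "\<delta> (\<zeta> x) e = x"
    and rho: "representation \<rho>"
    and vacuum: "\<rho> z w = \<rho> (\<zeta> (\<delta> z e)) w"
begin

lemma rho_bilinear: "cbilinear \<rho>"
  using rho by (simp add: representation_def)

lemmas rho_simps = cbilinearD[OF rho_bilinear]

lemma rho_bracket:
  "homogeneous p x \<Longrightarrow> homogeneous q y \<Longrightarrow>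
    \<rho> x (\<rho> y v) = \<rho> (bracket x y) v + koszul p q *\<^sub>C \<rho> y (\<rho> x v)"
  using rho by (simp add: representation_def)

lemma delta_bracket:
  "homogeneous p x \<Longrightarrow> homogeneous q y \<Longrightarrow>
    \<delta> (bracket x y) v = \<delta> x (\<delta> y v) - koszul p q *\<^sub>C \<delta> y (\<delta> x v)"
  using rep by (simp add: representation_def)

lemma D_bracket:
  "homogeneous p x \<Longrightarrow> homogeneous q y \<Longrightarrow>
    D (bracket x y) v = D x (D y v) - koszul p q *\<^sub>C D y (D x v)"
  using D_representation by (simp add: representation_def)

text \<open>The recursive call is made at \<open>D (\<zeta> x) t\<close>, which is a combination of
  words and not a word. The recursion therefore runs over the length, and
  \<open>polar_upto n\<close> is meant for tensors of length \<open>n\<close>.\<close>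

primrec polar_upto :: "nat \<Rightarrow> 'v tensor_algebra \<Rightarrow> 'm" where
  "polar_upto 0 = multilinear_lift (\<lambda>xs. if xs = [] then w else 0)"
| "polar_upto (Suc n) = multilinear_lift (\<lambda>xs. case xs of [] \<Rightarrow> 0
    | x # xs \<Rightarrow> \<rho> (\<zeta> x) (polar_upto n (tensor_word xs)) - polar_upto n (D (\<zeta> x) (tensor_word xs)))"

lemma polar_0_multilinear: "multilinear (\<lambda>xs. if xs = [] then w else 0)"
  unfolding multilinear_def by (auto simp: clinear_zero)

lemma polar_Suc_multilinear:
  assumes f: "clinear f"
  shows "multilinear (\<lambda>xs. case xs of [] \<Rightarrow> 0
    | x # xs \<Rightarrow> \<rho> (\<zeta> x) (f (tensor_word xs)) - f (D (\<zeta> x) (tensor_word xs)))"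
  unfolding multilinear_def
proof (intro allI impI)
  fix ws :: "'v list" and i assume i: "i < length ws"
  then obtain x xs where ws: "ws = x # xs" by (cases ws) auto
  show "clinear (\<lambda>v. case ws[i := v] of [] \<Rightarrow> 0
    | x # xs \<Rightarrow> \<rho> (\<zeta> x) (f (tensor_word xs)) - f (D (\<zeta> x) (tensor_word xs)))"
  proof (cases i)
    case 0
    have "clinear (\<lambda>v. \<rho> (\<zeta> v) (f (tensor_word xs)) - f (D (\<zeta> v) (tensor_word xs)))"
      by (intro clinear_minus clinear_compose[OF cbilinear_left[OF rho_bilinear] zeta_linear]
          clinear_compose[OF f] clinear_compose[OF cbilinear_left[OF D_bilinear] zeta_linear])
    then show ?thesis by (simp add: 0 ws)
  next
    case (Suc k)
    have k: "k < length xs" using i Suc ws by simp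
    note up = multilinear_update[OF tensor_word_multilinear k]
    have "clinear (\<lambda>v. \<rho> (\<zeta> x) (f (tensor_word (xs[k := v]))) - f (D (\<zeta> x) (tensor_word (xs[k := v]))))"
      by (intro clinear_minus clinear_compose[OF cbilinear_right[OF rho_bilinear]]
          clinear_compose[OF f] clinear_compose[OF D_linear] up)
    then show ?thesis by (simp add: Suc ws)
  qed
qed

lemma polar_upto_linear: "clinear (polar_upto n)"
proof (induction n)
  case 0
  show ?case by (simp add: multilinear_lift_linear polar_0_multilinear)
next
  case (Suc n)
  show ?case by (simp add: multilinear_lift_linear polar_Suc_multilinear[OF Suc])
qed

definition polar :: "'v tensor_algebra \<Rightarrow> 'm" where
  "polar = multilinear_lift (\<lambda>xs. polar_upto (length xs) (tensor_word xs))"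

lemma polar_multilinear: "multilinear (\<lambda>xs. polar_upto (length xs) (tensor_word xs))"
  unfolding multilinear_def length_list_update
  by (intro allI impI clinear_compose[OF polar_upto_linear] multilinear_update[OF tensor_word_multilinear])

lemma polar_linear: "clinear polar"
  unfolding polar_def by (rule multilinear_lift_linear[OF polar_multilinear])

lemmas polar_simps = clinear_add[OF polar_linear] clinear_scale[OF polar_linear]
  clinear_diff[OF polar_linear] clinear_0[OF polar_linear]

lemma polar_word: "polar (tensor_word xs) = polar_upto (length xs) (tensor_word xs)"
  by (simp add: polar_def polar_multilinear)

lemma polar_one [simp]: "polar 1 = w"
  using polar_word[of "[]"] multilinear_lift_word[OF polar_0_multilinear, of "[]"] by simp

text \<open>\<open>D\<close> preserves length, so \<open>polar\<close> and
  \<open>polar_upto (length xs)\<close> agree on \<open>D (\<zeta> x) (tensor_word xs)\<close>. This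
  removes the length index from the recursion.\<close>

lemma polar_Cons: "polar (tensor_incl x * t) = \<rho> (\<zeta> x) (polar t) - polar (D (\<zeta> x) t)"
proof (rule tensor_eqI[where t = t])
  show "clinear (\<lambda>t. polar (tensor_incl x * t))"
    by (rule clinear_compose[OF polar_linear clinear_times_right])
  show "clinear (\<lambda>t. \<rho> (\<zeta> x) (polar t) - polar (D (\<zeta> x) t))"
    by (intro clinear_minus clinear_compose[OF cbilinear_right[OF rho_bilinear]] polar_linear
        clinear_compose[OF polar_linear] D_linear)
  fix xs :: "'v list"
  have "polar t = polar_upto (length xs) t" if "t \<in> tensor_power (length xs)" for t
    using polar_linear polar_upto_linear _ that
    by (rule clinear_eq_on_power) (simp add: polar_word)
  from this[OF D_tensor_word]
  show "polar (tensor_incl x * tensor_word xs) =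
      \<rho> (\<zeta> x) (polar (tensor_word xs)) - polar (D (\<zeta> x) (tensor_word xs))"
    using polar_word[of "x # xs"]
    by (simp add: multilinear_lift_word[OF polar_Suc_multilinear[OF polar_upto_linear]]
        polar_word flip: tensor_word_Cons)
qed

text \<open>Subtracting \<open>\<zeta> (z e)\<close>, for which the identity is the definition of \<^term>\<open>polar\<close>, reduces it to
  elements \<open>z\<close> that kill \<open>e\<close>; for these it follows by commuting \<open>z\<close> past \<open>\<zeta> x\<close>.\<close>

lemma act_polar: "\<rho> z (polar t) = polar (D z t) + polar (tensor_incl (\<delta> z e) * t)"
proof -
  have lin: "clinear (\<lambda>t. \<rho> z (polar t))"
      "clinear (\<lambda>t. polar (D z t) + polar (tensor_incl (\<delta> z e) * t))" for z
    by (intro clinear_plus clinear_compose[OF cbilinear_right[OF rho_bilinear]] polar_linear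
        clinear_compose[OF polar_linear] D_linear clinear_times_right)+
  have power: "t \<in> tensor_power n \<Longrightarrow>
      \<rho> z (polar t) = polar (D z t) + polar (tensor_incl (\<delta> z e) * t)" for n t z
  proof (induction n arbitrary: t z)
    case 0
    show ?case
    proof (rule clinear_eq_on_power[OF lin _ 0])
      show "\<rho> z (polar (tensor_word ws)) = polar (D z (tensor_word ws)) + polar (tensor_incl (\<delta> z e) * tensor_word ws)"
        if "length ws = 0" for ws
        using that vacuum[of z] polar_Cons[of "\<delta> z e" 1] by (simp add: polar_simps)
    qed
  next
    case (Suc n)
    \<comment> \<open>As \<open>k\<close> kills \<open>e\<close>, the bracket of \<open>k\<close>
      and \<open>\<zeta> x\<close> sends \<open>e\<close> to \<open>\<delta> k x\<close>. The
      induction hypothesis for this bracket thus produces the term with \<open>\<delta> k x\<close>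
      in front, which is the first Leibniz term of \<open>D k (tensor_incl x * t)\<close>.\<close>
    have stab: "\<rho> k (polar (tensor_incl x * t)) = polar (D k (tensor_incl x * t))"
      if t: "t \<in> tensor_power n" and k: "homogeneous p k" "\<delta> k e = 0" and x: "homogeneous q x" for k p x q t
    proof -
      note z = zeta_graded[OF x]
      have "\<rho> k (\<rho> (\<zeta> x) (polar t)) = \<rho> (bracket k (\<zeta> x)) (polar t) + koszul p q *\<^sub>C \<rho> (\<zeta> x) (\<rho> k (polar t))"
        by (rule rho_bracket[OF k(1) z])
      moreover have "\<delta> (bracket k (\<zeta> x)) e = \<delta> k x"
        using cbilinearD(4)[OF bilinear, of "\<zeta> x" 0 0] by (simp add: delta_bracket[OF k(1) z] k(2))
      moreover have "\<rho> (\<zeta> x) (polar (D k t)) = polar (tensor_incl x * D k t) + polar (D (\<zeta> x) (D k t))"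
        by (simp add: polar_Cons)
      ultimately show ?thesis
        by (simp add: polar_Cons[of x t] clinear_diff[OF cbilinear_right[OF rho_bilinear]]
            Suc.IH[OF t, of k] Suc.IH[OF t, of "bracket k (\<zeta> x)"] Suc.IH[OF D_tensor_power[OF t], of k] k(2) polar_simps D_bracket[OF k(1) z] D_Cons[OF k(1)] parity_twist_homogeneous[OF x]
            clinear_scale[OF tensor_incl_linear] scaleC_mult_left scaleC_add_right)
    qed
    show ?case
    proof (rule clinear_eq_on_power[OF lin _ Suc.prems])
      fix ws :: "'v list" assume "length ws = Suc n"
      then obtain x xs where ws: "ws = x # xs" and xs: "tensor_word xs \<in> tensor_power n"
        by (metis length_Suc_conv tensor_word_in_power)
      have "\<rho> z (polar (tensor_incl x * tensor_word xs)) = polar (D z (tensor_incl x * tensor_word xs)) +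
          polar (tensor_incl (\<delta> z e) * (tensor_incl x * tensor_word xs))"
      proof (rule homogeneous_eqI[where x = x])
        show "clinear (\<lambda>x. \<rho> z (polar (tensor_incl x * tensor_word xs)))"
          by (rule clinear_compose[OF lin(1)], rule clinear_compose[OF clinear_times_left tensor_incl_linear])
        show "clinear (\<lambda>x. polar (D z (tensor_incl x * tensor_word xs)) +
            polar (tensor_incl (\<delta> z e) * (tensor_incl x * tensor_word xs)))"
          by (rule clinear_compose[OF lin(2)], rule clinear_compose[OF clinear_times_left tensor_incl_linear])
        fix q x assume x: "homogeneous q (x :: 'v)"
        let ?t = "tensor_incl x * tensor_word xs"
        show "\<rho> z (polar ?t) = polar (D z ?t) + polar (tensor_incl (\<delta> z e) * ?t)"
        proof (rule homogeneous_eqI[where x = z])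
          show "clinear (\<lambda>z. \<rho> z (polar ?t))" by (rule cbilinear_left[OF rho_bilinear])
          show "clinear (\<lambda>z. polar (D z ?t) + polar (tensor_incl (\<delta> z e) * ?t))"
            by (intro clinear_plus clinear_compose[OF polar_linear] cbilinear_left[OF D_bilinear]
                clinear_compose[OF clinear_times_left] clinear_compose[OF tensor_incl_linear]
                cbilinear_left[OF bilinear])
          fix p z assume z: "homogeneous p (z :: 'g)"
          let ?y = "\<delta> z e"
          have y: "homogeneous p (\<zeta> ?y)" using zeta_graded graded[OF z e_even] by simp
          have "homogeneous p (z - \<zeta> ?y)"
            using z y by (simp add: homogeneous_def clinear_diff[OF component_linear])
          moreover have "\<delta> (z - \<zeta> ?y) e = 0"
            by (simp add: clinear_diff[OF cbilinear_left[OF bilinear]])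
          ultimately have "\<rho> (z - \<zeta> ?y) (polar ?t) = polar (D (z - \<zeta> ?y) ?t)"
            using stab[OF xs] x by blast
          moreover have "polar (D (\<zeta> ?y) ?t) = \<rho> (\<zeta> ?y) (polar ?t) - polar (tensor_incl ?y * ?t)"
            by (simp add: polar_Cons)
          ultimately show "\<rho> z (polar ?t) = polar (D z ?t) + polar (tensor_incl ?y * ?t)"
            by (simp add: clinear_diff[OF cbilinear_left[OF rho_bilinear]] D_diff polar_simps)
        qed
      qed
      then show "\<rho> z (polar (tensor_word ws)) = polar (D z (tensor_word ws)) + polar (tensor_incl (\<delta> z e) * tensor_word ws)"
        by (simp add: ws tensor_word_Cons)
    qed
  qed
  show ?thesis
    by (rule tensor_eqI[where t = t, OF lin]) (rule power[OF tensor_word_in_power[OF refl]])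
qed

text \<open>The relations of the supersymmetric algebra. The parities are arguments because a zero
  letter, such as \<open>\<delta> z x\<close> may be, does not determine its own.\<close>

definition super_swap :: "bool \<Rightarrow> bool \<Rightarrow> 'v \<Rightarrow> 'v \<Rightarrow> 'v tensor_algebra \<Rightarrow> 'v tensor_algebra" where
  "super_swap p q x y t =
    tensor_incl x * (tensor_incl y * t) - koszul p q *\<^sub>C (tensor_incl y * (tensor_incl x * t))"

lemma D_super_swap:
  assumes "homogeneous r z" "homogeneous p x" "homogeneous q y"
  shows "D z (super_swap p q x y t) = super_swap (r \<noteq> p) q (\<delta> z x) y t +
    koszul r p *\<^sub>C super_swap p (r \<noteq> q) x (\<delta> z y) t + (koszul r p * koszul r q) *\<^sub>C super_swap p q x y (D z t)"
  by (cases p; cases q; cases r)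
    (simp_all add: super_swap_def D_diff D_simps D_Cons[OF assms(1)] parity_twist_homogeneous[OF assms(2)]
      parity_twist_homogeneous[OF assms(3)] koszul_def tensor_incl_minus
      distrib_left scaleC_mult_right scaleC_add_right scaleC_scaleC algebra_simps)

text \<open>Two uses of the recursion leave the supercommutator of \<open>\<rho> (\<zeta> x)\<close>
  and \<open>\<rho> (\<zeta> y)\<close> at \<open>polar t\<close>, that of the two derivations at
  \<open>t\<close>, and two terms with a letter changed by the other. These are the three terms of
  \<open>act_polar\<close> for \<open>bracket (\<zeta> x) (\<zeta> y)\<close>.\<close>

lemma polar_super_swap_0:
  assumes x: "homogeneous p x" and y: "homogeneous q y"
  shows "polar (super_swap p q x y t) = 0"
proof -
  note z = zeta_graded[OF x] zeta_graded[OF y]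
  have k: "koszul q p = koszul p q" "koszul p q * koszul p q = 1" by (auto simp: koszul_def)
  have "\<rho> (bracket (\<zeta> x) (\<zeta> y)) (polar t) = polar (D (bracket (\<zeta> x) (\<zeta> y)) t) +
      polar (tensor_incl (\<delta> (\<zeta> x) y - koszul p q *\<^sub>C \<delta> (\<zeta> y) x) * t)"
    by (simp add: act_polar delta_bracket[OF z])
  then show ?thesis
    by (simp add: super_swap_def polar_simps polar_Cons clinear_diff[OF cbilinear_right[OF rho_bilinear]]
        D_Cons[OF z(1)] D_Cons[OF z(2)] parity_twist_homogeneous[OF x] parity_twist_homogeneous[OF y]
        clinear_scale[OF tensor_incl_linear] clinear_diff[OF tensor_incl_linear] left_diff_distrib scaleC_mult_left
        scaleC_add_right cvec.scale_right_diff_distrib scaleC_scaleC rho_bracket[OF z] D_bracket[OF z] k)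
qed

text \<open>The recursion peels off the first letter \<open>u\<close>. Then
  \<open>D (\<zeta> u)\<close> turns the remaining prefix into a combination of other words of the
  same length, and swaps into swaps; hence induction on the length of the prefix and not on its
  structure.\<close>

lemma polar_super_swap:
  "homogeneous p x \<Longrightarrow> homogeneous q y \<Longrightarrow> polar (tensor_word us * super_swap p q x y t) = 0"
proof (induction us arbitrary: p q x y t rule: length_induct)
  case (1 us)
  show ?case
  proof (cases us)
    case Nil
    then show ?thesis by (simp add: polar_super_swap_0 1)
  next
    case (Cons u vs)
    have lin: "clinear (\<lambda>s. polar (s * t))" for t
      by (rule clinear_compose[OF polar_linear clinear_times_left])
    have IH: "polar (s * super_swap p q x y t) = 0"
      if "s \<in> tensor_power (length vs)" "homogeneous p x" "homogeneous q y" for s p q x y t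
      by (rule clinear_eq_on_power[OF lin clinear_zero _ that(1)]) (use 1(1) that Cons in auto)
    have "polar (tensor_incl u * (tensor_word vs * super_swap p q x y t)) = 0"
    proof (rule homogeneous_eqI[where x = u])
      show "clinear (\<lambda>u. polar (tensor_incl u * (tensor_word vs * super_swap p q x y t)))"
        by (rule clinear_compose[OF lin tensor_incl_linear])
      fix r u assume "homogeneous r (u :: 'v)"
      note z = zeta_graded[OF this]
      note g = graded[OF z 1(2)] graded[OF z 1(3)]
      have "polar (D (\<zeta> u) (tensor_word vs * super_swap p q x y t)) = 0"
        by (simp add: D_word_mult[OF z] D_super_swap[OF z 1(2,3)] polar_simps distrib_left scaleC_mult_right
            IH[OF D_tensor_word] IH[OF tensor_word_in_power] 1 g[simplified])
      moreover have "polar (tensor_word vs * super_swap p q x y t) = 0"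
        by (rule IH) (auto simp: 1)
      ultimately show "polar (tensor_incl u * (tensor_word vs * super_swap p q x y t)) = 0"
        using rho_simps(4)[of "\<zeta> u" 0 0] by (simp add: polar_Cons)
    qed (rule clinear_zero)
    then show ?thesis by (simp add: Cons tensor_word_Cons mult.assoc)
  qed
qed

lemma polar_supersymmetric: "supersymmetric polar"
  unfolding supersymmetric_def
proof (intro conjI allI impI polar_linear)
  fix us p q x y t assume "homogeneous p (x :: 'v)" "homogeneous q (y :: 'v)"
  from polar_super_swap[OF this, of us t]
  show "polar (tensor_word us * (tensor_incl x * (tensor_incl y * t))) =
      koszul p q *\<^sub>C polar (tensor_word us * (tensor_incl y * (tensor_incl x * t)))"
    by (simp add: super_swap_def right_diff_distrib polar_simps scaleC_mult_right)
qed

end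

text \<open>The weight condition \<open>weight\<close> and the integrability condition \<open>nilpotent\<close> cut the polarization
  down to words of length \<open>m\<close>; the second vector \<open>e'\<close> plays the role of \<open>v\<^sub>2 \<otimes> 1\<close>.\<close>

locale integrable_polarization = polarization \<delta> \<zeta> e \<rho> w
  for \<delta> :: "'g::lie_superalgebra \<Rightarrow> 'v::superspace \<Rightarrow> 'v" and \<zeta> e
    and \<rho> :: "'g \<Rightarrow> 'm::complex_vector \<Rightarrow> 'm" and w +
  fixes m :: nat and e' :: 'v and \<zeta>' :: "'v \<Rightarrow> 'g"
  assumes weight: "\<rho> (\<zeta> e) w = of_nat m *\<^sub>C w"
    and nilpotent: "(\<rho> (\<zeta> e') ^^ Suc m) w = 0"
    and e'_even: "homogeneous False e'"
    and zeta_e': "\<delta> (\<zeta> e') e' = 0"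
    and zeta'_graded: "homogeneous p x \<Longrightarrow> homogeneous p (\<zeta>' x)"
    and zeta'_e: "\<delta> (\<zeta>' x) e = 0"
    and zeta'_e': "\<delta> (\<zeta>' x) e' = x"
begin

text \<open>In the motivating case a letter \<open>e\<close> counts the factors that are not
  replaced yet. In general the weight gives \<open>m\<close> for the empty word. Each further letter
  \<open>x\<close> lowers the factor by 1: once \<open>e\<close> has been moved behind
  \<open>x\<close>, the recursion subtracts a term in which \<open>\<zeta> x\<close> has turned
  \<open>e\<close> into \<open>x\<close>.\<close>

lemma polar_e:
  assumes "t \<in> tensor_power n"
  shows "polar (tensor_incl e * t) = (of_nat m - of_nat n) *\<^sub>C polar t"
  using assms
proof (induction n arbitrary: t)
  case 0
  show ?case
  proof (rule clinear_eq_on_power[OF _ _ _ 0])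
    show "polar (tensor_incl e * tensor_word ws) = (of_nat m - of_nat 0) *\<^sub>C polar (tensor_word ws)"
      if "length ws = 0" for ws
      using that polar_Cons[of e 1] by (simp add: weight polar_simps)
  qed (intro clinear_compose[OF polar_linear clinear_times_right] clinear_scaled polar_linear)+
next
  case (Suc n)
  show ?case
  proof (rule clinear_eq_on_power[OF _ _ _ Suc.prems])
    fix ws :: "'v list" assume "length ws = Suc n"
    then obtain x xs where ws: "ws = x # xs" and xs: "tensor_word xs \<in> tensor_power n"
      by (metis length_Suc_conv tensor_word_in_power)
    have "polar (tensor_incl e * (tensor_incl x * tensor_word xs)) =
        (of_nat m - of_nat (Suc n)) *\<^sub>C polar (tensor_incl x * tensor_word xs)"
    proof (rule homogeneous_eqI[where x = x])
      fix p x assume x: "homogeneous p (x :: 'v)"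
      have "polar (tensor_incl e * (tensor_incl x * tensor_word xs)) =
          polar (tensor_incl x * (tensor_incl e * tensor_word xs))"
        using supersymmetric_swap[OF polar_supersymmetric e_even x, of "[]"] by simp
      also have "\<dots> = \<rho> (\<zeta> x) (polar (tensor_incl e * tensor_word xs)) -
          polar (tensor_incl x * tensor_word xs) - polar (tensor_incl e * D (\<zeta> x) (tensor_word xs))"
        by (simp add: polar_Cons[of x "tensor_incl e * tensor_word xs"] D_Cons_even[OF e_even] polar_simps)
      also have "\<dots> = (of_nat m - of_nat n) *\<^sub>C polar (tensor_incl x * tensor_word xs) - polar (tensor_incl x * tensor_word xs)"
        by (simp add: Suc.IH xs D_tensor_power rho_simps polar_Cons[of x] cvec.scale_right_diff_distrib
            clinear_diff[OF cbilinear_right[OF rho_bilinear]] cvec.scale_left_diff_distrib algebra_simps)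
      finally show "polar (tensor_incl e * (tensor_incl x * tensor_word xs)) =
          (of_nat m - of_nat (Suc n)) *\<^sub>C polar (tensor_incl x * tensor_word xs)"
        by (simp add: cvec.scale_left_diff_distrib scaleC_add_left)
    qed (intro clinear_scaled clinear_compose[OF polar_linear] clinear_compose[OF clinear_times_right]
        clinear_compose[OF clinear_times_left] tensor_incl_linear)+
    then show "polar (tensor_incl e * tensor_word ws) = (of_nat m - of_nat (Suc n)) *\<^sub>C polar (tensor_word ws)"
      by (simp add: ws tensor_word_Cons)
  qed (intro clinear_compose[OF polar_linear clinear_times_right] clinear_scaled polar_linear)+
qed

text \<open>Powers of \<open>e'\<close> are the accessible case: \<open>\<zeta> e'\<close> kills
  \<open>e'\<close>, so the recursion has no correction term and \<open>polar (e'^n)\<close> is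
  \<open>(\<rho> (\<zeta> e'))^n w\<close>. The elements \<open>\<zeta>' x\<close> convert
  \<open>e'\<close> into any letter and kill \<open>e\<close>, so \<open>act_polar\<close> makes
  \<open>polar\<close> commute with them and its zeros persist.\<close>

lemma polar_vanish:
  assumes "t \<in> tensor_power (Suc m)"
  shows "polar t = 0"
proof (rule supersymmetric_vanish[OF polar_supersymmetric e'_even _ _ assms])
  have "polar (tensor_incl e' ^ n) = (\<rho> (\<zeta> e') ^^ n) w" for n
  proof (induction n)
    case (Suc n)
    have "polar (D (\<zeta> e') (tensor_incl e' ^ n)) = 0"
      by (simp add: D_power_even[OF e'_even] zeta_e' clinear_0[OF tensor_incl_linear] polar_simps)
    then show ?case by (simp add: polar_Cons Suc)
  qed simp
  then show "polar (tensor_incl e' ^ Suc m) = 0" by (simp only: nilpotent)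
  show "\<exists>z. homogeneous p z \<and> \<delta> z e' = x \<and> (\<forall>t\<in>tensor_power (Suc m). polar t = 0 \<longrightarrow> polar (D z t) = 0)"
    if "homogeneous p x" for p x
  proof (intro exI[of _ "\<zeta>' x"] conjI ballI impI)
    fix t assume "polar t = 0"
    then show "polar (D (\<zeta>' x) t) = 0"
      using act_polar[of "\<zeta>' x" t] rho_simps(4)[of "\<zeta>' x" 0 0] by (simp add: zeta'_e polar_simps)
  qed (use that in \<open>simp_all add: zeta'_graded zeta'_e'\<close>)
qed

text \<open>The term by which \<open>act_polar\<close> differs from equivariance has length
  \<open>m + 1\<close>.\<close>

lemma polar_equivariant:
  assumes "t \<in> tensor_power m"
  shows "polar (D z t) = \<rho> z (polar t)"
proof -
  have "tensor_incl y * t \<in> tensor_power (Suc m)" for y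
    using tensor_power_times[OF tensor_word_in_power[of "[y]" 1] assms] by (simp add: tensor_word_single)
  then show ?thesis by (simp add: act_polar polar_vanish)
qed

lemma polar_e_power: "polar (tensor_incl e ^ m) = fact m *\<^sub>C w"
proof -
  \<comment> \<open>The factor \<open>fact (m - n)\<close> keeps the induction free of division; the
    claim is the case \<open>n = m\<close>.\<close>
  have "n \<le> m \<Longrightarrow> fact (m - n) *\<^sub>C polar (tensor_incl e ^ n) = fact m *\<^sub>C w" for n
  proof (induction n)
    case (Suc n)
    have "tensor_incl e ^ n \<in> tensor_power n" unfolding tensor_incl_power by auto
    moreover have "m - n = Suc (m - Suc n)" using Suc.prems by simp
    then have "fact (m - n) = fact (m - Suc n) * (of_nat m - of_nat n :: complex)"
      using Suc.prems by (simp add: mult.commute of_nat_diff)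
    ultimately show ?case using Suc by (simp add: polar_e scaleC_scaleC)
  qed simp
  from this[of m] show ?thesis by simp
qed

end

section \<open>The symmetrizer\<close>

text \<open>Gives every pair \<open>j < k\<close> a factor, so that the sign becomes a product over
  an index set independent of \<open>\<sigma>\<close> and can be reindexed.\<close>

definition inversion_sign :: "bool list \<Rightarrow> (nat \<Rightarrow> nat) \<Rightarrow> nat \<Rightarrow> nat \<Rightarrow> complex" where
  "inversion_sign es \<sigma> j k = (if \<sigma> j > \<sigma> k then koszul (es ! \<sigma> j) (es ! \<sigma> k) else 1)"

lemma finite_pairs: "finite {(j, k). j < k \<and> k < (m::nat)}"
  by (rule finite_subset[of _ "{..<m} \<times> {..<m}"]) auto

lemma koszul_sign_alt:
  "koszul_sign es \<sigma> = (\<Prod>(j, k)\<in>{(j, k). j < k \<and> k < length es}. inversion_sign es \<sigma> j k)"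
  unfolding koszul_sign_def
  by (rule prod.mono_neutral_cong_left[OF finite_pairs]) (auto simp: inversion_sign_def split: if_splits)

lemma koszul_commute: "koszul p q = koszul q p"
  by (auto simp: koszul_def)

lemma koszul_square [simp]: "koszul p q * koszul p q = 1"
  by (auto simp: koszul_def)

text \<open>The pairs of positions are reindexed along \<open>\<tau>\<close>, with
  \<open>min\<close> and \<open>max\<close> restoring their order. Pair by pair, an inversion by
  exactly one of \<open>\<tau>\<close> and \<open>\<sigma>\<close> is an inversion of the composite,
  while two inversions contribute the same factor twice, which squares to 1.\<close>

lemma koszul_sign_compose:
  assumes \<sigma>: "\<sigma> permutes {..<m}" and \<tau>: "\<tau> permutes {..<m}" and len: "length es = m"
  shows "koszul_sign es (\<sigma> \<circ> \<tau>) =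
    koszul_sign es \<sigma> * koszul_sign (map (\<lambda>j. es ! \<sigma> j) [0..<m]) \<tau>"
proof -
  let ?P = "{(j, k). j < k \<and> k < m}" and ?es = "map (\<lambda>j. es ! \<sigma> j) [0..<m]"
  let ?f = "\<lambda>\<tau> (j, k). (min (\<tau> j) (\<tau> k), max (\<tau> j) (\<tau> k))"
  have lt: "\<tau> j < m \<longleftrightarrow> j < m" "inv \<tau> j < m \<longleftrightarrow> j < m" for j
    using permutes_in_image[OF \<tau>, of j] permutes_in_image[OF permutes_inv[OF \<tau>], of j] by simp_all
  note inv = permutes_inverses[OF \<tau>]
  note inj = permutes_inj[OF \<tau>] permutes_inj[OF permutes_inv[OF \<tau>]]
  have "(\<Prod>(j, k)\<in>?P. inversion_sign es \<sigma> j k) =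
      (\<Prod>(j, k)\<in>?P. inversion_sign es \<sigma> (min (\<tau> j) (\<tau> k)) (max (\<tau> j) (\<tau> k)))"
  proof (rule prod.reindex_bij_witness[of _ "?f \<tau>" "?f (inv \<tau>)"])
    fix a assume "a \<in> ?P"
    then obtain j k where a: "a = (j, k)" "j < k" "k < m" by blast
    have ne: "\<tau> j \<noteq> \<tau> k" "inv \<tau> j \<noteq> inv \<tau> k"
      using a inj by (metis injD less_irrefl)+
    show *: "?f \<tau> (?f (inv \<tau>) a) = a" and "?f (inv \<tau>) (?f \<tau> a) = a" "?f \<tau> a \<in> ?P" "?f (inv \<tau>) a \<in> ?P"
      using a ne by (auto simp: min_def max_def inv lt)
    have "(case b of (j, k) \<Rightarrow> inversion_sign es \<sigma> (min (\<tau> j) (\<tau> k)) (max (\<tau> j) (\<tau> k))) =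
        (case ?f \<tau> b of (j, k) \<Rightarrow> inversion_sign es \<sigma> j k)" for b
      by (simp add: case_prod_unfold)
    then show "(case ?f (inv \<tau>) a of (j, k) \<Rightarrow> inversion_sign es \<sigma> (min (\<tau> j) (\<tau> k)) (max (\<tau> j) (\<tau> k))) =
        (case a of (j, k) \<Rightarrow> inversion_sign es \<sigma> j k)"
      by (simp only: *)
  qed
  moreover have "inversion_sign es \<sigma> (min (\<tau> j) (\<tau> k)) (max (\<tau> j) (\<tau> k)) * inversion_sign ?es \<tau> j k =
      inversion_sign es (\<sigma> \<circ> \<tau>) j k" if "j < k" "k < m" for j k
  proof -
    have ne: "\<tau> j \<noteq> \<tau> k" using that inj by (metis injD less_irrefl)
    then have "\<sigma> (\<tau> j) \<noteq> \<sigma> (\<tau> k)" using permutes_inj[OF \<sigma>] by (metis injD)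
    then show ?thesis
      using that ne lt(1)[of j] lt(1)[of k] koszul_commute[of "es ! \<sigma> (\<tau> j)" "es ! \<sigma> (\<tau> k)"]
      by (auto simp: inversion_sign_def min_def max_def)
  qed
  then have "(\<Prod>(j, k)\<in>?P. inversion_sign es (\<sigma> \<circ> \<tau>) j k) =
    (\<Prod>(j, k)\<in>?P. inversion_sign es \<sigma> (min (\<tau> j) (\<tau> k)) (max (\<tau> j) (\<tau> k)) * inversion_sign ?es \<tau> j k)"
    by (intro prod.cong) auto
  ultimately show ?thesis
    by (simp add: koszul_sign_alt len case_prod_unfold prod.distrib)
qed

lemma permute_act_linear: "\<sigma> permutes {..<m} \<Longrightarrow> clinear (permute_act m \<sigma>)"
  unfolding permute_act_def by (rule multilinear_lift_linear[OF permute_multilinear])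

lemma permute_act_homogeneous_word:
  assumes "\<sigma> permutes {..<m}" "length ws = m" "list_all2 homogeneous qs ws"
  shows "permute_act m \<sigma> (tensor_word ws) = koszul_sign qs \<sigma> *\<^sub>C tensor_word (map (\<lambda>j. ws ! \<sigma> j) [0..<m])"
  using assms by (intro permute_act_homogeneous) (auto simp: list_all2_conv_all_nth)

lemma permute_act_other:
  "\<sigma> permutes {..<m} \<Longrightarrow> length ws \<noteq> m \<Longrightarrow> permute_act m \<sigma> (tensor_word ws) = 0"
  by (simp add: permute_act_def permute_multilinear)

text \<open>The order is reversed because \<open>permute_act m \<sigma>\<close> is the operator of
  the inverse of \<open>\<sigma>\<close>.\<close>

lemma permute_act_compose:
  fixes t :: "'v::superspace tensor_algebra"
  assumes \<sigma>: "\<sigma> permutes {..<m}" and \<tau>: "\<tau> permutes {..<m}" and t: "t \<in> tensor_power m"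
  shows "permute_act m (\<sigma> \<circ> \<tau>) t = permute_act m \<tau> (permute_act m \<sigma> t)"
proof (rule clinear_eq_on_homogeneous_words[OF _ _ _ t])
  note \<sigma>\<tau> = permutes_compose[OF \<tau> \<sigma>]
  show "clinear (permute_act m (\<sigma> \<circ> \<tau>))" "clinear (\<lambda>t. permute_act m \<tau> (permute_act m \<sigma> t))"
    by (rule permute_act_linear[OF \<sigma>\<tau>],
        rule clinear_compose[OF permute_act_linear[OF \<tau>] permute_act_linear[OF \<sigma>]])
  fix ws :: "'v list" and ps assume ws: "length ws = m" "list_all2 homogeneous ps ws"
  let ?g = "\<lambda>xs. map (\<lambda>j. xs ! \<sigma> j) [0..<m]"
  have lt: "\<tau> j < m \<longleftrightarrow> j < m" "\<sigma> j < m \<longleftrightarrow> j < m" for j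
    using permutes_in_image[OF \<tau>, of j] permutes_in_image[OF \<sigma>, of j] by simp_all
  have ps: "length ps = m" using ws list_all2_lengthD by fastforce
  have "list_all2 homogeneous (?g ps) (?g ws)"
    using ws lt by (auto simp: list_all2_conv_all_nth)
  then have "permute_act m \<tau> (permute_act m \<sigma> (tensor_word ws)) =
      (koszul_sign ps \<sigma> * koszul_sign (?g ps) \<tau>) *\<^sub>C tensor_word (map (\<lambda>j. ?g ws ! \<tau> j) [0..<m])"
    by (simp add: permute_act_homogeneous_word[OF \<sigma> ws] clinear_scale[OF permute_act_linear[OF \<tau>]]
        permute_act_homogeneous_word[OF \<tau>, of "?g ws" "?g ps"] scaleC_scaleC)
  also have "map (\<lambda>j. ?g ws ! \<tau> j) [0..<m] = map (\<lambda>j. ws ! (\<sigma> \<circ> \<tau>) j) [0..<m]"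
    using lt by auto
  finally show "permute_act m (\<sigma> \<circ> \<tau>) (tensor_word ws) = permute_act m \<tau> (permute_act m \<sigma> (tensor_word ws))"
    by (simp only: permute_act_homogeneous_word[OF \<sigma>\<tau> ws] koszul_sign_compose[OF \<sigma> \<tau> ps])
qed

lemma permute_act_id: "t \<in> tensor_power m \<Longrightarrow> permute_act m id (t :: 'v::superspace tensor_algebra) = t"
proof (rule clinear_eq_on_homogeneous_words[where f = "permute_act m id" and g = "\<lambda>t. t" and t = t])
  fix ws :: "'v list" and ps assume ws: "length ws = m" "list_all2 homogeneous ps ws"
  have "koszul_sign ps id = 1"
    unfolding koszul_sign_def by (rule prod.neutral) auto
  moreover have "map ((!) ws) [0..<m] = ws" using ws(1) map_nth by blast
  ultimately show "permute_act m id (tensor_word ws) = tensor_word ws"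
    by (simp add: permute_act_homogeneous_word[OF permutes_id ws])
qed (auto intro: permute_act_linear[OF permutes_id] clinear_ident)

lemma permute_act_tensor_power:
  assumes \<sigma>: "\<sigma> permutes {..<m}" and t: "t \<in> tensor_power m"
  shows "permute_act m \<sigma> t \<in> tensor_power m"
  using t unfolding tensor_power_def
proof (induction rule: cvec.span_induct_alt)
  case (step c y z)
  then obtain ws where y: "y = tensor_word ws" "length ws = m" by blast
  have "permute_act m \<sigma> y \<in> cvec.span {tensor_word ws |ws. length ws = m}"
    unfolding y(1) permute_act_def multilinear_lift_word[OF permute_multilinear[OF \<sigma>]]
    by (simp add: y(2), intro cvec.span_sum cvec.span_scale tensor_word_in_power[unfolded tensor_power_def]) simp
  then show ?case using step
    by (simp add: clinear_add[OF permute_act_linear[OF \<sigma>]] clinear_scale[OF permute_act_linear[OF \<sigma>]]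
        cvec.span_add cvec.span_scale)
qed (simp add: clinear_0[OF permute_act_linear[OF \<sigma>]] cvec.span_zero)

lemma koszul_sign_adjacent:
  assumes "Suc i < length es"
  shows "koszul_sign es (Transposition.transpose i (Suc i)) = koszul (es ! i) (es ! Suc i)"
proof -
  have "{(j, k). j < k \<and> k < length es \<and> Transposition.transpose i (Suc i) j > Transposition.transpose i (Suc i) k} = {(i, Suc i)}"
    using assms by (auto simp: Transposition.transpose_def split: if_splits)
  then show ?thesis by (simp add: koszul_sign_def koszul_commute)
qed

lemma permute_act_adjacent:
  assumes x: "homogeneous p x" and y: "homogeneous q y"
    and s: "s \<in> tensor_power i" and t: "t \<in> tensor_power k" and m: "m = Suc (Suc (i + k))"
  shows "permute_act m (Transposition.transpose i (Suc i)) (s * (tensor_incl x * (tensor_incl y * t))) =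
    koszul p q *\<^sub>C (s * (tensor_incl y * (tensor_incl x * t)))"
proof -
  have perm: "Transposition.transpose i (Suc i) permutes {..<m}" by (rule permutes_swap_id) (auto simp: m)
  note lin = permute_act_linear[OF perm]
  note clin3 = clinear_compose[OF clinear_times_right clinear_compose[OF clinear_times_right clinear_times_right]]
  have words: "permute_act m (Transposition.transpose i (Suc i)) (tensor_word us * (tensor_incl x * (tensor_incl y * tensor_word vs))) =
    koszul p q *\<^sub>C (tensor_word us * (tensor_incl y * (tensor_incl x * tensor_word vs)))"
    if us: "length us = i" "list_all2 homogeneous ps us" and vs: "length vs = k" "list_all2 homogeneous qs vs" for us vs ps qs
  proof -
    have len: "length ps = i" using us list_all2_lengthD by fastforce
    let ?ws = "us @ x # y # vs" and ?es = "ps @ p # q # qs"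
    have ws: "length ?ws = m" "list_all2 homogeneous ?es ?ws"
      using us vs x y by (auto simp: m list_all2_appendI)
    have "map (\<lambda>j. ?ws ! Transposition.transpose i (Suc i) j) [0..<m] = us @ y # x # vs"
    proof (rule nth_equalityI)
      fix j assume "j < length (map (\<lambda>j. ?ws ! Transposition.transpose i (Suc i) j) [0..<m])"
      then have "j < m" by simp
      then show "map (\<lambda>j. ?ws ! Transposition.transpose i (Suc i) j) [0..<m] ! j = (us @ y # x # vs) ! j"
        using us(1) by (auto simp: Transposition.transpose_def nth_append nth_Cons' not_less)
    qed (simp add: m us vs)
    moreover have "koszul_sign ?es (Transposition.transpose i (Suc i)) = koszul p q"
      using len by (subst koszul_sign_adjacent) (auto simp: nth_append)
    ultimately show ?thesis
      using permute_act_homogeneous_word[OF perm ws] by (simp add: tensor_word_append tensor_word_Cons)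
  qed
  have 1: "permute_act m (Transposition.transpose i (Suc i)) (tensor_word us * (tensor_incl x * (tensor_incl y * t))) =
    koszul p q *\<^sub>C (tensor_word us * (tensor_incl y * (tensor_incl x * t)))"
    if us: "length us = i" "list_all2 homogeneous ps us" for us ps
    by (rule clinear_eq_on_homogeneous_words[where t = t and n = k and
          f = "\<lambda>t. permute_act m (Transposition.transpose i (Suc i)) (tensor_word us * (tensor_incl x * (tensor_incl y * t)))" and
          g = "\<lambda>t. koszul p q *\<^sub>C (tensor_word us * (tensor_incl y * (tensor_incl x * t)))"])
      (rule clinear_compose[OF lin clin3] clinear_scaled[OF clin3] words[OF us] t | assumption)+
  show ?thesis
    by (rule clinear_eq_on_homogeneous_words[where t = s and n = i and
          f = "\<lambda>s. permute_act m (Transposition.transpose i (Suc i)) (s * (tensor_incl x * (tensor_incl y * t)))" and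
          g = "\<lambda>s. koszul p q *\<^sub>C (s * (tensor_incl y * (tensor_incl x * t)))"])
      (rule clinear_compose[OF lin clinear_times_left] clinear_scaled[OF clinear_times_left] 1 s | assumption)+
qed

definition symmetrizer :: "nat \<Rightarrow> 'v::superspace tensor_algebra \<Rightarrow> 'v tensor_algebra" where
  "symmetrizer m t = (\<Sum>\<sigma> | \<sigma> permutes {..<m}. permute_act m \<sigma> t)"

lemma symmetrizer_linear: "clinear (symmetrizer m)"
  unfolding symmetrizer_def by (rule clinear_sum_fun) (simp add: permute_act_linear)

lemma symmetrizer_permute:
  assumes \<tau>: "\<tau> permutes {..<m}" and t: "t \<in> tensor_power m"
  shows "symmetrizer m (permute_act m \<tau> t) = symmetrizer m t"
proof -
  have "(\<Sum>\<sigma> | \<sigma> permutes {..<m}. permute_act m \<sigma> t) = (\<Sum>\<sigma> | \<sigma> permutes {..<m}. permute_act m (\<tau> \<circ> \<sigma>) t)"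
    by (rule setum_permutations_compose_left[OF \<tau>])
  also have "\<dots> = (\<Sum>\<sigma> | \<sigma> permutes {..<m}. permute_act m \<sigma> (permute_act m \<tau> t))"
    by (rule sum.cong) (simp_all add: permute_act_compose[OF \<tau> _ t])
  finally show ?thesis by (simp add: symmetrizer_def)
qed

text \<open>The symmetrizer absorbs every permutation; absorbing the adjacent transposition at
  \<open>x\<close> and \<open>y\<close> exchanges these letters at the cost of their Koszul sign. On
  words of length other than \<open>m\<close> both sides are 0.\<close>

lemma symmetrizer_supersymmetric: "supersymmetric (symmetrizer m)"
  unfolding supersymmetric_def
proof (intro conjI allI impI symmetrizer_linear)
  fix us p q and x y :: 'a and t :: "'a tensor_algebra" assume x: "homogeneous p x" and y: "homogeneous q y"
  note lin = clinear_compose[OF symmetrizer_linear clinear_compose[OF clinear_times_right clinear_compose[OF clinear_times_right clinear_times_right]]]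
  show "symmetrizer m (tensor_word us * (tensor_incl x * (tensor_incl y * t))) =
      koszul p q *\<^sub>C symmetrizer m (tensor_word us * (tensor_incl y * (tensor_incl x * t)))"
  proof (rule tensor_eqI[where t = t, OF lin clinear_scaled[OF lin]])
    fix vs
    show "symmetrizer m (tensor_word us * (tensor_incl x * (tensor_incl y * tensor_word vs))) =
      koszul p q *\<^sub>C symmetrizer m (tensor_word us * (tensor_incl y * (tensor_incl x * tensor_word vs)))"
    proof (cases "m = Suc (Suc (length us + length vs))")
      case True
      have "Transposition.transpose (length us) (Suc (length us)) permutes {..<m}"
        by (rule permutes_swap_id) (auto simp: True)
      moreover have "tensor_word us * (tensor_incl x * (tensor_incl y * tensor_word vs)) \<in> tensor_power m"
        using tensor_word_in_power[of "us @ x # y # vs" m] True by (simp add: tensor_word_append tensor_word_Cons)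
      ultimately have "symmetrizer m (koszul p q *\<^sub>C (tensor_word us * (tensor_incl y * (tensor_incl x * tensor_word vs)))) =
          symmetrizer m (tensor_word us * (tensor_incl x * (tensor_incl y * tensor_word vs)))"
        using symmetrizer_permute[of "Transposition.transpose (length us) (Suc (length us))" m]
        by (simp flip: permute_act_adjacent[OF x y tensor_word_in_power[OF refl] tensor_word_in_power[OF refl] True])
      then show ?thesis by (simp add: clinear_scale[OF symmetrizer_linear])
    next
      case False
      then have "symmetrizer m (tensor_word (us @ a # b # vs)) = 0" for a b :: 'a
        by (simp add: symmetrizer_def permute_act_other)
      then show ?thesis by (simp add: tensor_word_append tensor_word_Cons)
    qed
  qed
qed

lemma symmetrizer_even_power:
  assumes "homogeneous False e"
  shows "symmetrizer m (tensor_incl e ^ m) = fact m *\<^sub>C tensor_incl e ^ m"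
proof -
  have "permute_act m \<sigma> (tensor_word (replicate m e)) = tensor_word (replicate m e)" if \<sigma>: "\<sigma> permutes {..<m}" for \<sigma>
  proof -
    have lt: "\<sigma> j < m \<longleftrightarrow> j < m" for j using permutes_in_image[OF \<sigma>, of j] by simp
    have "koszul_sign (replicate m False) \<sigma> = 1"
      unfolding koszul_sign_def by (rule prod.neutral) (auto simp: lt)
    moreover have "map (\<lambda>j. replicate m e ! \<sigma> j) [0..<m] = replicate m e"
      by (rule nth_equalityI) (auto simp: lt)
    moreover have "list_all2 homogeneous (replicate m False) (replicate m e)"
      using assms by (simp add: list_all2_conv_all_nth)
    ultimately show ?thesis by (simp add: permute_act_homogeneous_word[OF \<sigma>])
  qed
  then show ?thesis
    by (simp add: symmetrizer_def tensor_incl_power cvec.sum_constant_scale card_permutations[of "{..<m}" m])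
qed

lemma symmetrized_power_image: "symmetrized_power m = symmetrizer m ` tensor_power m"
proof -
  have "symmetrized_power m = cvec.span (symmetrizer m ` {tensor_word ws |ws. length ws = m})"
    unfolding symmetrized_power_def symmetrizer_def by (rule arg_cong[of _ _ cvec.span]) blast
  also have "\<dots> = symmetrizer m ` tensor_power m"
    unfolding tensor_power_def
    by (rule module_hom.span_image[OF symmetrizer_linear[unfolded linear_iff_module_hom]])
  finally show ?thesis .
qed

section \<open>The coproduct action commutes with permutations\<close>

context supermodule
begin

text \<open>\<open>D z\<close> acts on the prefix, on \<open>x\<close>, on \<open>y\<close> or on
  the rest. The transposition matches the four contributions for the two orders of the letters, and
  the signs agree because the parity of \<open>z\<close> is added to that of the letter on which it
  acts.\<close>

lemma D_permute_adjacent: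
  assumes i: "Suc i < m" and u: "u \<in> tensor_power m"
  shows "D z (permute_act m (Transposition.transpose i (Suc i)) u) = permute_act m (Transposition.transpose i (Suc i)) (D z u)"
proof -
  let ?\<tau> = "permute_act m (Transposition.transpose i (Suc i))"
  have perm: "Transposition.transpose i (Suc i) permutes {..<m}" using i by (intro permutes_swap_id) auto
  note lin = permute_act_linear[OF perm]
  show ?thesis
  proof (rule homogeneous_eqI[where x = z])
    show "clinear (\<lambda>z. D z (?\<tau> u))" "clinear (\<lambda>z. ?\<tau> (D z u))"
      by (rule cbilinear_left[OF D_bilinear], rule clinear_compose[OF lin cbilinear_left[OF D_bilinear]])
    fix r z assume z: "homogeneous r (z :: 'g)"
    show "D z (?\<tau> u) = ?\<tau> (D z u)"
    proof (rule clinear_eq_on_homogeneous_words[OF _ _ _ u])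
      show "clinear (\<lambda>u. D z (?\<tau> u))" "clinear (\<lambda>u. ?\<tau> (D z u))"
        by (rule clinear_compose[OF D_linear lin], rule clinear_compose[OF lin D_linear])
      fix ws :: "'v list" and ps assume ws: "length ws = m" "list_all2 homogeneous ps ws"
      define us x y vs where def: "us = take i ws" "x = ws ! i" "y = ws ! Suc i" "vs = drop (Suc (Suc i)) ws"
      have split: "ws = us @ x # y # vs"
        using i ws(1) by (simp add: def id_take_nth_drop[symmetric] Cons_nth_drop_Suc)
      have len: "length us = i" "m = Suc (Suc (i + length vs))" using i ws(1) by (auto simp: def)
      have x: "homogeneous (ps ! i) x" and y: "homogeneous (ps ! Suc i) y"
        using ws i by (auto simp: def list_all2_conv_all_nth)
      define p q where pq: "p = ps ! i" "q = ps ! Suc i"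
      note x = x[folded pq] and y = y[folded pq]
      let ?us = "tensor_word us" and ?vs = "tensor_word vs" and ?us' = "tensor_word (map (parity_twist r) us)"
      have us: "?us \<in> tensor_power i" "?us' \<in> tensor_power i" "D z ?us \<in> tensor_power i"
        and vs: "?vs \<in> tensor_power (length vs)" "D z ?vs \<in> tensor_power (length vs)"
        using D_tensor_word[of z us] D_tensor_word[of z vs] len by auto
      note adj = permute_act_adjacent[OF _ _ _ _ len(2)]
      note expand = D_word_mult[OF z] D_Cons[OF z] parity_twist_homogeneous[OF x] parity_twist_homogeneous[OF y]
      note g = graded[OF z x] graded[OF z y]
      let ?X = "tensor_incl x" and ?Y = "tensor_incl y" and ?zX = "tensor_incl (\<delta> z x)" and ?zY = "tensor_incl (\<delta> z y)"
      have Dxy: "D z (?us * (?X * (?Y * ?vs))) = D z ?us * (?X * (?Y * ?vs)) + ?us' * (?zX * (?Y * ?vs)) +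
          koszul r p *\<^sub>C (?us' * (?X * (?zY * ?vs))) + (koszul r p * koszul r q) *\<^sub>C (?us' * (?X * (?Y * D z ?vs)))"
        by (simp add: expand distrib_left clinear_scale[OF tensor_incl_linear] scaleC_mult_left
            scaleC_mult_right scaleC_add_right scaleC_scaleC add.assoc)
      have Dyx: "D z (?us * (?Y * (?X * ?vs))) = D z ?us * (?Y * (?X * ?vs)) + ?us' * (?zY * (?X * ?vs)) +
          koszul r q *\<^sub>C (?us' * (?Y * (?zX * ?vs))) + (koszul r q * koszul r p) *\<^sub>C (?us' * (?Y * (?X * D z ?vs)))"
        by (simp add: expand distrib_left clinear_scale[OF tensor_incl_linear] scaleC_mult_left
            scaleC_mult_right scaleC_add_right scaleC_scaleC add.assoc)
      have "?\<tau> (D z (?us * (?X * (?Y * ?vs)))) = koszul p q *\<^sub>C (D z ?us * (?Y * (?X * ?vs))) +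
          koszul (r \<noteq> p) q *\<^sub>C (?us' * (?Y * (?zX * ?vs))) +
          koszul r p *\<^sub>C koszul p (r \<noteq> q) *\<^sub>C (?us' * (?zY * (?X * ?vs))) +
          (koszul r p * koszul r q) *\<^sub>C koszul p q *\<^sub>C (?us' * (?Y * (?X * D z ?vs)))"
        by (simp only: Dxy clinear_add[OF lin] clinear_scale[OF lin] adj[OF x y us(3) vs(1)] adj[OF g(1) y us(2) vs(1)]
            adj[OF x g(2) us(2) vs(1)] adj[OF x y us(2) vs(2)])
      also have "\<dots> = koszul p q *\<^sub>C D z (?us * (?Y * (?X * ?vs)))"
        unfolding Dyx by (cases p; cases q; cases r) (simp_all add: koszul_def algebra_simps)
      also have "\<dots> = D z (?\<tau> (?us * (?X * (?Y * ?vs))))"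
        by (simp add: adj[OF x y us(1) vs(1)] D_simps)
      finally have "D z (?\<tau> (?us * (?X * (?Y * ?vs)))) = ?\<tau> (D z (?us * (?X * (?Y * ?vs))))" ..
      then show "D z (?\<tau> (tensor_word ws)) = ?\<tau> (D z (tensor_word ws))"
        by (simp add: split tensor_word_append tensor_word_Cons)
    qed
  qed
qed

text \<open>The permutations that commute with \<open>D z\<close> are closed under composition, so
  the adjacent transpositions yield all of them.\<close>

lemma D_permute:
  assumes "\<sigma> permutes {..<m}" "t \<in> tensor_power m"
  shows "D z (permute_act m \<sigma> t) = permute_act m \<sigma> (D z t)"
proof -
  define C where "C \<sigma> \<longleftrightarrow> \<sigma> permutes {..<m} \<and>
    (\<forall>t\<in>tensor_power m. D z (permute_act m \<sigma> t) = permute_act m \<sigma> (D z t))" for \<sigma>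
  have comp: "C (\<sigma> \<circ> \<tau>)" if "C \<sigma>" "C \<tau>" for \<sigma> \<tau>
    using that unfolding C_def
    by (auto simp: permute_act_compose permutes_compose permute_act_tensor_power D_tensor_power)
  have C_id: "C id" by (simp add: C_def permutes_id permute_act_id D_tensor_power)
  have C_id': "C (\<lambda>a. a)" using C_id unfolding id_def .
  have "C (Transposition.transpose a (a + k))" if "a + k < m" for a k
    using that
  proof (induction k)
    case 0
    then show ?case using C_id C_id' by simp
  next
    case (Suc k)
    have adj: "C (Transposition.transpose (a + k) (Suc (a + k)))"
      using Suc.prems unfolding C_def by (auto intro: permutes_swap_id simp: D_permute_adjacent)
    show ?case
    proof (cases "k = 0")
      case False
      \<comment> \<open>Conjugation by an adjacent transposition lengthens a transposition by one
        step. For \<open>k = 0\<close> it would give the identity, hence the case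
        distinction.\<close>
      have "Transposition.transpose (a + k) (Suc (a + k)) \<circ> Transposition.transpose a (a + k) \<circ> Transposition.transpose (a + k) (Suc (a + k)) =
          Transposition.transpose a (a + Suc k)"
        using False by (auto simp: fun_eq_iff Transposition.transpose_def)
      then show ?thesis using comp[OF comp[OF adj] adj] Suc by (metis Suc_lessD add_Suc_right)
    qed (use adj in simp)
  qed
  then have less: "C (Transposition.transpose a b)" if "a < b" "b < m" for a b
    using that by (metis le_add_diff_inverse less_imp_le)
  have trans: "C (Transposition.transpose a b)" if "a < m" "b < m" for a b
    using less[of a b] less[of b a] that C_id C_id' transpose_commute[of a b]
    by (cases a b rule: linorder_cases) simp_all
  have "C \<sigma>" using assms(1) finite_lessThan
  proof (induction rule: permutes_induct)
    case id
    show ?case by (rule C_id)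
  next
    case (swap a b p)
    then show ?case by (intro comp trans) auto
  qed
  then show ?thesis using assms(2) by (simp add: C_def)
qed

lemma D_symmetrizer: "t \<in> tensor_power m \<Longrightarrow> D z (symmetrizer m t) = symmetrizer m (D z t)"
  by (simp add: symmetrizer_def clinear_sum[OF D_linear] D_permute)

end

section \<open>The natural module of sl(2,1)\<close>

text \<open>A linear section of \<open>z \<mapsto> z v_1\<close>; the entry at position (2,2)
  restores the condition that defines sl(2,1).\<close>

lift_definition column_first :: "natural_module \<Rightarrow> sl21" is
  "\<lambda>v. v $ 1 *\<^sub>C (matrix_unit 1 1 - matrix_unit 2 2) + v $ 2 *\<^sub>C matrix_unit 2 1 + v $ 3 *\<^sub>C matrix_unit 3 1"
  by (simp add: matrix_unit_def)

text \<open>A linear section of \<open>z \<mapsto> z v_2\<close> whose values have zero first column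
  and hence kill \<open>v_1\<close>.\<close>

lift_definition column_second :: "natural_module \<Rightarrow> sl21" is
  "\<lambda>v. v $ 1 *\<^sub>C matrix_unit 1 2 + v $ 2 *\<^sub>C (matrix_unit 2 2 + matrix_unit 3 3) + v $ 3 *\<^sub>C matrix_unit 3 2"
  by (simp add: matrix_unit_def)

definition v2 :: natural_module where "v2 = Vec (axis 2 1)"
definition v3 :: natural_module where "v3 = Vec (axis 3 1)"

lemma coords_v [simp]: "coords v1 = axis 1 1" "coords v2 = axis 2 1" "coords v3 = axis 3 1"
  by (simp_all add: v1_def v2_def v3_def Vec_inverse)

lemmas module_rep = uminus_natural_module.rep_eq coords_inject[symmetric] Rep_sl21_inject[symmetric] natural_act.rep_eq column_first.rep_eq
  column_second.rep_eq plus_natural_module.rep_eq zero_natural_module.rep_eq scaleC_natural_module.rep_eq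
  component_natural_module.rep_eq plus_sl21.rep_eq zero_sl21.rep_eq scaleC_sl21.rep_eq component_sl21.rep_eq
  sl_h1.rep_eq sl_h2.rep_eq sl_x1.rep_eq sl_x2.rep_eq sl_x3.rep_eq sl_y1.rep_eq sl_y2.rep_eq sl_y3.rep_eq
  bracket_sl21.rep_eq

lemmas module_compute = module_rep vec_eq_iff forall_3 matrix_vector_mult_def sum_3 matrix_unit_def axis_def block_nth

lemma column_linear: "clinear column_first" "clinear column_second"
  by (auto intro!: clinearI simp: module_compute algebra_simps)

lemma column_component: "component p (column_first v) = column_first (component p v)"
  "component p (column_second v) = column_second (component p v)"
  by (cases p; simp add: module_compute)+

lemma column_act: "natural_act (column_first v) v1 = v" "natural_act (column_second v) v2 = v"
  "natural_act (column_second v) v1 = 0"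
  by (simp_all add: module_compute)

lemma column_values: "column_first v1 = sl_h1" "column_first v2 = sl_y1" "column_first v3 = sl_y3"
  by (simp_all add: module_compute)

lemma natural_act_values:
  "natural_act sl_h1 v1 = v1" "natural_act sl_h1 v2 = -1 *\<^sub>C v2" "natural_act sl_h1 v3 = 0"
  "natural_act sl_y1 v1 = v2" "natural_act sl_y1 v2 = 0" "natural_act sl_y1 v3 = 0"
  "natural_act sl_y3 v1 = v3" "natural_act sl_y3 v2 = 0" "natural_act sl_y3 v3 = 0"
  "natural_act sl_h2 v1 = 0" "natural_act sl_x1 v1 = 0" "natural_act sl_x2 v1 = 0" "natural_act sl_x3 v1 = 0"
  "natural_act sl_y2 v1 = 0"
  by (simp_all add: module_compute)

lemma v_parity [simp]: "homogeneous False v1" "homogeneous False v2" "homogeneous True v3"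
  by (simp_all add: homogeneous_def module_compute)

lemma sl_parity: "homogeneous False sl_h1" "homogeneous False sl_y1" "homogeneous True sl_y3"
  "homogeneous True sl_x2" "homogeneous True sl_y2"
  by (simp_all add: homogeneous_def module_compute)

lemma bracket_x2_y2: "bracket sl_x2 sl_y2 = sl_h2"
  by (simp add: module_compute matrix3_simps)

text \<open>Removing the first column of \<open>z\<close> leaves an element that kills
  \<open>v_1\<close>; the five listed matrices span these elements.\<close>

lemma sl21_decomposition:
  "\<exists>c1 c2 c3 c4 c5. z = column_first (natural_act z v1) + c1 *\<^sub>C sl_x1 + c2 *\<^sub>C sl_x2 + c3 *\<^sub>C sl_x3
    + c4 *\<^sub>C sl_y2 + c5 *\<^sub>C sl_h2"
proof -
  let ?M = "Rep_sl21 z"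
  have "?M $ 3 $ 3 = ?M $ 1 $ 1 + ?M $ 2 $ 2" using Rep_sl21[of z] by simp
  then have "z = column_first (natural_act z v1) + ?M $ 1 $ 2 *\<^sub>C sl_x1 + ?M $ 2 $ 3 *\<^sub>C sl_x2 + ?M $ 1 $ 3 *\<^sub>C sl_x3
    + ?M $ 3 $ 2 *\<^sub>C sl_y2 + (?M $ 1 $ 1 + ?M $ 2 $ 2) *\<^sub>C sl_h2"
    by (simp add: module_compute)
  then show ?thesis by blast
qed

section \<open>The two column sections with coefficients in A\<close>

lemma homogeneous_tensor [simp]: "homogeneous p x \<Longrightarrow> homogeneous p (x \<otimes> a)"
  by (simp add: homogeneous_def)

definition tensor_map :: "('v::complex_vector \<Rightarrow> 'w::complex_vector) \<Rightarrow> ('v, 'a::complex_vector) tensor \<Rightarrow> ('w, 'a) tensor" where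
  "tensor_map f = tensor_lift (\<lambda>v a. f v \<otimes> a)"

lemma tensor_map_bilinear: "clinear f \<Longrightarrow> cbilinear (\<lambda>v a. f v \<otimes> a)"
  by (rule cbilinearI) (simp_all add: pure_tensor_simps clinear_add clinear_scale)

lemma tensor_map_pure: "clinear f \<Longrightarrow> tensor_map f (v \<otimes> a) = f v \<otimes> a"
  by (simp add: tensor_map_def tensor_map_bilinear)

lemma tensor_map_linear: "clinear f \<Longrightarrow> clinear (tensor_map f)"
  unfolding tensor_map_def by (rule tensor_lift_linear[OF tensor_map_bilinear])

lemma tensor_eq_on_pure:
  assumes "clinear f" "clinear g" "\<And>v a. f (v \<otimes> a) = g (v \<otimes> a)"
  shows "f x = g x"
  by (induction x rule: tensor_induct) (simp_all add: assms(3) clinear_add[OF assms(1)] clinear_add[OF assms(2)])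

lemma tensor_map_graded:
  assumes f: "clinear f" and comp: "\<And>p v. component p (f v) = f (component p v)" and x: "homogeneous p x"
  shows "homogeneous p (tensor_map f x)"
proof -
  have "component p (tensor_map f x) = tensor_map f (component p x)"
    by (rule tensor_eq_on_pure[where x = x])
      (simp_all add: clinear_compose[OF component_linear tensor_map_linear[OF f]]
        clinear_compose[OF tensor_map_linear[OF f] component_linear] tensor_map_pure[OF f] comp)
  then show ?thesis using x by (simp add: homogeneous_def)
qed

abbreviation first_column :: "(natural_module, 'a::complex_vector) tensor \<Rightarrow> (sl21, 'a) tensor" where
  "first_column \<equiv> tensor_map column_first"
abbreviation second_column :: "(natural_module, 'a::complex_vector) tensor \<Rightarrow> (sl21, 'a) tensor" where
  "second_column \<equiv> tensor_map column_second"

lemmas first_column_pure = tensor_map_pure[OF column_linear(1)]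
  and second_column_pure = tensor_map_pure[OF column_linear(2)]
  and first_column_linear = tensor_map_linear[OF column_linear(1)]
  and second_column_linear = tensor_map_linear[OF column_linear(2)]

lemma first_column_act: "map_natural_act (first_column x) (v1 \<otimes> 1) = x"
  by (rule tensor_eq_on_pure[where x = x])
    (simp_all add: clinear_compose[OF cbilinear_left[OF map_natural_act_bilinear] first_column_linear]
      clinear_ident first_column_pure map_natural_act_pure column_act)

lemma second_column_act: "map_natural_act (second_column x) (v2 \<otimes> 1) = x"
  by (rule tensor_eq_on_pure[where x = x])
    (simp_all add: clinear_compose[OF cbilinear_left[OF map_natural_act_bilinear] second_column_linear]
      clinear_ident second_column_pure map_natural_act_pure column_act)

lemma second_column_kills: "map_natural_act (second_column x) (v1 \<otimes> 1) = 0"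
  by (rule tensor_eq_on_pure[where x = x])
    (simp_all add: clinear_compose[OF cbilinear_left[OF map_natural_act_bilinear] second_column_linear]
      clinear_zero second_column_pure map_natural_act_pure column_act)

interpretation nat_mod: supermodule "map_natural_act :: (sl21, 'a::complex_comm_algebra) tensor \<Rightarrow> _"
  by (rule supermodule.intro[OF map_natural_act_representation map_natural_act_graded])

abbreviation (input) natural_word_act :: "(sl21, 'a::complex_comm_algebra) tensor \<Rightarrow> _" where
  "natural_word_act \<equiv> coproduct_act map_natural_act"

abbreviation top_vector :: "nat \<Rightarrow> (natural_module, 'a::complex_comm_algebra) tensor tensor_algebra" where
  "top_vector m \<equiv> tensor_incl (v1 \<otimes> 1) ^ m"

section \<open>Modules generated by a vector satisfying the defining relations\<close>

lemma uea_act_power: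
  "representation \<rho> \<Longrightarrow> uea_act \<rho> (u ^ n) v = (uea_act \<rho> u ^^ n) v"
  by (induction n) (simp_all add: uea_act)

lemma uea_act_left_linear: "representation \<rho> \<Longrightarrow> clinear (\<lambda>u. uea_act \<rho> u v)"
  by (rule clinearI) (simp_all add: uea_act)

lemma uea_incl_funpow: "representation \<rho> \<Longrightarrow> (uea_act \<rho> (uea_incl x) ^^ n) v = (\<rho> x ^^ n) v"
  by (induction n) (simp_all add: uea_act)

lemma uea_induct [case_names scale add]:
  assumes scale: "\<And>c xs. P (c *\<^sub>C prod_list (map uea_incl xs))" and add: "\<And>s t. P s \<Longrightarrow> P t \<Longrightarrow> P (s + t)"
  shows "P u"
proof (induct u)
  case (1 t)
  have word: "abs_uea (tensor_word xs) = prod_list (map uea_incl xs)" for xs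
    by (induction xs) (simp_all add: one_uea_def tensor_word_Cons uea_incl_def flip: times_uea.abs_eq)
  show ?case
    by (induction t rule: tensor_algebra_induct)
      (simp_all add: assms word flip: plus_uea.abs_eq scaleC_uea.abs_eq)
qed

text \<open>Each step of the recursion applies one element of the Lie superalgebra. In the tensor
  power this becomes surjectivity: symmetrized tensors are values of \<open>polar\<close>, hence
  reached from the top vector.\<close>

lemma (in polarization) polar_in_submodule: "\<exists>u. polar t = uea_act \<rho> u w"
proof -
  have "t \<in> tensor_power n \<Longrightarrow> \<exists>u. polar t = uea_act \<rho> u w" for n t
  proof (induction n arbitrary: t)
    case (Suc n)
    from Suc.prems show ?case unfolding tensor_power_def[of "Suc n"]
    proof (induction rule: cvec.span_induct_alt)
      case (step c y z)
      then obtain ws where ws: "y = tensor_word ws" "length ws = Suc n" by blast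
      then obtain x xs where y: "y = tensor_incl x * tensor_word xs" "length xs = n"
        by (cases ws) (simp_all add: tensor_word_Cons)
      obtain u1 where u1: "polar (tensor_word xs) = uea_act \<rho> u1 w"
        using Suc.IH[of "tensor_word xs"] y by blast
      obtain u2 where u2: "polar (D (\<zeta> x) (tensor_word xs)) = uea_act \<rho> u2 w"
        using Suc.IH[of "D (\<zeta> x) (tensor_word xs)"] y D_tensor_word by blast
      obtain u3 where u3: "polar z = uea_act \<rho> u3 w" using step by blast
      have "polar (c *\<^sub>C y + z) = uea_act \<rho> (c *\<^sub>C (uea_incl (\<zeta> x) * u1 - u2) + u3) w"
        by (simp add: y polar_simps polar_Cons u1 u2 u3 uea_act[OF rho]
            clinear_diff[OF uea_act_left_linear[OF rho]])
      then show ?case by blast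
    next
      case base
      show ?case by (rule exI[of _ 0]) (simp add: polar_simps clinear_0[OF uea_act_left_linear[OF rho]])
    qed
  next
    case 0
    then show ?case unfolding tensor_power_def[of 0]
    proof (induction rule: cvec.span_induct_alt)
      case (step c y z)
      then obtain u where "polar z = uea_act \<rho> u w" by blast
      then have "polar (c *\<^sub>C y + z) = uea_act \<rho> (c *\<^sub>C 1 + u) w"
        using step by (auto simp: polar_simps uea_act[OF rho])
      then show ?case by blast
    next
      case base
      show ?case by (rule exI[of _ 0]) (simp add: polar_simps clinear_0[OF uea_act_left_linear[OF rho]])
    qed
  qed
  then have word: "\<exists>u. polar (tensor_word ws) = uea_act \<rho> u w" for ws by blast
  show ?thesis
  proof (induction t rule: tensor_algebra_induct)
    case (scale c ws)
    obtain u where "polar (tensor_word ws) = uea_act \<rho> u w" using word by blast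
    then have "polar (c *\<^sub>C tensor_word ws) = uea_act \<rho> (c *\<^sub>C u) w" by (simp add: polar_simps uea_act[OF rho])
    then show ?case by blast
  next
    case (add s t)
    then obtain u u' where "polar s = uea_act \<rho> u w" "polar t = uea_act \<rho> u' w" by blast
    then have "polar (s + t) = uea_act \<rho> (u + u') w" by (simp add: polar_simps uea_act[OF rho])
    then show ?case by blast
  qed
qed

lemma (in supermodule) uea_act_tensor_power: "t \<in> tensor_power n \<Longrightarrow> uea_act D u t \<in> tensor_power n"
proof (induction u rule: uea_induct)
  case (scale c xs)
  have "uea_act D (prod_list (map uea_incl xs)) t \<in> tensor_power n"
    by (induction xs) (simp_all add: uea_act[OF D_representation] scale D_tensor_power)
  then show ?case by (simp add: uea_act[OF D_representation] cvec.subspace_scale[OF subspace_tensor_power])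
qed (simp add: uea_act[OF D_representation] cvec.subspace_add[OF subspace_tensor_power])

text \<open>Equivariance is asked only on a stable set \<open>N\<close>, because
  \<open>polar\<close> has it only on tensors of length \<open>m\<close>.\<close>

lemma uea_act_intertwine:
  assumes \<rho>: "representation \<rho>" and \<rho>': "representation \<rho>'" and f: "clinear f"
    and stable: "\<And>z t. t \<in> N \<Longrightarrow> \<rho> z t \<in> N"
    and eq: "\<And>z t. t \<in> N \<Longrightarrow> f (\<rho> z t) = \<rho>' z (f t)" and t: "t \<in> N"
  shows "f (uea_act \<rho> u t) = uea_act \<rho>' u (f t)"
proof (induction u rule: uea_induct)
  case (scale c xs)
  have "uea_act \<rho> (prod_list (map uea_incl xs)) t \<in> N \<and>
      f (uea_act \<rho> (prod_list (map uea_incl xs)) t) = uea_act \<rho>' (prod_list (map uea_incl xs)) (f t)"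
    by (induction xs) (simp_all add: uea_act[OF \<rho>] uea_act[OF \<rho>'] t stable eq)
  then show ?case by (simp add: uea_act[OF \<rho>] uea_act[OF \<rho>'] clinear_scale[OF f])
qed (simp add: uea_act[OF \<rho>] uea_act[OF \<rho>'] clinear_add[OF f])

text \<open>To be instantiated both by the top vector of the tensor power and by the generator of a
  model of the Weyl module.\<close>

locale weyl_vector =
  fixes \<rho> :: "(sl21, 'a::complex_comm_algebra) tensor \<Rightarrow> 'm::complex_vector \<Rightarrow> 'm" and w :: 'm and m :: nat
  assumes representation: "representation \<rho>"
    and relations: "r \<in> weyl_relations m \<Longrightarrow> uea_act \<rho> r w = 0"
begin

text \<open>Only \<open>h_2 \<otimes> 1\<close> is covered directly by the relations. For general
  \<open>a\<close>, the element \<open>h_2 \<otimes> a\<close> is the bracket of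
  \<open>x_2 \<otimes> a\<close> and \<open>x_{-2} \<otimes> 1\<close>, and both of these kill
  \<open>w\<close>.\<close>

lemma annihilated:
  "\<rho> (sl_x1 \<otimes> a) w = 0" "\<rho> (sl_x2 \<otimes> a) w = 0" "\<rho> (sl_x3 \<otimes> a) w = 0" "\<rho> (sl_y2 \<otimes> a) w = 0" "\<rho> (sl_h2 \<otimes> a) w = 0"
proof -
  have "x \<in> {sl_x1, sl_x2, sl_x3} \<Longrightarrow> \<rho> (x \<otimes> a) w = 0" for x a
    using relations[OF weyl_relations.intros(1), of x a]
    by (simp add: n_plus_def cvec.span_base uea_act[OF representation])
  then show x: "\<rho> (sl_x1 \<otimes> a) w = 0" "\<rho> (sl_x2 \<otimes> a) w = 0" "\<rho> (sl_x3 \<otimes> a) w = 0" for a by simp_all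
  show y: "\<rho> (sl_y2 \<otimes> a) w = 0" for a
    using relations[OF weyl_relations.intros(4), of a] by (simp add: uea_act[OF representation])
  have z: "\<rho> z 0 = 0" for z
    using representation by (simp add: representation_def cbilinear_def clinear_0)
  have "\<rho> (bracket (sl_x2 \<otimes> a) (sl_y2 \<otimes> 1)) w = 0"
    using representation homogeneous_tensor[OF sl_parity(4), of a] homogeneous_tensor[OF sl_parity(5), of 1] x y z
    unfolding representation_def by (metis cvec.scale_zero_right diff_zero)
  then show "\<rho> (sl_h2 \<otimes> a) w = 0" by (simp add: bracket_x2_y2)
qed

text \<open>The condition \<open>vacuum\<close> holds since \<open>z \<otimes> a\<close> differs
  from the first-column element with the same effect on \<open>v_1\<close> by elements covered by
  \<open>annihilated\<close>. The weight condition is the relation for \<open>h_1\<close>, and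
  nilpotency is the one for \<open>x_{-1}\<close>.\<close>

sublocale integrable_polarization map_natural_act first_column "v1 \<otimes> 1" \<rho> w m "v2 \<otimes> 1" second_column
proof unfold_locales
  note b = cbilinearD[OF conjunct1[OF representation[unfolded representation_def]]]
  note lin = cbilinear_left[OF conjunct1[OF representation[unfolded representation_def]]]
  show "\<rho> z w = \<rho> (first_column (map_natural_act z (v1 \<otimes> 1))) w" for z
  proof (rule tensor_eq_on_pure[where x = z])
    fix z :: sl21 and a :: 'a
    obtain c1 c2 c3 c4 c5 where "z = column_first (natural_act z v1) + c1 *\<^sub>C sl_x1 + c2 *\<^sub>C sl_x2 + c3 *\<^sub>C sl_x3
        + c4 *\<^sub>C sl_y2 + c5 *\<^sub>C sl_h2"
      using sl21_decomposition by blast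
    then have "\<rho> (z \<otimes> a) w = \<rho> ((column_first (natural_act z v1) + c1 *\<^sub>C sl_x1 + c2 *\<^sub>C sl_x2 + c3 *\<^sub>C sl_x3
        + c4 *\<^sub>C sl_y2 + c5 *\<^sub>C sl_h2) \<otimes> a) w" by simp
    then show "\<rho> (z \<otimes> a) w = \<rho> (first_column (map_natural_act (z \<otimes> a) (v1 \<otimes> 1))) w"
      by (simp add: pure_tensor_simps b annihilated map_natural_act_pure first_column_pure)
  qed (intro lin clinear_compose[OF lin] clinear_compose[OF first_column_linear] cbilinear_left[OF map_natural_act_bilinear])+
  show "\<rho> (first_column (v1 \<otimes> 1)) w = of_nat m *\<^sub>C w"
    using relations[OF weyl_relations.intros(2), of sl_h1]
    by (simp add: cartan_def cvec.span_base uea_act[OF representation] clinear_diff[OF uea_act_left_linear[OF representation]]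
        first_column_pure column_values omega1)
  show "(\<rho> (first_column (v2 \<otimes> 1)) ^^ Suc m) w = 0"
    using relations[OF weyl_relations.intros(3)]
    by (simp only: uea_act_power[OF representation] uea_incl_funpow[OF representation] first_column_pure column_values Suc_eq_plus1)
qed (simp_all add: representation clinear_add[OF first_column_linear] clinear_scale[OF first_column_linear] first_column_act second_column_act second_column_kills
    tensor_map_graded column_linear column_component first_column_pure column_values map_natural_act_pure natural_act_values)

lemma uea_act_polar: "t \<in> tensor_power m \<Longrightarrow> uea_act \<rho> u (polar t) = polar (uea_act natural_word_act u t)"
  by (rule uea_act_intertwine[OF nat_mod.D_representation representation polar_linear, symmetric])
    (auto intro: nat_mod.D_tensor_power polar_equivariant)

text \<open>Since \<open>m!\<close> is invertible, whatever kills the top vector kills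
  \<open>w\<close>; this is the source of injectivity.\<close>

lemma uea_act_vector: "fact m *\<^sub>C uea_act \<rho> u w = polar (uea_act natural_word_act u (top_vector m))"
proof -
  have "(top_vector m :: (natural_module, 'a) tensor tensor_algebra) \<in> tensor_power m"
    by (simp add: tensor_incl_power tensor_word_in_power)
  from uea_act_polar[OF this, of u] show ?thesis
    by (simp add: polar_e_power clinear_scale[OF uea_act(6)[OF representation]])
qed

end

text \<open>A quotient by a left ideal is modelled on the enveloping algebra itself, by means of a
  projection along the ideal.\<close>

lemma projection_along:
  fixes J :: "'u::complex_vector set"
  assumes J: "cvec.subspace J"
  obtains \<pi> :: "'u \<Rightarrow> 'u" where "clinear \<pi>" "\<And>x. \<pi> x = 0 \<longleftrightarrow> x \<in> J" "\<And>x. x - \<pi> x \<in> J"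
proof -
  interpret vector_space_pair "scaleC :: complex \<Rightarrow> 'u \<Rightarrow> 'u" "scaleC :: complex \<Rightarrow> 'u \<Rightarrow> 'u" ..
  obtain B where B: "B \<subseteq> J" "cvec.independent B" "J \<subseteq> cvec.span B"
    using cvec.maximal_independent_subset by blast
  define C where "C = cvec.extend_basis B"
  have C: "B \<subseteq> C" "cvec.independent C" "cvec.span C = UNIV"
    using cvec.extend_basis_superset[OF B(2)] cvec.independent_extend_basis[OF B(2)]
      cvec.span_extend_basis[OF B(2)] by (auto simp: C_def)
  obtain \<pi> where \<pi>: "clinear \<pi>" "\<And>x. x \<in> C \<Longrightarrow> \<pi> x = (if x \<in> B then 0 else x)"
    using linear_independent_extend[OF C(2), of "\<lambda>x. if x \<in> B then 0 else x"] by blast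
  have diff: "x - \<pi> x \<in> J" for x
  proof -
    have "x \<in> cvec.span C" by (simp add: C)
    then show ?thesis
    proof (induction rule: cvec.span_induct_alt)
      case (step c y z)
      have "y - \<pi> y \<in> J" using step(1) B(1) \<pi>(2)[of y] cvec.subspace_0[OF J] by auto
      then have "c *\<^sub>C (y - \<pi> y) + (z - \<pi> z) \<in> J"
        using step(2) by (intro cvec.subspace_add[OF J] cvec.subspace_scale[OF J])
      then show ?case
        by (simp add: clinear_add[OF \<pi>(1)] clinear_scale[OF \<pi>(1)] cvec.scale_right_diff_distrib algebra_simps)
    qed (simp add: clinear_0[OF \<pi>(1)] cvec.subspace_0[OF J])
  qed
  have "\<pi> x = 0" if "x \<in> J" for x
    using \<pi>(1) _ subsetD[OF B(3) that] by (rule clinear_vanish_on_span) (use C(1) \<pi>(2) in auto)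
  with diff have "\<pi> x = 0 \<longleftrightarrow> x \<in> J" for x by (metis diff_zero)
  then show ?thesis using that \<pi>(1) diff by blast
qed

lemma weyl_relation_in_ideal: "r \<in> weyl_relations m \<Longrightarrow> r \<in> weyl_ideal m"
  unfolding weyl_ideal_def left_ideal_span_def
  by (rule cvec.span_base) (metis (mono_tags, lifting) mem_Collect_eq mult_1_left)

text \<open>With \<open>\<rho> z u = \<pi> (z u)\<close>, an element \<open>u\<close> sends the
  vector \<open>\<pi> 1\<close> to \<open>\<pi> u\<close>. Its annihilator is therefore the kernel
  of \<open>\<pi>\<close>, which is the ideal, and it generates a copy of the Weyl module.\<close>

lemma weyl_quotient_vector:
  obtains \<rho> :: "(sl21, 'a::complex_comm_algebra) tensor \<Rightarrow> (sl21, 'a) tensor uea \<Rightarrow> (sl21, 'a) tensor uea" and w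
  where "weyl_vector \<rho> w m" "\<And>u. uea_act \<rho> u w = 0 \<longleftrightarrow> u \<in> weyl_ideal m"
proof -
  obtain \<pi> :: "(sl21, 'a) tensor uea \<Rightarrow> (sl21, 'a) tensor uea" where lin: "clinear \<pi>"
    and ker: "\<And>u. \<pi> u = 0 \<longleftrightarrow> u \<in> weyl_ideal m" and diff: "\<And>u. u - \<pi> u \<in> weyl_ideal m"
    using projection_along[OF subspace_weyl_ideal[where 'a = 'a, of m]] by blast
  \<comment> \<open>\<open>v - \<pi> v\<close> lies in the left ideal, hence so does its product
    with \<open>u\<close>, and \<open>\<pi>\<close> kills it.\<close>
  have mult: "\<pi> (u * \<pi> v) = \<pi> (u * v)" for u v
    using ker[of "u * (v - \<pi> v)"] weyl_ideal_mult[OF diff, of u v]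
    by (simp add: right_diff_distrib clinear_diff[OF lin])
  define \<rho> where "\<rho> z u = \<pi> (uea_incl z * u)" for z u
  have \<rho>: "\<rho> z (\<pi> u) = \<pi> (uea_incl z * u)" for z u by (simp add: \<rho>_def mult)
  have rep: "representation \<rho>"
    unfolding representation_def
  proof (intro conjI allI impI)
    show "cbilinear \<rho>"
      by (rule cbilinearI) (simp_all add: \<rho>_def clinear_add[OF uea_incl_linear] clinear_scale[OF uea_incl_linear]
          distrib_left distrib_right scaleC_mult_left scaleC_mult_right clinear_add[OF lin] clinear_scale[OF lin])
    fix p q x y v assume "homogeneous p (x :: (sl21, 'a) tensor)" "homogeneous q (y :: (sl21, 'a) tensor)"
    from uea_incl_bracket[OF this] have "uea_incl (bracket x y) = uea_incl x * uea_incl y - koszul p q *\<^sub>C (uea_incl y * uea_incl x)"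
      by simp
    then show "\<rho> (bracket x y) v = \<rho> x (\<rho> y v) - koszul p q *\<^sub>C \<rho> y (\<rho> x v)"
      by (simp add: \<rho>_def mult left_diff_distrib scaleC_mult_left clinear_diff[OF lin] clinear_scale[OF lin] mult.assoc)
  qed
  have act: "uea_act \<rho> u (\<pi> 1) = \<pi> u" for u
  proof (induction u rule: uea_induct)
    case (scale c xs)
    have "uea_act \<rho> (prod_list (map uea_incl xs)) (\<pi> 1) = \<pi> (prod_list (map uea_incl xs))"
      by (induction xs) (simp_all add: uea_act[OF rep] \<rho>)
    then show ?case by (simp add: uea_act[OF rep] clinear_scale[OF lin])
  qed (simp add: uea_act[OF rep] clinear_add[OF lin])
  have "weyl_vector \<rho> (\<pi> 1) m"
    by unfold_locales (simp_all add: rep act ker weyl_relation_in_ideal)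
  then show ?thesis using that[of \<rho> "\<pi> 1"] by (simp add: act ker)
qed

section \<open>The isomorphism\<close>

lemma e_even: "homogeneous False (v1 \<otimes> (1::'a::complex_comm_algebra))"
  by simp

lemma act_top_vector:
  assumes "natural_act z v1 = c *\<^sub>C v1"
  shows "natural_word_act (z \<otimes> (1 :: 'a::complex_comm_algebra)) (top_vector m) = (of_nat m * c) *\<^sub>C top_vector m"
proof -
  let ?e = "tensor_incl (v1 \<otimes> 1) :: (natural_module, 'a) tensor tensor_algebra"
  have "?e ^ i * tensor_incl (c *\<^sub>C v1 \<otimes> 1) * ?e ^ (m - Suc i) = c *\<^sub>C ?e ^ m"
    if "i < m" for i
  proof -
    have "m = Suc (i + (m - Suc i))" using that by simp
    then have "?e ^ i * (?e * ?e ^ (m - Suc i)) = ?e ^ m"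
      by (metis add_Suc_right power_Suc power_add)
    then show ?thesis
      by (simp add: clinear_scale[OF tensor_incl_linear] scaleC_mult_left scaleC_mult_right mult.assoc)
  qed
  then show ?thesis
    by (simp add: nat_mod.D_power_even[OF e_even] map_natural_act_pure assms pure_tensor_scale_left
        cvec.sum_constant_scale scaleC_scaleC)
qed

lemma kill_top_vector:
  assumes "natural_act z v1 = 0"
  shows "natural_word_act (z \<otimes> a) (top_vector m) = 0"
  by (simp add: nat_mod.D_power_even[OF e_even] map_natural_act_pure assms clinear_0[OF tensor_incl_linear])

text \<open>Each of the \<open>m\<close> factors can be lowered only once, because
  \<open>x_{-1}\<close> kills \<open>v_2\<close>.\<close>

lemma lowering_nilpotent: "(natural_word_act (sl_y1 \<otimes> (1 :: 'a::complex_comm_algebra)) ^^ Suc m) (top_vector m) = 0"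
proof -
  let ?e = "tensor_incl (v1 \<otimes> 1) :: (natural_module, 'a) tensor tensor_algebra"
    and ?f = "tensor_incl (v2 \<otimes> 1) :: (natural_module, 'a) tensor tensor_algebra"
    and ?D = "natural_word_act (sl_y1 \<otimes> (1 :: 'a))"
  have e: "?D (?e * t) = ?f * t + ?e * ?D t" and f: "?D (?f * t) = ?f * ?D t" for t
    by (simp_all add: nat_mod.D_Cons_even map_natural_act_pure natural_act_values clinear_0[OF tensor_incl_linear])
  \<comment> \<open>The iterated Leibniz rule stops after two terms, as \<open>?D\<close> turns
    \<open>?e\<close> into \<open>?f\<close> and annihilates \<open>?f\<close>.\<close>
  have pow: "(?D ^^ Suc k) (?e * t) = ?e * (?D ^^ Suc k) t + of_nat (Suc k) *\<^sub>C (?f * (?D ^^ k) t)" for k t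
    by (induction k)
      (simp_all add: e f scaleC_add_left[of 1 1, simplified] nat_mod.D_simps scaleC_add_left algebra_simps)
  show ?thesis
  proof (induction m)
    case (Suc m)
    show ?case using pow[of "Suc m" "top_vector m"] Suc by simp
  qed simp
qed

lemma top_vector_relations:
  assumes "r \<in> weyl_relations m"
  shows "uea_act natural_word_act r (top_vector m) = 0"
  using assms
proof cases
  case (1 x a)
  have "natural_act x v1 = 0"
    using cbilinear_left[OF natural_act_bilinear] _ 1(2)[unfolded n_plus_def]
    by (rule clinear_vanish_on_span) (auto simp: natural_act_values)
  then show ?thesis by (simp add: 1 uea_act[OF nat_mod.D_representation] kill_top_vector)
next
  case (2 h)
  have "natural_act h v1 - omega1 h *\<^sub>C v1 = 0"
  proof (rule clinear_vanish_on_span[OF _ _ 2(2)[unfolded cartan_def]])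
    show "clinear (\<lambda>h. natural_act h v1 - omega1 h *\<^sub>C v1)"
      by (rule clinear_minus[OF cbilinear_left[OF natural_act_bilinear]], rule clinearI)
        (simp_all add: clinear_add[OF omega1(1)] clinear_scale[OF omega1(1)] scaleC_add_left scaleC_scaleC)
  qed (auto simp: natural_act_values omega1)
  then show ?thesis
    by (simp add: 2 uea_act[OF nat_mod.D_representation] act_top_vector
        clinear_diff[OF uea_act_left_linear[OF nat_mod.D_representation]])
next
  case 3
  then show ?thesis
    using lowering_nilpotent[where 'a = 'a, of m]
    by (simp only: uea_act_power[OF nat_mod.D_representation] uea_incl_funpow[OF nat_mod.D_representation] Suc_eq_plus1)
next
  case (4 a)
  then show ?thesis by (simp add: uea_act[OF nat_mod.D_representation] kill_top_vector natural_act_values)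
qed

interpretation top: weyl_vector "natural_word_act :: (sl21, 'a::complex_comm_algebra) tensor \<Rightarrow> _" "top_vector m" m
  by unfold_locales (simp_all add: nat_mod.D_representation top_vector_relations)

lemma supersymmetric_diff:
  assumes f: "supersymmetric f" and g: "supersymmetric g"
  shows "supersymmetric (\<lambda>t. f t - g t)"
  unfolding supersymmetric_def
proof (intro conjI allI impI clinear_minus supersymmetric_linear f g)
  fix us p q x y and t :: "'a tensor_algebra" assume xy: "homogeneous p (x :: 'a)" "homogeneous q (y :: 'a)"
  let ?s = "tensor_word us * (tensor_incl x * (tensor_incl y * t))" and ?s' = "tensor_word us * (tensor_incl y * (tensor_incl x * t))"
  show "f ?s - g ?s = koszul p q *\<^sub>C (f ?s' - g ?s')"
    unfolding supersymmetric_swap[OF f xy] supersymmetric_swap[OF g xy] by (simp add: cvec.scale_right_diff_distrib)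
qed

text \<open>Both maps are supersymmetric, commute with the action on length \<open>m\<close>, and
  take the top vector to its multiple by \<open>m!\<close>. Their difference is therefore covered by
  \<open>supersymmetric_vanish\<close>.\<close>

lemma top_polar:
  assumes "t \<in> tensor_power m"
  shows "top.polar m t = symmetrizer m t"
proof -
  let ?Q = "\<lambda>t. top.polar m t - symmetrizer m t"
  have "?Q t = 0"
  proof (rule nat_mod.supersymmetric_vanish[OF _ e_even _ _ assms, where Q = ?Q])
    show "supersymmetric ?Q"
      by (rule supersymmetric_diff[OF top.polar_supersymmetric symmetrizer_supersymmetric])
    show "?Q (top_vector m) = 0"
      by (simp add: top.polar_e_power symmetrizer_even_power)
    fix p and x :: "(natural_module, 'a) tensor" assume "homogeneous p x"
    then show "\<exists>z. homogeneous p z \<and> map_natural_act z (v1 \<otimes> 1) = x \<and>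
        (\<forall>t\<in>tensor_power m. ?Q t = 0 \<longrightarrow> ?Q (natural_word_act z t) = 0)"
      by (intro exI[of _ "first_column x"])
        (simp add: tensor_map_graded column_linear column_component first_column_act top.polar_equivariant
          flip: nat_mod.D_symmetrizer)
  qed
  then show ?thesis by simp
qed

text \<open>If \<open>u\<close> kills the top vector, then \<open>uea_act_vector\<close> in the
  model of the Weyl module shows that \<open>m! u w = 0\<close>, so \<open>u\<close> lies in the
  ideal. The converse is that the top vector satisfies the relations.\<close>

lemma kernel_top_vector:
  fixes u :: "(sl21, 'a::complex_comm_algebra) tensor uea"
  shows "uea_act natural_word_act u (top_vector m) = 0 \<longleftrightarrow> u \<in> weyl_ideal m"
proof
  assume zero: "uea_act natural_word_act u (top_vector m) = 0"
  obtain \<rho> :: "(sl21, 'a) tensor \<Rightarrow> (sl21, 'a) tensor uea \<Rightarrow> (sl21, 'a) tensor uea" and w where "weyl_vector \<rho> w m" and ker: "\<And>u. uea_act \<rho> u w = 0 \<longleftrightarrow> u \<in> weyl_ideal m"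
    by (rule weyl_quotient_vector[where 'a = 'a and m = m]) blast
  interpret W: weyl_vector \<rho> w m by fact
  have "fact m *\<^sub>C uea_act \<rho> u w = 0" using W.uea_act_vector[of u] zero by (simp add: W.polar_simps)
  then show "u \<in> weyl_ideal m" by (simp add: ker)
next
  assume "u \<in> weyl_ideal m"
  then show "uea_act natural_word_act u (top_vector m) = 0"
    unfolding weyl_ideal_def left_ideal_span_def
  proof (rule clinear_vanish_on_span[OF uea_act_left_linear[OF nat_mod.D_representation], rotated])
    fix x assume "x \<in> {u * r |u r. r \<in> (weyl_relations m :: (sl21, 'a) tensor uea set)}"
    then obtain u r where x: "x = u * r" "r \<in> weyl_relations m" by blast
    show "uea_act natural_word_act x (top_vector m) = 0"
      by (simp add: x(1) uea_act(3)[OF nat_mod.D_representation] top_vector_relations[OF x(2)]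
          clinear_0[OF uea_act(6)[OF nat_mod.D_representation]])
  qed
qed

text \<open>An element \<open>y\<close> reached from the top vector satisfies
  \<open>m! y = symmetrizer m y\<close>, hence is itself a symmetrization; the reverse inclusion is
  \<open>polar_in_submodule\<close>.\<close>

lemma range_top_vector: "range (\<lambda>u. uea_act natural_word_act u (top_vector m)) = symmetrized_power m"
proof (intro equalityI subsetI)
  fix y assume "y \<in> range (\<lambda>u. uea_act natural_word_act u (top_vector m))"
  then obtain u where y: "y = uea_act natural_word_act u (top_vector m)" by blast
  have "uea_act natural_word_act u (top_vector m) \<in> tensor_power m"
    by (rule nat_mod.uea_act_tensor_power) (simp add: tensor_incl_power tensor_word_in_power)
  then have "fact m *\<^sub>C y = symmetrizer m y"
    using top.uea_act_vector[of m u] by (simp add: y top_polar)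
  then have "y = symmetrizer m (inverse (fact m) *\<^sub>C y)"
    by (simp add: clinear_scale[OF symmetrizer_linear] scaleC_scaleC flip: \<open>fact m *\<^sub>C y = symmetrizer m y\<close>)
  moreover have "inverse (fact m) *\<^sub>C y \<in> tensor_power m"
    using \<open>uea_act _ u _ \<in> tensor_power m\<close> y by (simp add: cvec.subspace_scale[OF subspace_tensor_power])
  ultimately show "y \<in> symmetrized_power m" unfolding symmetrized_power_image by blast
next
  fix y :: "(natural_module, 'a) tensor tensor_algebra" assume "y \<in> symmetrized_power m"
  then obtain t where "t \<in> tensor_power m" "y = symmetrizer m t" unfolding symmetrized_power_image by blast
  then show "y \<in> range (\<lambda>u. uea_act natural_word_act u (top_vector m))"
    using top.polar_in_submodule[of m t] by (auto simp: top_polar)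
qed

section \<open>Sums over submultisets\<close>

definition mfact :: "'a multiset \<Rightarrow> complex" where
  "mfact \<psi> = (\<Prod>a\<in>set_mset \<psi>. fact (count \<psi> a))"

lemma mfact_nonzero [simp]: "mfact \<psi> \<noteq> 0"
  by (simp add: mfact_def)

lemma mfact_empty [simp]: "mfact {#} = 1"
  by (simp add: mfact_def)

lemma multinomial_alt: "multinomial \<psi> = fact (size \<psi>) / mfact \<psi>"
  by (simp add: multinomial_def mfact_def)

lemma mfact_superset: "finite S \<Longrightarrow> set_mset \<psi> \<subseteq> S \<Longrightarrow> mfact \<psi> = (\<Prod>a\<in>S. fact (count \<psi> a))"
  unfolding mfact_def by (rule prod.mono_neutral_left) (auto simp: not_in_iff)

lemma mfact_add: "mfact (add_mset a \<psi>) = of_nat (Suc (count \<psi> a)) * mfact \<psi>"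
proof -
  let ?S = "set_mset (add_mset a \<psi>)"
  have "mfact (add_mset a \<psi>) = fact (count (add_mset a \<psi>) a) * (\<Prod>b\<in>?S - {a}. fact (count (add_mset a \<psi>) b))"
    unfolding mfact_superset[OF finite_set_mset order_refl] by (rule prod.remove) auto
  also have "(\<Prod>b\<in>?S - {a}. fact (count (add_mset a \<psi>) b)) = (\<Prod>b\<in>?S - {a}. fact (count \<psi> b) :: complex)"
    by (rule prod.cong) auto
  also have "fact (count (add_mset a \<psi>) a) * (\<Prod>b\<in>?S - {a}. fact (count \<psi> b)) =
      of_nat (Suc (count \<psi> a)) * (fact (count \<psi> a) * (\<Prod>b\<in>?S - {a}. fact (count \<psi> b) :: complex))"
    by simp
  also have "fact (count \<psi> a) * (\<Prod>b\<in>?S - {a}. fact (count \<psi> b)) = (\<Prod>b\<in>?S. fact (count \<psi> b) :: complex)"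
    by (rule prod.remove[symmetric]) auto
  also have "\<dots> = mfact \<psi>" by (rule mfact_superset[symmetric]) auto
  finally show ?thesis .
qed

lemma mfact_remove: "a \<in># \<psi> \<Longrightarrow> 1 / mfact (\<psi> - {#a#}) = of_nat (count \<psi> a) / mfact \<psi>"
  using mfact_add[of a "\<psi> - {#a#}"] by (simp add: Suc_diff_1 del: of_nat_Suc)

lemma sum_mfact_remove:
  "(\<Sum>a\<in>set_mset \<psi>. 1 / mfact (\<psi> - {#a#})) = of_nat (size \<psi>) / mfact \<psi>"
  by (simp add: mfact_remove size_multiset_overloaded_eq flip: sum_divide_distrib)

text \<open>The arrangements of \<open>\<psi>\<close> are sorted by their first letter.\<close>

lemma multinomial_pascal:
  assumes "\<psi> \<noteq> {#}"
  shows "(\<Sum>a\<in>set_mset \<psi>. multinomial (\<psi> - {#a#})) = multinomial \<psi>"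
proof -
  have "(\<Sum>a\<in>set_mset \<psi>. multinomial (\<psi> - {#a#})) = (\<Sum>a\<in>set_mset \<psi>. fact (size \<psi> - 1) * (1 / mfact (\<psi> - {#a#})))"
    by (rule sum.cong) (simp_all add: multinomial_alt size_Diff_singleton)
  also have "\<dots> = fact (size \<psi> - 1) * (of_nat (size \<psi>) / mfact \<psi>)"
    by (simp only: sum_mfact_remove flip: sum_distrib_left)
  also have "\<dots> = multinomial \<psi>"
    using assms by (cases "size \<psi>") (simp_all add: multinomial_alt)
  finally show ?thesis .
qed

definition msum :: "('a \<Rightarrow> 'm::complex_vector) \<Rightarrow> 'a multiset \<Rightarrow> 'm" where
  "msum g X = (\<Sum>a\<in>set_mset X. of_nat (count X a) *\<^sub>C g a)"

lemma msum_empty [simp]: "msum g {#} = 0"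
  by (simp add: msum_def)

lemma msum_superset: "finite S \<Longrightarrow> set_mset X \<subseteq> S \<Longrightarrow> msum g X = (\<Sum>a\<in>S. of_nat (count X a) *\<^sub>C g a)"
  unfolding msum_def by (rule sum.mono_neutral_left) (auto simp: not_in_iff)

lemma msum_add: "msum g (add_mset a X) = g a + msum g X"
proof -
  let ?S = "set_mset (add_mset a X)"
  have "msum g (add_mset a X) = (\<Sum>b\<in>?S. of_nat (count X b) *\<^sub>C g b + (if b = a then g b else 0))"
    unfolding msum_def by (rule sum.cong) (auto simp: scaleC_add_left)
  also have "\<dots> = (\<Sum>b\<in>?S. of_nat (count X b) *\<^sub>C g b) + g a"
    using sum.delta[of ?S a g] by (simp add: sum.distrib del: set_mset_add_mset_insert) simp
  also have "(\<Sum>b\<in>?S. of_nat (count X b) *\<^sub>C g b) = msum g X"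
    by (rule msum_superset[symmetric]) auto
  finally show ?thesis by (simp add: add.commute)
qed

lemma sum_nth_msum: "(\<Sum>i<length xs. g (xs ! i)) = msum g (mset xs)"
  by (induction xs) (simp_all add: sum.lessThan_Suc_shift msum_add del: sum.lessThan_Suc)

lemma msum_const: "msum (\<lambda>_. x) X = of_nat (size X) *\<^sub>C x"
  by (induction X) (simp_all add: msum_add scaleC_add_left)

lemma msum_cong: "(\<And>a. a \<in># X \<Longrightarrow> f a = g a) \<Longrightarrow> msum f X = msum g X"
  by (simp add: msum_def)

text \<open>The terms in \<open>g (add_mset a \<psi>)\<close> are regrouped by \<open>add_mset a \<psi>\<close>; by the Pascal rule they then cancel
  all terms in \<open>g \<psi>\<close> except the one for the empty multiset.\<close>

lemma multinomial_telescope: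
  fixes g :: "'a multiset \<Rightarrow> 'm::complex_vector"
  shows "(\<Sum>\<psi>\<in>{\<psi>. \<psi> \<subseteq># \<theta>}. ((-1) ^ size \<psi> * multinomial \<psi> / mfact (\<theta> - \<psi>)) *\<^sub>C
      (g \<psi> + msum (\<lambda>a. g (add_mset a \<psi>)) (\<theta> - \<psi>))) = (1 / mfact \<theta>) *\<^sub>C g {#}"
proof -
  let ?S = "{\<psi>. \<psi> \<subseteq># \<theta>}"
  define c where "c \<psi> = (-1) ^ size \<psi> * multinomial \<psi> / mfact (\<theta> - \<psi>)" for \<psi>
  have fin: "finite ?S" by (rule finite_submultisets)
  have "(\<Sum>\<psi>\<in>?S. c \<psi> *\<^sub>C msum (\<lambda>a. g (add_mset a \<psi>)) (\<theta> - \<psi>)) =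
      (\<Sum>\<psi>\<in>?S. \<Sum>a\<in>set_mset (\<theta> - \<psi>). (c \<psi> * of_nat (count (\<theta> - \<psi>) a)) *\<^sub>C g (add_mset a \<psi>))"
    by (simp only: msum_def cvec.scale_sum_right scaleC_scaleC)
  also have "\<dots> = (\<Sum>(\<psi>, a)\<in>Sigma ?S (\<lambda>\<psi>. set_mset (\<theta> - \<psi>)). (c \<psi> * of_nat (count (\<theta> - \<psi>) a)) *\<^sub>C g (add_mset a \<psi>))"
    by (rule sum.Sigma) (simp_all add: fin)
  also have "\<dots> = (\<Sum>(\<psi>, a)\<in>Sigma (?S - {{#}}) set_mset.
      ((-1) ^ (size \<psi> - 1) * multinomial (\<psi> - {#a#}) / mfact (\<theta> - \<psi>)) *\<^sub>C g \<psi>)"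
  proof (rule sum.reindex_bij_witness[of _ "\<lambda>(\<psi>, a). (\<psi> - {#a#}, a)" "\<lambda>(\<psi>, a). (add_mset a \<psi>, a)"])
    fix x assume "x \<in> Sigma ?S (\<lambda>\<psi>. set_mset (\<theta> - \<psi>))"
    then obtain \<psi> a where x: "x = (\<psi>, a)" "\<psi> \<subseteq># \<theta>" "a \<in># \<theta> - \<psi>" by blast
    have sub: "add_mset a \<psi> \<subseteq># \<theta>"
    proof (rule mset_subset_eqI)
      show "count (add_mset a \<psi>) b \<le> count \<theta> b" for b
        using mset_subset_eq_count[OF x(2), of b] x(3) by (auto simp: in_diff_count Suc_le_eq)
    qed
    show "(case case x of (\<psi>, a) \<Rightarrow> (add_mset a \<psi>, a) of (\<psi>, a) \<Rightarrow> (\<psi> - {#a#}, a)) = x" by (simp add: x)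
    show "(case x of (\<psi>, a) \<Rightarrow> (add_mset a \<psi>, a)) \<in> Sigma (?S - {{#}}) set_mset" using sub by (simp add: x)
    have "\<theta> - add_mset a \<psi> = \<theta> - \<psi> - {#a#}" by simp
    then have "of_nat (count (\<theta> - \<psi>) a) / mfact (\<theta> - \<psi>) = 1 / mfact (\<theta> - add_mset a \<psi>)"
      using mfact_remove[OF x(3)] by simp
    then have "c \<psi> * of_nat (count (\<theta> - \<psi>) a) = (-1) ^ size \<psi> * multinomial \<psi> / mfact (\<theta> - add_mset a \<psi>)"
      by (simp add: c_def divide_inverse mult.assoc) (simp add: mult.commute)
    then show "(case case x of (\<psi>, a) \<Rightarrow> (add_mset a \<psi>, a) of (\<psi>, a) \<Rightarrow>
        ((-1) ^ (size \<psi> - 1) * multinomial (\<psi> - {#a#}) / mfact (\<theta> - \<psi>)) *\<^sub>C g \<psi>) =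
        (case x of (\<psi>, a) \<Rightarrow> (c \<psi> * of_nat (count (\<theta> - \<psi>) a)) *\<^sub>C g (add_mset a \<psi>))"
      by (simp add: x)
  next
    fix y assume "y \<in> Sigma (?S - {{#}}) set_mset"
    then obtain \<psi> a where y: "y = (\<psi>, a)" "\<psi> \<subseteq># \<theta>" "a \<in># \<psi>" by blast
    have "count \<psi> a > 0" using y(3) by simp
    then have "count \<psi> a - 1 < count \<theta> a" using mset_subset_eq_count[OF y(2), of a] by linarith
    then have "a \<in># \<theta> - (\<psi> - {#a#})" by (simp add: in_diff_count)
    moreover have "\<psi> - {#a#} \<subseteq># \<theta>" using y(2) by (meson diff_subset_eq_self subset_mset.order_trans)
    ultimately show "(case y of (\<psi>, a) \<Rightarrow> (\<psi> - {#a#}, a)) \<in> Sigma ?S (\<lambda>\<psi>. set_mset (\<theta> - \<psi>))" by (simp add: y)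
    show "(case case y of (\<psi>, a) \<Rightarrow> (\<psi> - {#a#}, a) of (\<psi>, a) \<Rightarrow> (add_mset a \<psi>, a)) = y" using y by simp
  qed
  also have "\<dots> = (\<Sum>\<psi>\<in>?S - {{#}}. \<Sum>a\<in>set_mset \<psi>.
      ((-1) ^ (size \<psi> - 1) * multinomial (\<psi> - {#a#}) / mfact (\<theta> - \<psi>)) *\<^sub>C g \<psi>)"
    by (rule sum.Sigma[symmetric]) (simp_all add: fin)
  also have "\<dots> = (\<Sum>\<psi>\<in>?S - {{#}}. - (c \<psi> *\<^sub>C g \<psi>))"
  proof (rule sum.cong[OF refl])
    fix \<psi> assume "\<psi> \<in> ?S - {{#}}"
    then have ne: "\<psi> \<noteq> {#}" by simp
    have sgn: "(-1) ^ (size \<psi> - 1) = - ((-1) ^ size \<psi> :: complex)"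
      using ne by (cases "size \<psi>") simp_all
    have "(\<Sum>a\<in>set_mset \<psi>. ((-1) ^ (size \<psi> - 1) * multinomial (\<psi> - {#a#}) / mfact (\<theta> - \<psi>)) *\<^sub>C g \<psi>) =
        ((-1) ^ (size \<psi> - 1) * (\<Sum>a\<in>set_mset \<psi>. multinomial (\<psi> - {#a#})) / mfact (\<theta> - \<psi>)) *\<^sub>C g \<psi>"
      by (simp only: cvec.scale_sum_left sum_distrib_left sum_divide_distrib)
    also have "\<dots> = - (c \<psi> *\<^sub>C g \<psi>)"
      by (simp add: multinomial_pascal[OF ne] sgn[unfolded One_nat_def] c_def)
    finally show "(\<Sum>a\<in>set_mset \<psi>. ((-1) ^ (size \<psi> - 1) * multinomial (\<psi> - {#a#}) / mfact (\<theta> - \<psi>)) *\<^sub>C g \<psi>) =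
        - (c \<psi> *\<^sub>C g \<psi>)" .
  qed
  finally have second: "(\<Sum>\<psi>\<in>?S. c \<psi> *\<^sub>C msum (\<lambda>a. g (add_mset a \<psi>)) (\<theta> - \<psi>)) =
      - (\<Sum>\<psi>\<in>?S - {{#}}. c \<psi> *\<^sub>C g \<psi>)"
    by (simp add: sum_negf)
  have "(\<Sum>\<psi>\<in>?S. c \<psi> *\<^sub>C g \<psi>) = c {#} *\<^sub>C g {#} + (\<Sum>\<psi>\<in>?S - {{#}}. c \<psi> *\<^sub>C g \<psi>)"
    by (rule sum.remove[OF fin]) simp
  then show ?thesis
    using second by (simp add: scaleC_add_right sum.distrib flip: c_def) (simp add: c_def multinomial_alt)
qed

section \<open>The action of the elements p\<close>

lemma supersymmetric_move_even:
  assumes Q: "supersymmetric Q" and x: "homogeneous False x" and ys: "\<And>y. y \<in> set ys \<Longrightarrow> homogeneous False y"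
  shows "Q (tensor_word us * (tensor_word ys * (tensor_incl x * t))) = Q (tensor_word us * (tensor_incl x * (tensor_word ys * t)))"
  using ys
proof (induction ys arbitrary: us)
  case (Cons y ys)
  have "Q (tensor_word (us @ [y]) * (tensor_word ys * (tensor_incl x * t))) =
      Q (tensor_word (us @ [y]) * (tensor_incl x * (tensor_word ys * t)))"
    using Cons.prems by (intro Cons.IH) simp
  moreover have "Q (tensor_word us * (tensor_incl y * (tensor_incl x * (tensor_word ys * t)))) =
      Q (tensor_word us * (tensor_incl x * (tensor_incl y * (tensor_word ys * t))))"
    using supersymmetric_swap[OF Q Cons.prems[of y] x] by simp
  ultimately show ?case
    by (simp add: tensor_word_append tensor_word_Cons mult.assoc)
qed simp

lemma supersymmetric_even_perm:
  assumes Q: "supersymmetric Q" and xs: "\<And>x. x \<in> set xs \<Longrightarrow> homogeneous False x" and eq: "mset xs = mset ys"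
  shows "Q (tensor_word us * (tensor_word xs * t)) = Q (tensor_word us * (tensor_word ys * t))"
  using xs eq
proof (induction xs arbitrary: us ys)
  case (Cons x xs)
  then have "x \<in> set ys" by (metis list.set_intros(1) mset_eq_setD)
  then obtain as bs where ys: "ys = as @ x # bs" by (meson split_list)
  have evens: "homogeneous False y" if "y \<in> set as" for y
    using that Cons.prems ys mset_eq_setD[OF Cons.prems(2)] by auto
  have "Q (tensor_word (us @ [x]) * (tensor_word xs * t)) = Q (tensor_word (us @ [x]) * (tensor_word (as @ bs) * t))"
    using Cons.prems ys by (intro Cons.IH) auto
  then show ?case
    using supersymmetric_move_even[OF Q Cons.prems(1)[of x] evens, where us = us and t = "tensor_word bs * t"]
    by (simp add: ys tensor_word_append tensor_word_Cons mult.assoc)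
qed simp

context supermodule
begin

text \<open>With \<open>z\<close> and the letters even, the letter on which \<open>z\<close> has
  acted can be brought to the front without a sign.\<close>

lemma D_even_word:
  assumes Q: "supersymmetric Q" and z: "homogeneous False z" and xs: "\<And>x. x \<in> set xs \<Longrightarrow> homogeneous False x"
  shows "Q (tensor_word us * D z (tensor_word xs * t)) =
    (\<Sum>i<length xs. Q (tensor_word us * (tensor_incl (\<delta> z (xs ! i)) * (tensor_word (take i xs @ drop (Suc i) xs) * t))))
    + Q (tensor_word us * (tensor_word xs * D z t))"
  using xs
proof (induction xs arbitrary: us)
  case (Cons x xs)
  have x: "homogeneous False x" using Cons.prems by simp
  have swap: "Q (tensor_word us * (tensor_incl x * (tensor_incl (\<delta> z (xs ! i)) * s))) =
      Q (tensor_word us * (tensor_incl (\<delta> z (xs ! i)) * (tensor_incl x * s)))" if "i < length xs" for i s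
    using supersymmetric_swap[OF Q x graded[OF z Cons.prems[of "xs ! i"]]] that by simp
  have "Q (tensor_word us * D z (tensor_word (x # xs) * t)) =
      Q (tensor_word us * (tensor_incl (\<delta> z x) * (tensor_word xs * t))) + Q (tensor_word (us @ [x]) * D z (tensor_word xs * t))"
    by (simp add: tensor_word_Cons mult.assoc D_Cons_even[OF x] distrib_left clinear_add[OF supersymmetric_linear[OF Q]]
        tensor_word_append)
  also have "Q (tensor_word (us @ [x]) * D z (tensor_word xs * t)) =
    (\<Sum>i<length xs. Q (tensor_word us * (tensor_incl (\<delta> z (xs ! i)) * (tensor_incl x * (tensor_word (take i xs @ drop (Suc i) xs) * t)))))
    + Q (tensor_word (us @ [x]) * (tensor_word xs * D z t))"
    using Cons.prems by (subst Cons.IH) (simp_all add: tensor_word_append tensor_word_Cons mult.assoc swap)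
  finally show ?case
    by (simp add: sum.lessThan_Suc_shift tensor_word_append tensor_word_Cons mult.assoc add.assoc del: sum.lessThan_Suc)
qed simp

lemma D_word_killed:
  assumes "homogeneous p z" "\<And>x. x \<in> set xs \<Longrightarrow> \<delta> z x = 0" "D z t = 0"
  shows "D z (tensor_word xs * t) = 0"
  using assms(2)
  by (induction xs) (simp_all add: assms(3) tensor_word_Cons D_Cons[OF assms(1)] mult.assoc clinear_0[OF tensor_incl_linear])

end

text \<open>An arbitrary arrangement; it is used for even letters, whose order does not affect
  supersymmetric maps.\<close>

definition list_of :: "'a multiset \<Rightarrow> 'a list" where
  "list_of X = (SOME xs. mset xs = X)"

lemma mset_list_of [simp]: "mset (list_of X) = X"
  unfolding list_of_def by (rule someI_ex) (rule ex_mset)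

lemma length_list_of [simp]: "length (list_of X) = size X"
  by (metis mset_list_of size_mset)

lemma set_list_of [simp]: "set (list_of X) = set_mset X"
  by (metis mset_list_of set_mset_mset)

lemma list_of_empty [simp]: "list_of {#} = []"
  using mset_list_of[of "{#}"] by (simp del: mset_list_of)

lemma even_letters:
  "x \<in> set (map ((\<otimes>) v1) as) \<Longrightarrow> homogeneous False x" "x \<in> set (map ((\<otimes>) v2) as) \<Longrightarrow> homogeneous False x"
  by auto

definition standard_word :: "'a::complex_comm_algebra list \<Rightarrow> 'a list \<Rightarrow> 'a list \<Rightarrow> (natural_module, 'a) tensor tensor_algebra" where
  "standard_word as bs cs = tensor_word (map ((\<otimes>) v1) as) * (tensor_word (map ((\<otimes>) v2) bs) * tensor_word (map ((\<otimes>) v3) cs))"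

lemma supersymmetric_standard_word:
  assumes Q: "supersymmetric Q" and "mset as = mset as'" "mset bs = mset bs'"
  shows "Q (standard_word as bs cs) = Q (standard_word as' bs' cs)"
proof -
  have "Q (standard_word as bs cs) = Q (standard_word as' bs cs)"
    using supersymmetric_even_perm[OF Q even_letters(1)[of _ as], where xs = "map ((\<otimes>) v1) as" and ys = "map ((\<otimes>) v1) as'" and us = "[]"] assms(2)
    by (simp add: standard_word_def)
  also have "\<dots> = Q (standard_word as' bs' cs)"
    using supersymmetric_even_perm[OF Q even_letters(2)[of _ bs], where xs = "map ((\<otimes>) v2) bs" and ys = "map ((\<otimes>) v2) bs'" and us = "map ((\<otimes>) v1) as'"] assms(3)
    by (simp add: standard_word_def)
  finally show ?thesis .
qed

text \<open>Handles exponents \<open>k = n - s\<close>, which have the parity of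
  \<open>n + s\<close>.\<close>

lemma sign_shift:
  assumes "n + s = k + 2 * s"
  shows "(-1) ^ k = (-1) ^ n * (-1 :: complex) ^ s"
proof -
  have "(-1 :: complex) ^ (n + s) = (-1) ^ (k + 2 * s)" by (simp only: assms)
  then show ?thesis by (simp add: power_add power_mult)
qed

section \<open>The action of the elements p on the generator\<close>

context weyl_vector
begin

text \<open>The odd part \<open>\<xi>\<close> stays a list because reordering odd letters changes
  the sign.\<close>

definition monomial :: "'a multiset \<Rightarrow> 'a multiset \<Rightarrow> 'a list \<Rightarrow> 'm" where
  "monomial \<theta> \<phi> \<xi> = polar (standard_word (list_of \<theta>) (list_of \<phi>) \<xi>)"

lemma monomial_eq: "polar (standard_word as bs cs) = monomial (mset as) (mset bs) cs"
  unfolding monomial_def by (rule supersymmetric_standard_word[OF polar_supersymmetric]) simp_all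

text \<open>Only the \<open>v_1\<close> letters are affected. The alternative \<open>bs = []\<close>
  serves \<open>h_1\<close>, which does not kill \<open>v_2\<close> but is applied in
  \<open>p1\<close> before any \<open>v_2\<close> letter is created.\<close>

lemma polar_lowering:
  assumes z: "homogeneous False z" and kill: "bs = [] \<or> natural_act z v2 = 0" "natural_act z v3 = 0"
  shows "polar (natural_word_act (z \<otimes> a) (standard_word as bs cs)) =
    (\<Sum>i<length as. polar (tensor_incl (natural_act z v1 \<otimes> (a * as ! i)) * standard_word (take i as @ drop (Suc i) as) bs cs))"
proof -
  have "natural_word_act (z \<otimes> a) (tensor_word (map ((\<otimes>) v3) cs) * 1) = 0"
    by (rule nat_mod.D_word_killed[OF homogeneous_tensor[OF z]]) (auto simp: map_natural_act_pure kill)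
  then have 3: "natural_word_act (z \<otimes> a) (tensor_word (map ((\<otimes>) v3) cs)) = 0" by simp
  have "natural_word_act (z \<otimes> a) (tensor_word (map ((\<otimes>) v2) bs) * tensor_word (map ((\<otimes>) v3) cs)) = 0"
    by (rule nat_mod.D_word_killed[OF homogeneous_tensor[OF z] _ 3]) (use kill(1) in \<open>auto simp: map_natural_act_pure\<close>)
  then show ?thesis
    using nat_mod.D_even_word[OF polar_supersymmetric homogeneous_tensor[OF z, of a] even_letters(1)[of _ as], where xs = "map ((\<otimes>) v1) as" and us = "[]"
        and t = "tensor_word (map ((\<otimes>) v2) bs) * tensor_word (map ((\<otimes>) v3) cs)"]
    by (simp add: standard_word_def map_natural_act_pure polar_simps take_map drop_map)
qed

lemma mset_take_drop: "i < length xs \<Longrightarrow> mset (take i xs @ drop (Suc i) xs) = mset xs - {#xs ! i#}"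
  using arg_cong[OF id_take_nth_drop[of i xs], of mset] by simp

text \<open>\<open>act_polar\<close> inserts the new letter \<open>v_1 \<otimes> a\<close>, and the
  Leibniz rule multiplies the present \<open>v_1\<close> letters by \<open>a\<close> in turn. In the
  same way, \<open>x_{-1} \<otimes> a\<close> inserts \<open>v_2 \<otimes> a\<close> or lowers one
  of the \<open>v_1\<close> letters.\<close>

lemma h1_monomial:
  "\<rho> (sl_h1 \<otimes> a) (monomial \<theta> {#} \<xi>) =
    monomial (add_mset a \<theta>) {#} \<xi> + msum (\<lambda>b. monomial (add_mset (a * b) (\<theta> - {#b#})) {#} \<xi>) \<theta>"
proof -
  define as where "as = list_of \<theta>"
  have cons: "tensor_incl (v1 \<otimes> b) * standard_word bs [] \<xi> = standard_word (b # bs) [] \<xi>" for b bs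
    by (simp add: standard_word_def tensor_word_Cons mult.assoc)
  have "\<rho> (sl_h1 \<otimes> a) (polar (standard_word as [] \<xi>)) = polar (standard_word (a # as) [] \<xi>) +
      (\<Sum>i<length as. polar (standard_word (a * as ! i # take i as @ drop (Suc i) as) [] \<xi>))"
    by (simp add: act_polar map_natural_act_pure natural_act_values polar_lowering[OF sl_parity(1)] cons)
  also have "(\<Sum>i<length as. polar (standard_word (a * as ! i # take i as @ drop (Suc i) as) [] \<xi>)) =
      (\<Sum>i<length as. monomial (add_mset (a * as ! i) (\<theta> - {#as ! i#})) {#} \<xi>)"
    by (rule sum.cong[OF refl]) (simp add: monomial_eq mset_take_drop[unfolded mset_append] as_def)
  also have "\<dots> = msum (\<lambda>b. monomial (add_mset (a * b) (\<theta> - {#b#})) {#} \<xi>) \<theta>"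
    by (subst sum_nth_msum) (simp add: as_def)
  finally show ?thesis by (simp add: monomial_eq as_def)
qed

lemma y1_monomial:
  "\<rho> (sl_y1 \<otimes> a) (monomial \<theta> \<phi> \<xi>) =
    monomial \<theta> (add_mset a \<phi>) \<xi> + msum (\<lambda>b. monomial (\<theta> - {#b#}) (add_mset (a * b) \<phi>) \<xi>) \<theta>"
proof -
  define as where "as = list_of \<theta>"
  define bs where "bs = list_of \<phi>"
  have cons: "polar (tensor_incl (v2 \<otimes> b) * standard_word cs bs \<xi>) = polar (standard_word cs (b # bs) \<xi>)" for b cs
    using supersymmetric_move_even[OF polar_supersymmetric _ even_letters(1)[of _ cs], where ys = "map ((\<otimes>) v1) cs" and x = "v2 \<otimes> b" and us = "[]"]
    by (simp add: standard_word_def tensor_word_Cons mult.assoc)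
  have "\<rho> (sl_y1 \<otimes> a) (polar (standard_word as bs \<xi>)) = polar (standard_word as (a # bs) \<xi>) +
      (\<Sum>i<length as. polar (standard_word (take i as @ drop (Suc i) as) (a * as ! i # bs) \<xi>))"
    by (simp add: act_polar map_natural_act_pure natural_act_values polar_lowering[OF sl_parity(2)] cons)
  also have "(\<Sum>i<length as. polar (standard_word (take i as @ drop (Suc i) as) (a * as ! i # bs) \<xi>)) =
      (\<Sum>i<length as. monomial (\<theta> - {#as ! i#}) (add_mset (a * as ! i) \<phi>) \<xi>)"
    by (rule sum.cong[OF refl]) (simp add: monomial_eq mset_take_drop[unfolded mset_append] as_def bs_def)
  also have "\<dots> = msum (\<lambda>b. monomial (\<theta> - {#b#}) (add_mset (a * b) \<phi>) \<xi>) \<theta>"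
    by (subst sum_nth_msum) (simp add: as_def)
  finally show ?thesis by (simp add: monomial_eq as_def bs_def)
qed

text \<open>Since \<open>x_{-3}\<close> kills \<open>v_3\<close>, the recursion of
  \<open>polar\<close> has no correction term here.\<close>

lemma X_minus3_monomial: "uea_act \<rho> (X_minus3 \<xi>) w = monomial {#} {#} \<xi>"
proof (induction \<xi>)
  case Nil
  show ?case by (simp add: X_minus3_def monomial_def standard_word_def uea_act[OF representation])
next
  case (Cons c \<xi>)
  have "natural_word_act (sl_y3 \<otimes> c) (tensor_word (map ((\<otimes>) v3) \<xi>) * 1) = 0"
    by (rule nat_mod.D_word_killed[OF homogeneous_tensor[OF sl_parity(3)]]) (auto simp: map_natural_act_pure natural_act_values)
  then have "\<rho> (sl_y3 \<otimes> c) (monomial {#} {#} \<xi>) = monomial {#} {#} (c # \<xi>)"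
    using polar_Cons[of "v3 \<otimes> c" "tensor_word (map ((\<otimes>) v3) \<xi>)"]
    by (simp add: monomial_def standard_word_def tensor_word_Cons first_column_pure column_values polar_simps)
  then show ?case using Cons by (simp add: X_minus3_def uea_act[OF representation])
qed

lemma uea_act_sum: "uea_act \<rho> (\<Sum>i\<in>I. u i) v = (\<Sum>i\<in>I. uea_act \<rho> (u i) v)"
  by (rule clinear_sum[OF uea_act_left_linear[OF representation]])

text \<open>Let \<open>g \<psi>\<close> be the monomial in which the part \<open>\<psi>\<close> of
  \<open>\<theta>\<close> has been merged into a single letter. The actions of \<open>h_1\<close>
  and \<open>x_{-1}\<close> yield \<open>g \<psi>\<close> plus the terms with one more element
  merged, and the multinomial coefficients of \<open>p1\<close> are those for which such sums
  telescope to \<open>g {#}\<close>.\<close>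

lemma p1_monomial:
  "uea_act \<rho> (p1 \<phi> \<theta>) (monomial {#} {#} \<xi>) =
    ((-1) ^ (size \<phi> + size \<theta>) / (mfact \<phi> * mfact \<theta>)) *\<^sub>C monomial \<theta> \<phi> \<xi>"
proof (induction "size \<phi> + size \<theta>" arbitrary: \<phi> \<theta> rule: less_induct)
  case less
  let ?v = "monomial {#} {#} \<xi>" and ?S = "{\<psi>. \<psi> \<subseteq># \<theta>}"
  let ?sgn = "\<lambda>n. (-1) ^ n :: complex"
  consider (lower) "\<phi> \<noteq> {#}" | (cartan) "\<phi> = {#}" "\<theta> \<noteq> {#}" | (one) "\<phi> = {#}" "\<theta> = {#}" by blast
  then show ?case
  proof cases
    case one
    then show ?thesis by (simp add: p1.simps uea_act[OF representation])
  next
    case lower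
    have inner: "(\<Sum>\<psi>\<in>?S. uea_act \<rho> (multinomial \<psi> *\<^sub>C (uea_incl (sl_y1 \<otimes> (d * prod_mset \<psi>)) * p1 (\<phi> - {#d#}) (\<theta> - \<psi>))) ?v) =
        (?sgn (size \<phi> + size \<theta> - 1) / mfact \<theta> * (1 / mfact (\<phi> - {#d#}))) *\<^sub>C monomial \<theta> \<phi> \<xi>"
      if d: "d \<in># \<phi>" for d
    proof -
      define g where "g \<psi> = monomial (\<theta> - \<psi>) (add_mset (d * prod_mset \<psi>) (\<phi> - {#d#})) \<xi>" for \<psi>
      define k where "k = ?sgn (size \<phi> + size \<theta> - 1) * (1 / mfact (\<phi> - {#d#}))"
      have "uea_act \<rho> (multinomial \<psi> *\<^sub>C (uea_incl (sl_y1 \<otimes> (d * prod_mset \<psi>)) * p1 (\<phi> - {#d#}) (\<theta> - \<psi>))) ?v =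
          k *\<^sub>C ((?sgn (size \<psi>) * multinomial \<psi> / mfact (\<theta> - \<psi>)) *\<^sub>C (g \<psi> + msum (\<lambda>a. g (add_mset a \<psi>)) (\<theta> - \<psi>)))"
        if "\<psi> \<in> ?S" for \<psi>
      proof -
        have \<psi>: "\<psi> \<subseteq># \<theta>" using that by simp
        have size: "size (\<phi> - {#d#}) = size \<phi> - 1" "size (\<theta> - \<psi>) = size \<theta> - size \<psi>" "size \<psi> \<le> size \<theta>" "size \<phi> > 0"
          using d \<psi> lower by (simp_all add: size_Diff_singleton size_Diff_submset size_mset_mono nonempty_has_size[symmetric])
        have sgn: "?sgn (size \<phi> - 1 + (size \<theta> - size \<psi>)) = ?sgn (size \<phi> + size \<theta> - 1) * ?sgn (size \<psi>)"
        proof -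
          have "size \<phi> + size \<theta> - 1 + size \<psi> = (size \<phi> - 1 + (size \<theta> - size \<psi>)) + 2 * size \<psi>" using size by simp
          then show ?thesis by (rule sign_shift)
        qed
        have "uea_act \<rho> (p1 (\<phi> - {#d#}) (\<theta> - \<psi>)) ?v =
            (?sgn (size \<phi> - 1 + (size \<theta> - size \<psi>)) / (mfact (\<phi> - {#d#}) * mfact (\<theta> - \<psi>))) *\<^sub>C monomial (\<theta> - \<psi>) (\<phi> - {#d#}) \<xi>"
          using less[of "\<phi> - {#d#}" "\<theta> - \<psi>"] size by simp
        moreover have "\<rho> (sl_y1 \<otimes> (d * prod_mset \<psi>)) (monomial (\<theta> - \<psi>) (\<phi> - {#d#}) \<xi>) =
            g \<psi> + msum (\<lambda>a. g (add_mset a \<psi>)) (\<theta> - \<psi>)"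
          by (simp add: y1_monomial g_def mult.assoc mult.commute mult.left_commute)
        ultimately show ?thesis
          by (simp add: uea_act[OF representation] rho_simps scaleC_scaleC sgn[unfolded One_nat_def] k_def)
      qed
      then have "(\<Sum>\<psi>\<in>?S. uea_act \<rho> (multinomial \<psi> *\<^sub>C (uea_incl (sl_y1 \<otimes> (d * prod_mset \<psi>)) * p1 (\<phi> - {#d#}) (\<theta> - \<psi>))) ?v) =
          (\<Sum>\<psi>\<in>?S. k *\<^sub>C ((?sgn (size \<psi>) * multinomial \<psi> / mfact (\<theta> - \<psi>)) *\<^sub>C
            (g \<psi> + msum (\<lambda>a. g (add_mset a \<psi>)) (\<theta> - \<psi>))))"
        by (rule sum.cong[OF refl])
      also have "\<dots> = k *\<^sub>C ((1 / mfact \<theta>) *\<^sub>C g {#})"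
        by (simp only: multinomial_telescope flip: cvec.scale_sum_right)
      finally have "(\<Sum>\<psi>\<in>?S. uea_act \<rho> (multinomial \<psi> *\<^sub>C (uea_incl (sl_y1 \<otimes> (d * prod_mset \<psi>)) * p1 (\<phi> - {#d#}) (\<theta> - \<psi>))) ?v) =
          k *\<^sub>C ((1 / mfact \<theta>) *\<^sub>C g {#})" .
      \<comment> \<open>In \<open>g {#}\<close> the element \<open>d\<close> is put back into
        \<open>\<phi>\<close>, which gives \<open>monomial \<theta> \<phi> \<xi>\<close>.\<close>
      then show ?thesis using d by (simp add: g_def k_def scaleC_scaleC)
    qed
    have p1: "p1 \<phi> \<theta> = (- 1 / of_nat (size \<phi>)) *\<^sub>C (\<Sum>d\<in>set_mset \<phi>. \<Sum>\<psi>\<in>?S.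
        multinomial \<psi> *\<^sub>C (uea_incl (sl_y1 \<otimes> (d * prod_mset \<psi>)) * p1 (\<phi> - {#d#}) (\<theta> - \<psi>)))"
      by (subst p1.simps) (simp only: if_P[OF lower])
    have "uea_act \<rho> (p1 \<phi> \<theta>) ?v = (- 1 / of_nat (size \<phi>)) *\<^sub>C
        (\<Sum>d\<in>set_mset \<phi>. (?sgn (size \<phi> + size \<theta> - 1) / mfact \<theta> * (1 / mfact (\<phi> - {#d#}))) *\<^sub>C monomial \<theta> \<phi> \<xi>)"
      unfolding p1 uea_act(5)[OF representation] uea_act_sum
      by (intro arg_cong[where f = "scaleC _"] sum.cong refl inner[unfolded uea_act(5)[OF representation]])
    \<comment> \<open>Summing over \<open>d\<close> produces the factor \<open>size \<phi>\<close>,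
      which the prefactor of \<open>p1\<close> cancels.\<close>
    also have "\<dots> = (- 1 / of_nat (size \<phi>) * (?sgn (size \<phi> + size \<theta> - 1) / mfact \<theta> * (of_nat (size \<phi>) / mfact \<phi>))) *\<^sub>C monomial \<theta> \<phi> \<xi>"
      by (simp only: scaleC_scaleC sum_mfact_remove flip: cvec.scale_sum_left sum_distrib_left)
    also have "- 1 / of_nat (size \<phi>) * (?sgn (size \<phi> + size \<theta> - 1) / mfact \<theta> * (of_nat (size \<phi>) / mfact \<phi>)) =
        ?sgn (size \<phi> + size \<theta>) / (mfact \<phi> * mfact \<theta>)"
    proof -
      have "(of_nat (size \<phi>) :: complex) \<noteq> 0" using lower by simp
      moreover have "?sgn (size \<phi> + size \<theta>) = - ?sgn (size \<phi> + size \<theta> - 1)"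
        using lower by (cases "size \<phi>") simp_all
      ultimately show ?thesis by (simp add: mult.commute)
    qed
    finally show ?thesis .
  next
    case cartan
    define g where "g \<psi> = monomial (add_mset (prod_mset \<psi>) (\<theta> - \<psi>)) {#} \<xi>" for \<psi>
    define f where "f \<psi> = (?sgn (size \<psi>) * multinomial \<psi> / mfact (\<theta> - \<psi>)) *\<^sub>C
      (g \<psi> + msum (\<lambda>a. g (add_mset a \<psi>)) (\<theta> - \<psi>))" for \<psi>
    have summand: "uea_act \<rho> (multinomial \<psi> *\<^sub>C (uea_incl (sl_h1 \<otimes> prod_mset \<psi>) * p1 {#} (\<theta> - \<psi>))) ?v =
        ?sgn (size \<theta>) *\<^sub>C f \<psi>" if "\<psi> \<in> ?S - {{#}}" for \<psi>
    proof -
      have \<psi>: "\<psi> \<subseteq># \<theta>" "\<psi> \<noteq> {#}" using that by auto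
      have size: "size (\<theta> - \<psi>) = size \<theta> - size \<psi>" "size \<psi> \<le> size \<theta>" "size \<psi> > 0"
        using \<psi> by (simp_all add: size_Diff_submset size_mset_mono nonempty_has_size[symmetric])
      have sgn: "?sgn (size \<theta> - size \<psi>) = ?sgn (size \<theta>) * ?sgn (size \<psi>)"
      proof -
        have "size \<theta> + size \<psi> = (size \<theta> - size \<psi>) + 2 * size \<psi>" using size by simp
        then show ?thesis by (rule sign_shift)
      qed
      have "uea_act \<rho> (p1 {#} (\<theta> - \<psi>)) ?v =
          (?sgn (size \<theta> - size \<psi>) / mfact (\<theta> - \<psi>)) *\<^sub>C monomial (\<theta> - \<psi>) {#} \<xi>"
        using less[of "{#}" "\<theta> - \<psi>"] size cartan by simp
      moreover have "\<rho> (sl_h1 \<otimes> prod_mset \<psi>) (monomial (\<theta> - \<psi>) {#} \<xi>) =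
          g \<psi> + msum (\<lambda>a. g (add_mset a \<psi>)) (\<theta> - \<psi>)"
        by (simp add: h1_monomial g_def mult.commute)
      ultimately show ?thesis
        by (simp add: uea_act[OF representation] rho_simps scaleC_scaleC sgn f_def)
    qed
    \<comment> \<open>The recursion of \<open>p1\<close> omits the empty multiset, which the
      telescoping sum includes, so its term is computed separately. Here \<open>g {#}\<close>
      carries an additional letter \<open>v_1 \<otimes> 1\<close>, the empty product being
      1.\<close>
    have "f {#} = (1 / mfact \<theta>) *\<^sub>C (g {#} + msum (\<lambda>_. monomial \<theta> {#} \<xi>) \<theta>)"
    proof -
      have "msum (\<lambda>a. monomial (add_mset a (\<theta> - {#a#})) {#} \<xi>) \<theta> = msum (\<lambda>_. monomial \<theta> {#} \<xi>) \<theta>"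
        by (rule msum_cong) simp
      then show ?thesis by (simp add: f_def multinomial_alt g_def)
    qed
    then have f0: "f {#} = (1 / mfact \<theta>) *\<^sub>C g {#} + (of_nat (size \<theta>) / mfact \<theta>) *\<^sub>C monomial \<theta> {#} \<xi>"
      by (simp add: msum_const scaleC_add_right scaleC_scaleC)
    have "(\<Sum>\<psi>\<in>?S. f \<psi>) = f {#} + (\<Sum>\<psi>\<in>?S - {{#}}. f \<psi>)"
      by (rule sum.remove[OF finite_submultisets]) simp
    \<comment> \<open>\<open>g {#}\<close> has the same coefficient in the full sum and in the
      omitted term. It cancels, and with it the unwanted additional letter.\<close>
    then have rest: "(\<Sum>\<psi>\<in>?S - {{#}}. f \<psi>) = - ((of_nat (size \<theta>) / mfact \<theta>) *\<^sub>C monomial \<theta> {#} \<xi>)"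
      using multinomial_telescope[of \<theta> g] by (simp add: f0 flip: f_def) (simp add: eq_neg_iff_add_eq_0 add.commute)
    have p1: "p1 {#} \<theta> = (- 1 / of_nat (size \<theta>)) *\<^sub>C (\<Sum>\<psi>\<in>?S - {{#}}.
        multinomial \<psi> *\<^sub>C (uea_incl (sl_h1 \<otimes> prod_mset \<psi>) * p1 {#} (\<theta> - \<psi>)))"
      using cartan(2) by (subst p1.simps) (simp only: if_True if_False not_True_eq_False refl simp_thms)
    have "uea_act \<rho> (p1 {#} \<theta>) ?v = (- 1 / of_nat (size \<theta>)) *\<^sub>C (\<Sum>\<psi>\<in>?S - {{#}}. ?sgn (size \<theta>) *\<^sub>C f \<psi>)"
      unfolding p1 uea_act(5)[OF representation] uea_act_sum
      by (intro arg_cong[where f = "scaleC _"] sum.cong refl summand[unfolded uea_act(5)[OF representation]])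
    also have "\<dots> = (- 1 / of_nat (size \<theta>) * ?sgn (size \<theta>) * - (of_nat (size \<theta>) / mfact \<theta>)) *\<^sub>C monomial \<theta> {#} \<xi>"
      by (simp only: rest scaleC_scaleC cvec.scale_minus_left mult.assoc flip: cvec.scale_sum_right)
        (simp add: scaleC_scaleC)
    also have "- 1 / of_nat (size \<theta>) * ?sgn (size \<theta>) * - (of_nat (size \<theta>) / mfact \<theta>) = ?sgn (size \<theta>) / mfact \<theta>"
      using cartan by simp
    finally show ?thesis using cartan by simp
  qed
qed

lemma p_elem_monomial:
  "uea_act \<rho> (p_elem \<phi>\<^sub>1 \<phi>\<^sub>2 \<xi>) w =
    ((-1) ^ (size \<phi>\<^sub>2 + size \<phi>\<^sub>1) / (mfact \<phi>\<^sub>2 * mfact \<phi>\<^sub>1)) *\<^sub>C monomial \<phi>\<^sub>1 \<phi>\<^sub>2 \<xi>"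
  by (simp add: p_elem_def uea_act(3)[OF representation] X_minus3_monomial p1_monomial)

end

section \<open>Words in the basis letters\<close>

definition letter :: "3 \<times> 'a::complex_comm_algebra \<Rightarrow> (natural_module, 'a) tensor" where
  "letter l = Vec (axis (fst l) 1) \<otimes> snd l"

definition labels :: "'a list \<Rightarrow> 'a list \<Rightarrow> 'a list \<Rightarrow> (3 \<times> 'a) list" where
  "labels as bs cs = map (Pair 1) as @ map (Pair 2) bs @ map (Pair 3) cs"

lemma letter_homogeneous: "homogeneous (fst l = 3) (letter l)"
proof -
  have "homogeneous (k = 3) (Vec (axis k 1))" for k :: 3
    using exhaust_3[of k] v_parity by (auto simp: v1_def v2_def v3_def)
  then show ?thesis by (simp add: letter_def)
qed

lemma letter_values: "letter (1, a) = v1 \<otimes> a" "letter (2, a) = v2 \<otimes> a" "letter (3, a) = v3 \<otimes> a"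
  by (simp_all add: letter_def v1_def v2_def v3_def)

lemma standard_word_labels: "standard_word as bs cs = tensor_word (map letter (labels as bs cs))"
  by (simp add: standard_word_def labels_def tensor_word_append o_def letter_values)

lemma length_labels [simp]: "length (labels as bs cs) = length as + length bs + length cs"
  by (simp add: labels_def)

text \<open>The sign is left as an unspecified scalar \<open>c\<close>, since this serves only to
  show that certain words span.\<close>

lemma supersymmetric_move:
  assumes Q: "supersymmetric Q" and x: "homogeneous p x" and ys: "\<And>y. y \<in> set ys \<Longrightarrow> \<exists>q. homogeneous q y"
  shows "\<exists>c. Q (tensor_word us * (tensor_incl x * (tensor_word ys * t))) = c *\<^sub>C Q (tensor_word us * (tensor_word ys * (tensor_incl x * t)))"
  using ys
proof (induction ys arbitrary: us)
  case Nil
  show ?case by (rule exI[of _ 1]) simp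
next
  case (Cons y ys)
  then obtain q where y: "homogeneous q y" by auto
  obtain c where c: "Q (tensor_word (us @ [y]) * (tensor_incl x * (tensor_word ys * t))) =
      c *\<^sub>C Q (tensor_word (us @ [y]) * (tensor_word ys * (tensor_incl x * t)))"
    using Cons.IH[of "us @ [y]"] Cons.prems by auto
  have "Q (tensor_word us * (tensor_incl x * (tensor_word (y # ys) * t))) =
      (koszul p q * c) *\<^sub>C Q (tensor_word us * (tensor_word (y # ys) * (tensor_incl x * t)))"
    using c supersymmetric_swap[OF Q x y, of us "tensor_word ys * t"]
    by (simp add: tensor_word_append tensor_word_Cons mult.assoc scaleC_scaleC)
  then show ?case by blast
qed

lemma supersymmetric_perm:
  assumes Q: "supersymmetric Q" and xs: "\<And>x. x \<in> set xs \<Longrightarrow> \<exists>p. homogeneous p x" and eq: "mset xs = mset ys"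
  shows "\<exists>c. Q (tensor_word us * tensor_word xs) = c *\<^sub>C Q (tensor_word us * tensor_word ys)"
  using xs eq
proof (induction xs arbitrary: us ys)
  case Nil
  then show ?case by (intro exI[of _ 1]) simp
next
  case (Cons x xs)
  then have "x \<in> set ys" by (metis list.set_intros(1) mset_eq_setD)
  then obtain as bs where ys: "ys = as @ x # bs" by (meson split_list)
  obtain p where x: "homogeneous p x" using Cons.prems(1) by auto
  have hom: "\<exists>q. homogeneous q y" if "y \<in> set as" for y
    using that Cons.prems ys mset_eq_setD[OF Cons.prems(2)] by auto
  obtain c where c: "Q (tensor_word (us @ [x]) * tensor_word xs) = c *\<^sub>C Q (tensor_word (us @ [x]) * tensor_word (as @ bs))"
    using Cons.IH[of "as @ bs" "us @ [x]"] Cons.prems ys by auto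
  obtain d where d: "Q (tensor_word us * (tensor_incl x * (tensor_word as * tensor_word bs))) =
      d *\<^sub>C Q (tensor_word us * (tensor_word as * (tensor_incl x * tensor_word bs)))"
    using supersymmetric_move[OF Q x hom] by blast
  have "Q (tensor_word us * tensor_word (x # xs)) = (c * d) *\<^sub>C Q (tensor_word us * tensor_word ys)"
    using c d by (simp add: ys tensor_word_append tensor_word_Cons mult.assoc scaleC_scaleC)
  then show ?case by blast
qed

lemma supersymmetric_repeated_odd:
  assumes Q: "supersymmetric Q" and x: "homogeneous True x"
  shows "Q (tensor_word us * (tensor_incl x * (tensor_incl x * t))) = 0"
proof -
  let ?q = "Q (tensor_word us * (tensor_incl x * (tensor_incl x * t)))"
  have "?q = - ?q" using supersymmetric_swap[OF Q x x, of us t] by (simp add: koszul_def)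
  then have "?q + ?q = 0" by (simp only: eq_neg_iff_add_eq_0)
  then have "2 *\<^sub>C ?q = 0" using scaleC_add_left[of 1 1 ?q] by simp
  then show ?thesis by simp
qed

lemma mset_labels:
  "set ls \<subseteq> UNIV \<times> B \<Longrightarrow> \<exists>as bs cs. mset ls = mset (labels as bs cs) \<and> set as \<subseteq> B \<and> set bs \<subseteq> B \<and> set cs \<subseteq> B"
proof (induction ls)
  case Nil
  show ?case by (rule exI[of _ "[]"])+ (simp add: labels_def)
next
  case (Cons l ls)
  obtain k b where l: "l = (k, b)" "b \<in> B" using Cons.prems by auto
  obtain as bs cs where IH: "mset ls = mset (labels as bs cs)" "set as \<subseteq> B" "set bs \<subseteq> B" "set cs \<subseteq> B"
    using Cons by auto
  consider "k = 1" | "k = 2" | "k = 3" using exhaust_3 by blast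
  then show ?case
  proof cases
    case 1
    then show ?thesis using IH l by (intro exI[of _ "b # as"] exI[of _ bs] exI[of _ cs]) (simp add: labels_def)
  next
    case 2
    then show ?thesis using IH l by (intro exI[of _ as] exI[of _ "b # bs"] exI[of _ cs]) (simp add: labels_def)
  next
    case 3
    then show ?thesis using IH l by (intro exI[of _ as] exI[of _ bs] exI[of _ "b # cs"]) (simp add: labels_def)
  qed
qed

lemma supersymmetric_labels:
  assumes Q: "supersymmetric Q" and "mset ls = mset ls'"
  shows "\<exists>c. Q (tensor_word (map letter ls)) = c *\<^sub>C Q (tensor_word (map letter ls'))"
  using supersymmetric_perm[OF Q, of "map letter ls" "map letter ls'" "[]"] letter_homogeneous assms(2)
  by fastforce

lemma tensor_word_span:
  assumes L: "cvec.span L = UNIV"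
  shows "tensor_word ws \<in> cvec.span {tensor_word ls |ls. length ls = length ws \<and> set ls \<subseteq> L}"
proof (induction ws)
  case Nil
  show ?case by (rule cvec.span_base) force
next
  case (Cons w ws)
  let ?S = "\<lambda>n. {tensor_word ls |ls. length ls = n \<and> set ls \<subseteq> L}"
  have letter: "tensor_incl x * t \<in> cvec.span (?S (Suc (length ws)))" if "x \<in> L" "t \<in> cvec.span (?S (length ws))" for x t
    using that(2)
  proof (induction rule: cvec.span_induct_alt)
    case (step c y z)
    then obtain ls where "y = tensor_word ls" "length ls = length ws" "set ls \<subseteq> L" by blast
    then have "tensor_incl x * y \<in> ?S (Suc (length ws))"
      using that(1) by (auto simp flip: tensor_word_Cons intro!: exI[of _ "x # ls"])
    then show ?case using step
      by (simp add: distrib_left scaleC_mult_right cvec.span_add cvec.span_scale cvec.span_base)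
  qed (simp add: cvec.span_zero)
  have "w \<in> cvec.span L" by (simp add: L)
  then have "tensor_incl w * tensor_word ws \<in> cvec.span (?S (Suc (length ws)))"
  proof (induction rule: cvec.span_induct_alt)
    case (step c y z)
    then show ?case using letter[OF step(1) Cons.IH]
      by (simp add: clinear_add[OF tensor_incl_linear] clinear_scale[OF tensor_incl_linear] distrib_right
          scaleC_mult_left cvec.span_add cvec.span_scale)
  qed (simp add: clinear_0[OF tensor_incl_linear] cvec.span_zero)
  then show ?case by (simp add: tensor_word_Cons)
qed

section \<open>Spanning words and coordinates of words in the basis letters\<close>

definition index_set :: "'a set \<Rightarrow> 'a list set \<Rightarrow> nat \<Rightarrow> ('a multiset \<times> 'a multiset \<times> 'a list) set" where
  "index_set B \<Xi> m = {(\<phi>\<^sub>1, \<phi>\<^sub>2, \<xi>). set_mset \<phi>\<^sub>1 \<subseteq> B \<and> set_mset \<phi>\<^sub>2 \<subseteq> B \<and> \<xi> \<in> \<Xi> \<and>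
    size \<phi>\<^sub>1 + size \<phi>\<^sub>2 + length \<xi> = m}"

definition index_word :: "'a multiset \<times> 'a multiset \<times> 'a list \<Rightarrow> (3 \<times> 'a) list" where
  "index_word = (\<lambda>(\<phi>\<^sub>1, \<phi>\<^sub>2, \<xi>). labels (list_of \<phi>\<^sub>1) (list_of \<phi>\<^sub>2) \<xi>)"

text \<open>For \<open>l\<close> with second entry in \<open>B\<close>, the functional dual to
  \<open>letter l\<close>; products of these give the coefficient of a given word in
  \<open>word_coordinate\<close>.\<close>

definition coordinate :: "'a::complex_comm_algebra set \<Rightarrow> 3 \<times> 'a \<Rightarrow> (natural_module, 'a) tensor \<Rightarrow> complex" where
  "coordinate B l = tensor_lift (\<lambda>v a. coords v $ fst l * cvec.representation B a (snd l))"

definition word_coordinate :: "'a::complex_comm_algebra set \<Rightarrow> (3 \<times> 'a) list \<Rightarrow> (natural_module, 'a) tensor tensor_algebra \<Rightarrow> complex" where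
  "word_coordinate B ls = multilinear_lift (\<lambda>ws. if length ws = length ls then \<Prod>j<length ls. coordinate B (ls ! j) (ws ! j) else 0)"

context
  fixes B :: "'a::complex_comm_algebra set"
  assumes independent: "cvec.independent B" and spanning: "cvec.span B = UNIV"
begin

lemma letters_span: "cvec.span (letter ` (UNIV \<times> B)) = UNIV"
proof -
  have basis: "Vec (axis k 1) \<otimes> a \<in> cvec.span (letter ` (UNIV \<times> B))" for k a
  proof -
    have "a \<in> cvec.span B" by (simp add: spanning)
    then show ?thesis
    proof (induction rule: cvec.span_induct_alt)
      case (step c b z)
      have "Vec (axis k 1) \<otimes> b \<in> letter ` (UNIV \<times> B)"
        using step(1) by (auto simp: letter_def intro!: image_eqI[of _ _ "(k, b)"])
      then show ?case using step(2) by (simp add: pure_tensor_simps cvec.span_add cvec.span_scale cvec.span_base)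
    qed (simp add: cvec.span_zero)
  qed
  have "x \<in> cvec.span (letter ` (UNIV \<times> B))" for x :: "(natural_module, 'a) tensor"
  proof (induction x rule: tensor_induct)
    case (pure v a)
    have "v = coords v $ 1 *\<^sub>C Vec (axis 1 1) + coords v $ 2 *\<^sub>C Vec (axis 2 1) + coords v $ 3 *\<^sub>C Vec (axis 3 1)"
      by (simp add: module_compute Vec_inverse)
    then have "v \<otimes> a = coords v $ 1 *\<^sub>C (Vec (axis 1 1) \<otimes> a) + coords v $ 2 *\<^sub>C (Vec (axis 2 1) \<otimes> a)
        + coords v $ 3 *\<^sub>C (Vec (axis 3 1) \<otimes> a)"
      by (metis pure_tensor_add_left pure_tensor_scale_left)
    then show ?case using basis by (simp add: cvec.span_add cvec.span_scale)
  qed (rule cvec.span_add)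
  then show ?thesis by blast
qed

lemma tensor_power_letters:
  "tensor_power m = cvec.span {tensor_word (map letter ls) |ls. length ls = m \<and> set ls \<subseteq> UNIV \<times> B}"
proof -
  let ?S = "{tensor_word (map letter ls) |ls. length ls = m \<and> set ls \<subseteq> UNIV \<times> B}"
  have "{tensor_word ls |ls. length ls = m \<and> set ls \<subseteq> letter ` (UNIV \<times> B)} \<subseteq> ?S"
  proof (clarify)
    fix ls :: "(natural_module, 'a) tensor list" assume "set ls \<subseteq> letter ` (UNIV \<times> B)"
    then have "\<exists>zs. set zs \<subseteq> UNIV \<times> B \<and> ls = map letter zs"
    proof (induction ls)
      case (Cons x ls)
      then obtain zs z where "set zs \<subseteq> UNIV \<times> B" "ls = map letter zs" "z \<in> UNIV \<times> B" "x = letter z"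
        by auto
      then show ?case by (intro exI[of _ "z # zs"]) simp
    qed simp
    then show "\<exists>zs. tensor_word ls = tensor_word (map letter zs) \<and> length zs = length ls \<and> set zs \<subseteq> UNIV \<times> B"
      by auto
  qed
  then have "tensor_word ws \<in> cvec.span ?S" if "length ws = m" for ws
    using tensor_word_span[OF letters_span, of ws] cvec.span_mono that by blast
  then show ?thesis
    unfolding tensor_power_def
    by (intro equalityI cvec.span_minimal[OF _ cvec.subspace_span] cvec.span_mono) auto
qed

text \<open>The letters are sorted by type. If the odd ones are distinct, they are brought into the
  order chosen in \<open>\<Xi>\<close>; if one is repeated, its two copies are made adjacent and the
  value is 0.\<close>

lemma supersymmetric_index_word:
  assumes Q: "supersymmetric Q" and \<Xi>: "orderings_of_subsets B \<Xi>" and ls: "set ls \<subseteq> UNIV \<times> B" "length ls = m"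
  shows "Q (tensor_word (map letter ls)) \<in> cvec.span ((\<lambda>i. Q (tensor_word (map letter (index_word i)))) ` index_set B \<Xi> m)"
proof -
  obtain as bs cs where sorted: "mset ls = mset (labels as bs cs)" "set as \<subseteq> B" "set bs \<subseteq> B" "set cs \<subseteq> B"
    using mset_labels[OF ls(1)] by blast
  have len: "length as + length bs + length cs = m"
    using arg_cong[OF sorted(1), of size] ls(2) by simp
  show ?thesis
  proof (cases "distinct cs")
    case True
    have "set cs \<in> set ` \<Xi>" using \<Xi> sorted(4) by (auto simp: orderings_of_subsets_def bij_betw_def)
    then obtain \<xi> where \<xi>: "\<xi> \<in> \<Xi>" "set \<xi> = set cs" by auto
    then have "mset \<xi> = mset cs" using True \<Xi> set_eq_iff_mset_eq_distinct by (auto simp: orderings_of_subsets_def)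
    then have "mset ls = mset (index_word (mset as, mset bs, \<xi>))" "length \<xi> = length cs"
      by (auto simp: sorted(1) index_word_def labels_def dest: mset_eq_length)
    moreover have "(mset as, mset bs, \<xi>) \<in> index_set B \<Xi> m"
      using sorted(2,3) \<xi> len \<open>length \<xi> = length cs\<close> by (simp add: index_set_def)
    moreover obtain c where "Q (tensor_word (map letter ls)) =
        c *\<^sub>C Q (tensor_word (map letter (index_word (mset as, mset bs, \<xi>))))"
      using supersymmetric_labels[OF Q calculation(1)] by blast
    ultimately show ?thesis
      by (metis (no_types, lifting) cvec.span_base cvec.span_scale image_eqI)
  next
    case False
    then obtain xs ys zs c where "cs = xs @ [c] @ ys @ [c] @ zs" using not_distinct_decomp by blast
    then have "mset ls = mset (labels as bs (xs @ ys @ zs) @ [(3, c), (3, c)])"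
      by (simp add: sorted(1) labels_def)
    from supersymmetric_labels[OF Q this] obtain d where
      "Q (tensor_word (map letter ls)) = d *\<^sub>C Q (tensor_word (map letter (labels as bs (xs @ ys @ zs) @ [(3, c), (3, c)])))"
      by blast
    also have "\<dots> = 0"
      using supersymmetric_repeated_odd[OF Q, of "letter (3, c)" "map letter (labels as bs (xs @ ys @ zs))" 1]
        letter_homogeneous[of "(3, c)"]
      by (simp add: tensor_word_append tensor_word_Cons)
    finally show ?thesis by (simp add: cvec.span_zero)
  qed
qed

lemma symmetrizer_span:
  assumes \<Xi>: "orderings_of_subsets B \<Xi>" and t: "t \<in> tensor_power m"
  shows "symmetrizer m t \<in> cvec.span ((\<lambda>i. symmetrizer m (tensor_word (map letter (index_word i)))) ` index_set B \<Xi> m)"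
  using t unfolding tensor_power_letters
proof (induction rule: cvec.span_induct_alt)
  case (step c y z)
  then show ?case
    using supersymmetric_index_word[OF symmetrizer_supersymmetric \<Xi>]
    by (auto simp: clinear_add[OF symmetrizer_linear] clinear_scale[OF symmetrizer_linear] intro!: cvec.span_add cvec.span_scale)
qed (simp add: clinear_0[OF symmetrizer_linear] cvec.span_zero)

lemma coordinate_bilinear: "cbilinear (\<lambda>v a. coords v $ k * cvec.representation B a b)"
  by (rule cbilinearI)
    (simp_all add: module_rep cvec.representation_add[OF independent] cvec.representation_scale[OF independent]
      spanning algebra_simps)

lemma coordinate_letter: "snd l' \<in> B \<Longrightarrow> coordinate B l (letter l') = (if l = l' then 1 else 0)"
  by (cases l; cases l')
    (auto simp: coordinate_def coordinate_bilinear letter_def Vec_inverse axis_def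
      cvec.representation_basis[OF independent])

lemma word_coordinate_multilinear:
  "multilinear (\<lambda>ws. if length ws = length ls then \<Prod>j<length ls. coordinate B (ls ! j) (ws ! j) else 0)"
  unfolding multilinear_def length_list_update
proof (intro allI impI)
  fix ws :: "(natural_module, 'a) tensor list" and i assume i: "i < length ws"
  show "clinear (\<lambda>v. if length ws = length ls then \<Prod>j<length ls. coordinate B (ls ! j) (ws[i := v] ! j) else 0)"
  proof (cases "length ws = length ls")
    case True
    have "(\<Prod>j<length ls. coordinate B (ls ! j) (ws[i := v] ! j)) =
        (\<Prod>j\<in>{..<length ls} - {i}. coordinate B (ls ! j) (ws ! j)) *\<^sub>C coordinate B (ls ! i) v" for v
    proof -
      have "(\<Prod>j<length ls. coordinate B (ls ! j) (ws[i := v] ! j)) = coordinate B (ls ! i) (ws[i := v] ! i) *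
          (\<Prod>j\<in>{..<length ls} - {i}. coordinate B (ls ! j) (ws[i := v] ! j))"
        by (rule prod.remove) (use i True in auto)
      also have "(\<Prod>j\<in>{..<length ls} - {i}. coordinate B (ls ! j) (ws[i := v] ! j)) =
          (\<Prod>j\<in>{..<length ls} - {i}. coordinate B (ls ! j) (ws ! j))"
        by (rule prod.cong) auto
      finally show ?thesis using i by simp
    qed
    moreover have "clinear (coordinate B l)" for l
      unfolding coordinate_def by (rule tensor_lift_linear[OF coordinate_bilinear])
    then have "clinear (\<lambda>v. k * coordinate B l v)" for k l
      using clinear_scaled[of "coordinate B l" k] by simp
    ultimately show ?thesis using True by simp
  qed (simp add: clinear_zero)
qed

lemma word_coordinate_linear: "clinear (word_coordinate B ls)"
  unfolding word_coordinate_def by (rule multilinear_lift_linear[OF word_coordinate_multilinear])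

lemma word_coordinate_word:
  assumes "length ls' = length ls" "set ls' \<subseteq> UNIV \<times> B"
  shows "word_coordinate B ls (tensor_word (map letter ls')) = (if ls = ls' then 1 else 0)"
proof -
  have "coordinate B (ls ! j) (letter (ls' ! j)) = (if ls ! j = ls' ! j then 1 else 0)" if "j < length ls" for j
  proof -
    have "ls' ! j \<in> UNIV \<times> B" using that assms by (metis nth_mem subsetD)
    then show ?thesis by (intro coordinate_letter) auto
  qed
  then have "word_coordinate B ls (tensor_word (map letter ls')) = (\<Prod>j<length ls. if ls ! j = ls' ! j then 1 else 0)"
    using assms(1) by (simp add: word_coordinate_def word_coordinate_multilinear)
  also have "\<dots> = (if ls = ls' then 1 else 0)"
    using assms(1) by (auto simp: list_eq_iff_nth_eq)
  finally show ?thesis .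
qed

lemma word_coordinate_symmetrizer:
  assumes ls': "length ls' = length ls" "set ls' \<subseteq> UNIV \<times> B"
  shows "word_coordinate B ls (symmetrizer (length ls) (tensor_word (map letter ls'))) =
    (\<Sum>\<sigma> | \<sigma> permutes {..<length ls} \<and> map (\<lambda>j. ls' ! \<sigma> j) [0..<length ls] = ls.
      koszul_sign (map (\<lambda>l. fst l = 3) ls') \<sigma>)"
proof -
  let ?m = "length ls" and ?g = "\<lambda>\<sigma>. map (\<lambda>j. ls' ! \<sigma> j) [0..<length ls]" and ?es = "map (\<lambda>l. fst l = 3) ls'"
  have "word_coordinate B ls (permute_act ?m \<sigma> (tensor_word (map letter ls'))) =
      (if ?g \<sigma> = ls then koszul_sign ?es \<sigma> else 0)" if \<sigma>: "\<sigma> permutes {..<?m}" for \<sigma>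
  proof -
    have lt: "\<sigma> j < ?m \<longleftrightarrow> j < ?m" for j using permutes_in_image[OF \<sigma>, of j] by simp
    have "list_all2 homogeneous ?es (map letter ls')"
      by (simp add: list_all2_conv_all_nth letter_homogeneous)
    then have "permute_act ?m \<sigma> (tensor_word (map letter ls')) = koszul_sign ?es \<sigma> *\<^sub>C
        tensor_word (map (\<lambda>j. map letter ls' ! \<sigma> j) [0..<?m])"
      using ls'(1) by (intro permute_act_homogeneous_word[OF \<sigma>]) auto
    also have "map (\<lambda>j. map letter ls' ! \<sigma> j) [0..<?m] = map letter (?g \<sigma>)"
      using lt ls'(1) by simp
    finally have "word_coordinate B ls (permute_act ?m \<sigma> (tensor_word (map letter ls'))) =
        koszul_sign ?es \<sigma> * word_coordinate B ls (tensor_word (map letter (?g \<sigma>)))"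
      by (simp only: clinear_scale[OF word_coordinate_linear] scaleC_complex_eq)
    moreover have "set (?g \<sigma>) \<subseteq> UNIV \<times> B"
    proof
      fix x assume "x \<in> set (?g \<sigma>)"
      then obtain j where "j < ?m" "x = ls' ! \<sigma> j" by auto
      then have "x \<in> set ls'" using lt[of j] ls'(1) by simp
      then show "x \<in> UNIV \<times> B" using ls'(2) by blast
    qed
    ultimately show ?thesis by (subst (asm) word_coordinate_word) auto
  qed
  then show ?thesis
    by (simp add: symmetrizer_def clinear_sum[OF word_coordinate_linear] sum.If_cases finite_permutations Collect_conj_eq)
qed

end

lemma filter_labels:
  "filter (\<lambda>l. fst l = 1) (labels as bs cs) = map (Pair 1) as"
  "filter (\<lambda>l. fst l = 2) (labels as bs cs) = map (Pair 2) bs"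
  "filter (\<lambda>l. fst l = 3) (labels as bs cs) = map (Pair 3) cs"
  by (simp_all add: labels_def filter_map o_def)

lemma mset_labels_eqD:
  assumes "mset (labels as bs cs) = mset (labels as' bs' cs')"
  shows "mset as = mset as'" "mset bs = mset bs'" "mset cs = mset cs'"
proof -
  have "mset (map snd (filter (\<lambda>l. fst l = k) (labels as bs cs))) = mset (map snd (filter (\<lambda>l. fst l = k) (labels as' bs' cs')))" for k
    using assms by (simp only: mset_map mset_filter)
  from this[of 1] this[of 2] this[of 3] show "mset as = mset as'" "mset bs = mset bs'" "mset cs = mset cs'"
    by (simp_all add: filter_labels o_def del: mset_map)
qed

lemma distinct_filter_nth_eq:
  "distinct (filter P xs) \<Longrightarrow> i < length xs \<Longrightarrow> j < length xs \<Longrightarrow> xs ! i = xs ! j \<Longrightarrow> P (xs ! i) \<Longrightarrow> i = j"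
proof (induction xs arbitrary: i j)
  case (Cons x xs)
  show ?case
  proof (cases i)
    case i: 0
    show ?thesis
    proof (cases j)
      case (Suc j')
      then have "x \<in> set xs" "P x" using i Cons.prems by auto
      then show ?thesis using Cons.prems by simp
    qed (use i in simp)
  next
    case i: (Suc i')
    show ?thesis
    proof (cases j)
      case 0
      then have "x \<in> set xs" "P x" using i Cons.prems nth_mem[of i' xs] by auto
      then show ?thesis using Cons.prems by simp
    next
      case (Suc j')
      then show ?thesis using i Cons.IH[of i' j'] Cons.prems by (auto split: if_splits)
    qed
  qed
qed simp

text \<open>A permutation fixing a word without repeated odd letters fixes the positions of its odd
  letters, hence has no odd-odd inversions.\<close>

lemma koszul_sign_stabilizer:
  assumes \<sigma>: "\<sigma> permutes {..<length ls}" and stab: "map (\<lambda>j. ls ! \<sigma> j) [0..<length ls] = ls"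
    and distinct: "distinct (filter P ls)"
  shows "koszul_sign (map P ls) \<sigma> = 1"
  unfolding koszul_sign_def
proof (rule prod.neutral, clarify)
  fix j k assume jk: "j < k" "k < length (map P ls)" "\<sigma> k < \<sigma> j"
  have lt: "\<sigma> i < length ls \<longleftrightarrow> i < length ls" for i using permutes_in_image[OF \<sigma>, of i] by simp
  have eq: "ls ! \<sigma> i = ls ! i" if "i < length ls" for i
    using arg_cong[OF stab, of "\<lambda>xs. xs ! i"] that by simp
  have fixed: "\<sigma> i = i" if "i < length ls" "P (ls ! \<sigma> i)" for i
    using distinct_filter_nth_eq[OF distinct _ _ eq[OF that(1)] that(2)] lt that(1) by simp
  have "\<not> (P (ls ! \<sigma> j) \<and> P (ls ! \<sigma> k))"
    using fixed[of j] fixed[of k] jk by auto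
  then show "koszul (map P ls ! \<sigma> j) (map P ls ! \<sigma> k) = 1"
    using jk lt[of j] lt[of k] by (simp add: koszul_def)
qed

section \<open>Detecting bases of a quotient through a linear map\<close>

lemma span_image_lin_ext:
  assumes "x \<in> cvec.span (f ` I)"
  shows "\<exists>c. Poly_Mapping.keys c \<subseteq> I \<and> lin_ext f c = x"
  using assms
proof (induction rule: cvec.span_induct_alt)
  case base
  show ?case by (rule exI[of _ 0]) (simp add: lin_ext_def)
next
  case (step a y z)
  then obtain i c where i: "i \<in> I" "y = f i" and c: "Poly_Mapping.keys c \<subseteq> I" "lin_ext f c = z" by blast
  have "Poly_Mapping.keys (Poly_Mapping.single i a + c) \<subseteq> I"
    using Poly_Mapping.keys_add[of "Poly_Mapping.single i a" c] i(1) c(1) by (auto split: if_splits)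
  moreover have "lin_ext f (Poly_Mapping.single i a + c) = a *\<^sub>C y + z"
    by (simp add: clinear_add[OF lin_ext_linear] i c)
  ultimately show ?case by blast
qed

lemma coset_eq_iff:
  assumes J: "cvec.subspace J"
  shows "a +o J = b +o J \<longleftrightarrow> a - b \<in> J"
proof
  assume "a +o J = b +o J"
  moreover have "a \<in> a +o J" using cvec.subspace_0[OF J] by (force simp: elt_set_plus_def)
  ultimately show "a - b \<in> J" by (auto simp: elt_set_plus_def)
next
  have sub: "a +o J \<subseteq> b +o J" if "a - b \<in> J" for a b
  proof
    fix x assume "x \<in> a +o J"
    then obtain j where "j \<in> J" "x = a + j" by (auto simp: elt_set_plus_def)
    then have "(a - b) + j \<in> J" "x = b + ((a - b) + j)" using cvec.subspace_add[OF J that] by auto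
    then show "x \<in> b +o J" unfolding elt_set_plus_def by blast
  qed
  assume ab: "a - b \<in> J"
  then have "b - a \<in> J" using cvec.subspace_neg[OF J] by fastforce
  then show "a +o J = b +o J" using sub ab by blast
qed

text \<open>\<open>E\<close> embeds the quotient by \<open>J\<close>, so the expansions of a coset
  are those of its image: \<open>span\<close> yields existence and \<open>indep\<close>
  uniqueness.\<close>

lemma coset_basisI:
  fixes E :: "'u::complex_vector \<Rightarrow> 'v::complex_vector"
  assumes J: "cvec.subspace J" and E: "clinear E" and ker: "\<And>u. E u = 0 \<longleftrightarrow> u \<in> J"
    and span: "\<And>u. E u \<in> cvec.span ((\<lambda>i. E (P i)) ` I)"
    and indep: "\<And>c. Poly_Mapping.keys c \<subseteq> I \<Longrightarrow> lin_ext (\<lambda>i. E (P i)) c = 0 \<Longrightarrow> c = 0"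
  shows "coset_basis J I (\<lambda>i. P i +o J)"
proof -
  have eq: "coset_lincomb J c (\<lambda>i. P i +o J) = u +o J \<longleftrightarrow> lin_ext (\<lambda>i. E (P i)) c = E u" for c u
    unfolding coset_lincomb[OF J] coset_eq_iff[OF J] lin_ext_comp[OF E] ker[symmetric] clinear_diff[OF E]
    by (simp add: lin_ext_def)
  show ?thesis
    unfolding coset_basis_def
  proof (intro conjI ballI)
    show "(\<lambda>i. P i +o J) ` I \<subseteq> coset_space J" by (auto simp: coset_space_def)
    fix X assume "X \<in> coset_space J"
    then obtain u where u: "X = u +o J" by (auto simp: coset_space_def)
    obtain c where c: "Poly_Mapping.keys c \<subseteq> I" "lin_ext (\<lambda>i. E (P i)) c = E u"
      using span_image_lin_ext[OF span] by blast
    have "c' = c" if "Poly_Mapping.keys c' \<subseteq> I" "lin_ext (\<lambda>i. E (P i)) c' = E u" for c'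
    proof -
      have "Poly_Mapping.keys (c' - c) \<subseteq> I" using Poly_Mapping.keys_diff[of c' c] that(1) c(1) by blast
      then show ?thesis using indep[of "c' - c"] that(2) c(2) by (simp add: clinear_diff[OF lin_ext_linear])
    qed
    then show "\<exists>!c. Poly_Mapping.keys c \<subseteq> I \<and> coset_lincomb J c (\<lambda>i. P i +o J) = X"
      unfolding u eq using c by blast
  qed
qed

section \<open>The basis given by the elements p\<close>

context
  fixes B :: "'a::complex_comm_algebra set" and \<Xi> :: "'a list set"
  assumes independent: "cvec.independent B" and spanning: "cvec.span B = UNIV"
    and \<Xi>: "orderings_of_subsets B \<Xi>"
begin

lemma ordering: "\<xi> \<in> \<Xi> \<Longrightarrow> distinct \<xi>" "\<xi> \<in> \<Xi> \<Longrightarrow> set \<xi> \<subseteq> B"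
  "\<xi> \<in> \<Xi> \<Longrightarrow> \<xi>' \<in> \<Xi> \<Longrightarrow> mset \<xi> = mset \<xi>' \<Longrightarrow> \<xi> = \<xi>'"
proof -
  show "\<xi> \<in> \<Xi> \<Longrightarrow> distinct \<xi>" "\<xi> \<in> \<Xi> \<Longrightarrow> set \<xi> \<subseteq> B"
    using \<Xi> by (auto simp: orderings_of_subsets_def bij_betw_def)
  show "\<xi> \<in> \<Xi> \<Longrightarrow> \<xi>' \<in> \<Xi> \<Longrightarrow> mset \<xi> = mset \<xi>' \<Longrightarrow> \<xi> = \<xi>'"
    using \<Xi> mset_eq_setD[of \<xi> \<xi>'] by (auto simp: orderings_of_subsets_def bij_betw_def inj_on_def)
qed

lemma index_word:
  assumes "i \<in> index_set B \<Xi> m"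
  shows "length (index_word i) = m" "set (index_word i) \<subseteq> UNIV \<times> B"
    "distinct (filter (\<lambda>l. fst l = 3) (index_word i))"
proof -
  obtain \<phi>1 \<phi>2 \<xi> where i: "i = (\<phi>1, \<phi>2, \<xi>)" "set_mset \<phi>1 \<subseteq> B" "set_mset \<phi>2 \<subseteq> B" "\<xi> \<in> \<Xi>"
    "size \<phi>1 + size \<phi>2 + length \<xi> = m"
    using assms by (auto simp: index_set_def)
  show "length (index_word i) = m" using i(5) by (simp add: index_word_def i(1))
  show "set (index_word i) \<subseteq> UNIV \<times> B" using i ordering(2)[OF i(4)] by (auto simp: index_word_def labels_def)
  show "distinct (filter (\<lambda>l. fst l = 3) (index_word i))"
    using ordering(1)[OF i(4)] by (simp add: index_word_def i(1) filter_labels distinct_map inj_on_def)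
qed

lemma index_word_inj:
  assumes "i \<in> index_set B \<Xi> m" "i' \<in> index_set B \<Xi> m" "mset (index_word i) = mset (index_word i')"
  shows "i = i'"
proof -
  obtain \<phi>1 \<phi>2 \<xi> \<psi>1 \<psi>2 \<xi>' where i: "i = (\<phi>1, \<phi>2, \<xi>)" "i' = (\<psi>1, \<psi>2, \<xi>')" by (cases i; cases i')
  have \<xi>: "\<xi> \<in> \<Xi>" "\<xi>' \<in> \<Xi>" using assms(1,2) by (auto simp: index_set_def i)
  have "mset (labels (list_of \<phi>1) (list_of \<phi>2) \<xi>) = mset (labels (list_of \<psi>1) (list_of \<psi>2) \<xi>')"
    using assms(3) by (simp add: index_word_def i)
  from mset_labels_eqD[OF this] show ?thesis using ordering(3)[OF \<xi>] by (simp add: i)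
qed

abbreviation sym_word :: "nat \<Rightarrow> 'a multiset \<times> 'a multiset \<times> 'a list \<Rightarrow> (natural_module, 'a) tensor tensor_algebra" where
  "sym_word m i \<equiv> symmetrizer m (tensor_word (map letter (index_word i)))"

text \<open>A permutation carries one index word to another only if their multisets of letters
  agree, which forces equal indices. For equal indices the coordinate is the order of the stabilizer
  of the word, all signs there being 1.\<close>

lemma coordinate_sym_word:
  assumes i: "i \<in> index_set B \<Xi> m" and i': "i' \<in> index_set B \<Xi> m"
  shows "word_coordinate B (index_word i) (sym_word m i') = 0 \<longleftrightarrow> i \<noteq> i'"
proof -
  let ?S = "\<lambda>i'. {\<sigma>. \<sigma> permutes {..<m} \<and> map (\<lambda>j. index_word i' ! \<sigma> j) [0..<m] = index_word i}"
  note len = index_word(1)[OF i] index_word(1)[OF i']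
  have val: "word_coordinate B (index_word i) (sym_word m i') =
      (\<Sum>\<sigma>\<in>?S i'. koszul_sign (map (\<lambda>l. fst l = 3) (index_word i')) \<sigma>)"
    using word_coordinate_symmetrizer[OF independent spanning, of "index_word i'" "index_word i"]
      index_word(2)[OF i'] len by simp
  have same: "i = i'" if "\<sigma> \<in> ?S i'" for \<sigma>
  proof -
    have "\<sigma> permutes {..<length (index_word i')}" "map (\<lambda>j. index_word i' ! \<sigma> j) [0..<length (index_word i')] = index_word i"
      using that len by auto
    then have "mset (index_word i) = mset (index_word i')"
      using mset_permute_list[of \<sigma> "index_word i'"] by (simp add: permute_list_def)
    then show ?thesis by (rule index_word_inj[OF i i'])
  qed
  have nonzero: "(\<Sum>\<sigma>\<in>?S i. koszul_sign (map (\<lambda>l. fst l = 3) (index_word i)) \<sigma>) \<noteq> 0"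
  proof -
    \<comment> \<open>The odd letters of an index word are distinct, so no signs can cancel.\<close>
    have sum: "(\<Sum>\<sigma>\<in>?S i. koszul_sign (map (\<lambda>l. fst l = 3) (index_word i)) \<sigma>) = (\<Sum>\<sigma>\<in>?S i. 1)"
      using index_word(1,3)[OF i] by (intro sum.cong refl koszul_sign_stabilizer) auto
    have "finite (?S i)" by (rule finite_subset[OF _ finite_permutations[of "{..<m}"]]) auto
    moreover have "id \<in> ?S i" using map_nth[of "index_word i"] len(1) by (simp add: permutes_id)
    ultimately have "card (?S i) \<noteq> 0" using card_gt_0_iff by blast
    then show ?thesis by (simp only: sum sum_constant) simp
  qed
  show ?thesis
  proof (cases "i = i'")
    case True
    then show ?thesis using nonzero val by (simp only: simp_thms)
  next
    case False
    then have "?S i' = {}" using same by blast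
    then show ?thesis using False by (simp only: val sum.empty) simp
  qed
qed

text \<open>The coordinate of the word of \<open>i\<close> isolates the coefficient at
  \<open>i\<close>. The scalars \<open>k i\<close> allow for the signs and factorials by which the
  elements \<open>p_elem\<close> differ from symmetrized words.\<close>

lemma sym_word_independent:
  assumes c: "Poly_Mapping.keys c \<subseteq> index_set B \<Xi> m" and zero: "lin_ext (\<lambda>i. k i *\<^sub>C sym_word m i) c = 0"
    and k: "\<And>i. k i \<noteq> 0"
  shows "c = 0"
proof (rule poly_mapping_eqI)
  fix i
  show "Poly_Mapping.lookup c i = Poly_Mapping.lookup 0 i"
  proof (cases "i \<in> Poly_Mapping.keys c")
    case True
    let ?f = "word_coordinate B (index_word i)"
    note lin = word_coordinate_linear[OF independent spanning, of "index_word i"]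
    have others: "?f (sym_word m j) = 0" if "j \<in> Poly_Mapping.keys c" "j \<noteq> i" for j
      using coordinate_sym_word[of i m j] that True c by blast
    have "0 = ?f (lin_ext (\<lambda>i. k i *\<^sub>C sym_word m i) c)" by (simp add: zero clinear_0[OF lin])
    also have "\<dots> = (\<Sum>j\<in>Poly_Mapping.keys c. Poly_Mapping.lookup c j * (k j * ?f (sym_word m j)))"
      by (simp add: lin_ext_def clinear_sum[OF lin] clinear_scale[OF lin] mult.assoc)
    also have "\<dots> = (\<Sum>j\<in>{i}. Poly_Mapping.lookup c j * (k j * ?f (sym_word m j)))"
      using True c by (intro sum.mono_neutral_right) (auto simp: others)
    finally show ?thesis
      using k[of i] coordinate_sym_word[of i m i] True c by auto
  qed (simp add: in_keys_iff)
qed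

lemma p_elem_basis:
  "coset_basis (weyl_ideal m) (index_set B \<Xi> m) (\<lambda>(\<phi>\<^sub>1, \<phi>\<^sub>2, \<xi>). weyl_act m (p_elem \<phi>\<^sub>1 \<phi>\<^sub>2 \<xi>) (weyl_gen m))"
proof -
  let ?E = "\<lambda>u. uea_act natural_word_act u (top_vector m) :: (natural_module, 'a) tensor tensor_algebra"
  let ?P = "\<lambda>(\<phi>\<^sub>1, \<phi>\<^sub>2, \<xi>). p_elem \<phi>\<^sub>1 \<phi>\<^sub>2 (\<xi> :: 'a list)"
  define k where "k = (\<lambda>(\<phi>\<^sub>1, \<phi>\<^sub>2, \<xi> :: 'a list). (-1) ^ (size \<phi>\<^sub>2 + size \<phi>\<^sub>1) / (mfact (\<phi>\<^sub>2 :: 'a multiset) * mfact (\<phi>\<^sub>1 :: 'a multiset)))"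
  have k: "k i \<noteq> 0" for i by (cases i) (simp add: k_def)
  have E: "?E (?P i) = k i *\<^sub>C sym_word m i" if "i \<in> index_set B \<Xi> m" for i
  proof -
    obtain \<phi>1 \<phi>2 \<xi> where i: "i = (\<phi>1, \<phi>2, \<xi>)" by (cases i)
    have "tensor_word (map letter (index_word i)) \<in> tensor_power m"
      using index_word(1)[OF that] by (intro tensor_word_in_power) simp
    then have "top.monomial m \<phi>1 \<phi>2 \<xi> = sym_word m i"
      by (simp add: top.monomial_def standard_word_labels i index_word_def top_polar)
    then show ?thesis by (simp add: i top.p_elem_monomial k_def)
  qed
  have img: "(\<lambda>i. ?E (?P i)) ` index_set B \<Xi> m = (\<lambda>i. k i *\<^sub>C sym_word m i) ` index_set B \<Xi> m"
    by (rule image_cong[OF refl E])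
  have span: "sym_word m i \<in> cvec.span ((\<lambda>i. ?E (?P i)) ` index_set B \<Xi> m)" if "i \<in> index_set B \<Xi> m" for i
  proof -
    have "inverse (k i) *\<^sub>C k i *\<^sub>C sym_word m i \<in> cvec.span ((\<lambda>i. k i *\<^sub>C sym_word m i) ` index_set B \<Xi> m)"
      using that by (intro cvec.span_scale cvec.span_base) blast
    then show ?thesis by (simp add: img scaleC_scaleC k)
  qed
  have "coset_basis (weyl_ideal m) (index_set B \<Xi> m) (\<lambda>i. ?P i +o weyl_ideal m)"
  proof (rule coset_basisI[OF subspace_weyl_ideal uea_act_left_linear[OF nat_mod.D_representation] kernel_top_vector])
    fix u :: "(sl21, 'a) tensor uea"
    have "?E u \<in> symmetrized_power m" by (simp flip: range_top_vector)
    then obtain t where t: "t \<in> tensor_power m" "?E u = symmetrizer m t" by (auto simp: symmetrized_power_image)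
    show "?E u \<in> cvec.span ((\<lambda>i. ?E (?P i)) ` index_set B \<Xi> m)"
      using symmetrizer_span[OF independent spanning \<Xi> t(1)] span
        cvec.span_minimal[OF _ cvec.subspace_span, of "sym_word m ` index_set B \<Xi> m" "(\<lambda>i. ?E (?P i)) ` index_set B \<Xi> m"]
      unfolding t(2) by blast
  next
    fix c assume c: "Poly_Mapping.keys c \<subseteq> index_set B \<Xi> m" "lin_ext (\<lambda>i. ?E (?P i)) c = 0"
    have "lin_ext (\<lambda>i. k i *\<^sub>C sym_word m i) c = lin_ext (\<lambda>i. ?E (?P i)) c"
      unfolding lin_ext_def by (rule sum.cong) (use c(1) E in auto)
    then show "c = 0" using c sym_word_independent[OF c(1) _ k] by simp
  qed
  moreover have "(\<lambda>i. ?P i +o weyl_ideal m) = (\<lambda>(\<phi>\<^sub>1, \<phi>\<^sub>2, \<xi>). weyl_act m (p_elem \<phi>\<^sub>1 \<phi>\<^sub>2 \<xi>) (weyl_gen m))"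
    by (auto simp: weyl_gen_def weyl_act_coset)
  ultimately show ?thesis by simp
qed

end

theorem theorem3p2p1:
  fixes B :: "'a::complex_comm_algebra set" and m :: nat
  assumes "cvec.independent B" and "cvec.span B = UNIV"
  shows
    "(\<exists>\<Phi>. bij_betw \<Phi> (weyl_module m :: (sl21, 'a) tensor uea set set) (symmetrized_power m) \<and>
        (\<forall>X\<in>weyl_module m. \<forall>Y\<in>weyl_module m. \<Phi> (X + Y) = \<Phi> X + \<Phi> Y) \<and>
        (\<forall>u. \<forall>X\<in>weyl_module m.
          \<Phi> (weyl_act m u X) = uea_act (coproduct_act map_natural_act) u (\<Phi> X)) \<and>
        \<Phi> (weyl_gen m) = tensor_word (replicate m (v1 \<otimes> 1))) \<and>
     (\<forall>\<Xi>. orderings_of_subsets B \<Xi> \<longrightarrow>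
        coset_basis (weyl_ideal m)
          {(\<phi>\<^sub>1, \<phi>\<^sub>2, \<xi>). set_mset \<phi>\<^sub>1 \<subseteq> B \<and> set_mset \<phi>\<^sub>2 \<subseteq> B \<and> \<xi> \<in> \<Xi> \<and>
             size \<phi>\<^sub>1 + size \<phi>\<^sub>2 + length \<xi> = m}
          (\<lambda>(\<phi>\<^sub>1, \<phi>\<^sub>2, \<xi>). weyl_act m (p_elem \<phi>\<^sub>1 \<phi>\<^sub>2 \<xi>) (weyl_gen m)))"
proof (intro conjI allI impI)
  show "coset_basis (weyl_ideal m)
      {(\<phi>\<^sub>1, \<phi>\<^sub>2, \<xi>). set_mset \<phi>\<^sub>1 \<subseteq> B \<and> set_mset \<phi>\<^sub>2 \<subseteq> B \<and> \<xi> \<in> \<Xi> \<and> size \<phi>\<^sub>1 + size \<phi>\<^sub>2 + length \<xi> = m}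
      (\<lambda>(\<phi>\<^sub>1, \<phi>\<^sub>2, \<xi>). weyl_act m (p_elem \<phi>\<^sub>1 \<phi>\<^sub>2 \<xi>) (weyl_gen m))"
    if "orderings_of_subsets B \<Xi>" for \<Xi>
    using p_elem_basis[OF assms that, of m] by (simp add: index_set_def)
  let ?J = "weyl_ideal m :: (sl21, 'a) tensor uea set"
  let ?E = "\<lambda>u. uea_act natural_word_act u (top_vector m) :: (natural_module, 'a) tensor tensor_algebra"
  \<comment> \<open>The value is computed from a chosen representative; \<open>E_eq\<close> below
    gives both independence of this choice and injectivity.\<close>
  define \<Phi> where "\<Phi> X = ?E (SOME u. X = u +o ?J)" for X
  note J = subspace_weyl_ideal[where 'a = 'a, of m]
  note act = uea_act[OF nat_mod.D_representation]
  have E_eq: "?E u = ?E u' \<longleftrightarrow> u +o ?J = u' +o ?J" for u u'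
    using kernel_top_vector[of "u - u'" m]
    by (simp add: coset_eq_iff[OF J] clinear_diff[OF uea_act_left_linear[OF nat_mod.D_representation]])
  have \<Phi>: "\<Phi> (u +o ?J) = ?E u" for u
  proof -
    have "u +o ?J = (SOME u'. u +o ?J = u' +o ?J) +o ?J" by (rule someI[of _ u]) (rule refl)
    from this[symmetric] show ?thesis unfolding \<Phi>_def E_eq .
  qed
  have W: "X \<in> weyl_module m \<longleftrightarrow> (\<exists>u. X = u +o ?J)" for X
    by (auto simp: weyl_module_def coset_space_def)
  show "\<exists>\<Phi>. bij_betw \<Phi> (weyl_module m :: (sl21, 'a) tensor uea set set) (symmetrized_power m) \<and>
        (\<forall>X\<in>weyl_module m. \<forall>Y\<in>weyl_module m. \<Phi> (X + Y) = \<Phi> X + \<Phi> Y) \<and>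
        (\<forall>u. \<forall>X\<in>weyl_module m.
          \<Phi> (weyl_act m u X) = uea_act (coproduct_act map_natural_act) u (\<Phi> X)) \<and>
        \<Phi> (weyl_gen m) = tensor_word (replicate m (v1 \<otimes> 1))"
  proof (intro exI[of _ \<Phi>] conjI ballI allI)
    show "bij_betw \<Phi> (weyl_module m) (symmetrized_power m)"
    proof (rule bij_betw_imageI)
      show "inj_on \<Phi> (weyl_module m)" by (rule inj_onI) (auto simp: W \<Phi> E_eq)
      have "\<Phi> ` weyl_module m = range ?E" by (auto simp: weyl_module_def coset_space_def \<Phi> image_image)
      then show "\<Phi> ` weyl_module m = symmetrized_power m" by (simp only: range_top_vector)
    qed
    show "\<Phi> (X + Y) = \<Phi> X + \<Phi> Y" if "X \<in> weyl_module m" "Y \<in> weyl_module m" for X Y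
      using that by (auto simp: W coset_add[OF J] \<Phi> act)
    show "\<Phi> (weyl_act m u X) = uea_act (coproduct_act map_natural_act) u (\<Phi> X)" if "X \<in> weyl_module m" for u X
      using that by (auto simp: W weyl_act_coset \<Phi> act)
    show "\<Phi> (weyl_gen m) = tensor_word (replicate m (v1 \<otimes> 1))"
      by (simp add: weyl_gen_def \<Phi> act tensor_incl_power)
  qed
qed

end
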